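(* Let $(Q,g)$ be a complete connected Riemannian manifold, $T>0$, $(q_0,v_0),(q_T,v_T)\in TQ$, $p\in Q$, $0<r<r^\ast<R$, and $0\le V^-\le V^\ast$. Let $V:Q\to\mathbb{R}$ be a smooth non-negative function such that $V\ge V^\ast$ on $B_{r^\ast}(p)$ and $V\le V^-$ on $Q\setminus\overline{B_R}(p)$. Assume that obstacle avoidance is feasible with the tolerance $R$, and fix a reference trajectory $q\in\Omega$, i.e. a curve $q\in\Omega$ with $q(t)\in Q\setminus\overline{B_R}(p)$ for all $t\in[0,T]$. Define the non-negative real numbers $$a:=\sup_{t\in[0,T]}\left\|\frac{D}{dt}\dot q(t)\right\|,\qquad c:=(a^2+V^-)T,\qquad v:=\sqrt{cT}+\sqrt{cT+\|v_0\|^2}$$ (where the reference trajectory is such that $a<\infty$). If $$V^\ast>\frac{cv}{2(r^\ast-r)},$$ then any minimizer $q^\ast$ of $J$ on $\Omega$ avoids $p$ with tolerance $r$, i.e. $q^\ast(t)\notin B_r(p)$ for all $t\in[0,T]$.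
   Context: $Q$ is finite-dimensional. $\frac{D}{dt}$ is the covariant derivative along a curve for the Levi-Civita connection, $\frac{D^2q}{dt^2}=\frac{D}{dt}\dot q$, and $\|\cdot\|$ is the norm induced by $g$. $B_s(p)$ is the open ball of radius $s$ about $p$ for the Riemannian distance $d$, and $\overline{B_s}(p)$ is its topological closure. $H^2([0,T];Q)$ is the set of curves $q:[0,T]\to Q$ whose local chart expressions (on closed subintervals mapped into a chart domain) are of Sobolev class $H^2=W^{2,2}$. $\Omega$ is the set of $q\in H^2([0,T];Q)$ with $q(0)=q_0$, $q(T)=q_T$, $\dot q(0)=v_0$, $\dot q(T)=v_T$. The functional $J:\Omega\to\mathbb{R}$ is $$J(q)=\frac12\int_0^T\left(\left\|\frac{D^2q}{dt^2}(t)\right\|^2+V(q(t))\right)dt .$$ A minimizer of $J$ is a curve $q^\ast\in\Omega$ with $J(q^\ast)\le J(\tilde q)$ for all $\tilde q\in\Omega$. A curve $q\in\Omega$ avoids the obstacle $p$ with tolerance $s$ if $q(t)\notin B_s(p)$ for all $t\in[0,T]$; obstacle avoidance with tolerance $s$ is feasible if such a curve in $\Omega$ exists. *)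

theory Defs
  imports "HOL-Analysis.Analysis"
begin

text \<open>Only meant for open \<open>S\<close>: existence and continuity of the partial derivatives of order
  \<open>\<le> k\<close> is expressed through iterated directional derivatives.\<close>

primrec Ck_on :: "nat \<Rightarrow> 'a::euclidean_space set \<Rightarrow> ('a \<Rightarrow> 'b::real_normed_vector) \<Rightarrow> bool" where
  "Ck_on 0 S f \<longleftrightarrow> continuous_on S f"
| "Ck_on (Suc k) S f \<longleftrightarrow>
     (\<forall>x\<in>S. f differentiable (at x)) \<and> (\<forall>u. Ck_on k S (\<lambda>x. frechet_derivative f (at x) u))"

definition smooth_on :: "'a::euclidean_space set \<Rightarrow> ('a \<Rightarrow> 'b::real_normed_vector) \<Rightarrow> bool" where
  "smooth_on S f \<longleftrightarrow> (\<forall>k. Ck_on k S f)"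

text \<open>The manifold is the whole type \<open>'q\<close>, with its topology; it is modelled on \<open>'e\<close>, so its
  dimension is \<open>DIM('e)\<close>. A chart is a pair of a domain and a map; values of the map outside the
  domain are irrelevant.\<close>

type_synonym ('q, 'e) chart = "'q set \<times> ('q \<Rightarrow> 'e)"

abbreviation chart_dom :: "('q, 'e) chart \<Rightarrow> 'q set" where "chart_dom \<equiv> fst"
abbreviation chart_map :: "('q, 'e) chart \<Rightarrow> 'q \<Rightarrow> 'e" where "chart_map \<equiv> snd"

definition chart_inv :: "('q, 'e) chart \<Rightarrow> 'e \<Rightarrow> 'q" where
  "chart_inv c = inv_into (chart_dom c) (chart_map c)"

definition is_chart :: "('q::topological_space, 'e::euclidean_space) chart \<Rightarrow> bool" where
  "is_chart c \<longleftrightarrow> open (chart_dom c) \<and> open (chart_map c ` chart_dom c) \<and>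
     homeomorphism (chart_dom c) (chart_map c ` chart_dom c) (chart_map c) (chart_inv c)"

definition transition :: "('q, 'e) chart \<Rightarrow> ('q, 'e) chart \<Rightarrow> 'e \<Rightarrow> 'e" where
  "transition c c' = chart_map c' \<circ> chart_inv c"

definition smooth_atlas :: "('q::topological_space, 'e::euclidean_space) chart set \<Rightarrow> bool" where
  "smooth_atlas A \<longleftrightarrow>
     (\<forall>c\<in>A. is_chart c) \<and> (\<Union>c\<in>A. chart_dom c) = UNIV \<and>
     (\<forall>c\<in>A. \<forall>c'\<in>A. smooth_on (chart_map c ` (chart_dom c \<inter> chart_dom c')) (transition c c'))"

definition smooth_function :: "('q, 'e::euclidean_space) chart set \<Rightarrow> ('q \<Rightarrow> real) \<Rightarrow> bool" where
  "smooth_function A f \<longleftrightarrow> (\<forall>c\<in>A. smooth_on (chart_map c ` chart_dom c) (f \<circ> chart_inv c))"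

text \<open>A tangent vector at \<open>x\<close> is the family of its component vectors, one for each chart around
  \<open>x\<close>, related by the differentials of the transition maps. The components in all other charts are
  set to \<open>0\<close>, so that equality of tangent vectors is equality of functions.\<close>

type_synonym ('q, 'e) tangent = "('q, 'e) chart \<Rightarrow> 'e"

definition tangent_space ::
    "('q, 'e::euclidean_space) chart set \<Rightarrow> 'q \<Rightarrow> ('q, 'e) tangent set" where
  "tangent_space A x = {v.
     (\<forall>c\<in>A. \<forall>c'\<in>A. x \<in> chart_dom c \<inter> chart_dom c' \<longrightarrow>
        v c' = frechet_derivative (transition c c') (at (chart_map c x)) (v c)) \<and>
     (\<forall>c. c \<notin> A \<or> x \<notin> chart_dom c \<longrightarrow> v c = 0)}"

definition tangent_bundle ::
    "('q, 'e::euclidean_space) chart set \<Rightarrow> ('q \<times> ('q, 'e) tangent) set" where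
  "tangent_bundle A = (SIGMA x:UNIV. tangent_space A x)"

text \<open>The tangent vector at \<open>x\<close> whose component in the chart \<open>c\<close> is \<open>e\<close>.\<close>

definition coord_vector ::
    "('q, 'e::euclidean_space) chart set \<Rightarrow> ('q, 'e) chart \<Rightarrow> 'q \<Rightarrow> 'e \<Rightarrow> ('q, 'e) tangent" where
  "coord_vector A c x e = (\<lambda>c'. if c' \<in> A \<and> x \<in> chart_dom c'
     then frechet_derivative (transition c c') (at (chart_map c x)) e else 0)"

type_synonym ('q, 'e) metric = "'q \<Rightarrow> ('q, 'e) tangent \<Rightarrow> ('q, 'e) tangent \<Rightarrow> real"

definition metric_in_chart ::
    "('q, 'e::euclidean_space) chart set \<Rightarrow> ('q, 'e) metric \<Rightarrow> ('q, 'e) chart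
      \<Rightarrow> 'e \<Rightarrow> 'e \<Rightarrow> 'e \<Rightarrow> real" where
  "metric_in_chart A g c y e e' =
     g (chart_inv c y) (coord_vector A c (chart_inv c y) e) (coord_vector A c (chart_inv c y) e')"

definition riemannian_metric ::
    "('q, 'e::euclidean_space) chart set \<Rightarrow> ('q, 'e) metric \<Rightarrow> bool" where
  "riemannian_metric A g \<longleftrightarrow>
     (\<forall>x. \<forall>u\<in>tangent_space A x. \<forall>v\<in>tangent_space A x. \<forall>w\<in>tangent_space A x. \<forall>a b.
        g x (\<lambda>c. a *\<^sub>R u c + b *\<^sub>R v c) w = a * g x u w + b * g x v w) \<and>
     (\<forall>x. \<forall>u\<in>tangent_space A x. \<forall>v\<in>tangent_space A x. g x u v = g x v u) \<and>
     (\<forall>x. \<forall>u\<in>tangent_space A x. u \<noteq> (\<lambda>_. 0) \<longrightarrow> g x u u > 0) \<and>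
     (\<forall>c\<in>A. \<forall>e e'. smooth_on (chart_map c ` chart_dom c) (\<lambda>y. metric_in_chart A g c y e e'))"

definition tangent_norm :: "('q, 'e) metric \<Rightarrow> 'q \<Rightarrow> ('q, 'e) tangent \<Rightarrow> real" where
  "tangent_norm g x v = sqrt (g x v v)"

text \<open>The Levi-Civita connection in a chart: \<open>\<Gamma> z u\<close> is the value at \<open>y\<close> of the covariant derivative
  of the constant field \<open>u\<close> in the direction \<open>z\<close>. As constant fields commute, symmetry of \<open>\<Gamma>\<close> is
  torsion-freeness; the last condition is compatibility with the metric.\<close>

definition christoffel ::
    "('q, 'e::euclidean_space) chart set \<Rightarrow> ('q, 'e) metric \<Rightarrow> ('q, 'e) chart
      \<Rightarrow> 'e \<Rightarrow> 'e \<Rightarrow> 'e \<Rightarrow> 'e" where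
  "christoffel A g c y = (THE \<Gamma>. bilinear \<Gamma> \<and> (\<forall>z u. \<Gamma> z u = \<Gamma> u z) \<and>
     (\<forall>z u w. frechet_derivative (\<lambda>y'. metric_in_chart A g c y' u w) (at y) z =
        metric_in_chart A g c y (\<Gamma> z u) w + metric_in_chart A g c y u (\<Gamma> z w)))"

definition velocity ::
    "('q, 'e::euclidean_space) chart set \<Rightarrow> real set \<Rightarrow> (real \<Rightarrow> 'q) \<Rightarrow> real \<Rightarrow> ('q, 'e) tangent" where
  "velocity A I q t = (\<lambda>c. if c \<in> A \<and> q t \<in> chart_dom c
     then vector_derivative (\<lambda>s. chart_map c (q s)) (at t within I) else 0)"

text \<open>Covariant derivative at \<open>t\<close> of a vector field \<open>X\<close> along \<open>q\<close>, i.e. \<open>X s\<close> is tangent at \<open>q s\<close>;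
  by convention it is \<open>0\<close> at times where the components of \<open>X\<close> are not differentiable.\<close>

definition covariant_derivative ::
    "('q, 'e::euclidean_space) chart set \<Rightarrow> ('q, 'e) metric \<Rightarrow> real set \<Rightarrow> (real \<Rightarrow> 'q)
      \<Rightarrow> (real \<Rightarrow> ('q, 'e) tangent) \<Rightarrow> real \<Rightarrow> ('q, 'e) tangent" where
  "covariant_derivative A g I q X t = (\<lambda>c.
     if c \<in> A \<and> q t \<in> chart_dom c \<and> (\<lambda>s. X s c) differentiable (at t within I)
     then vector_derivative (\<lambda>s. X s c) (at t within I)
          + christoffel A g c (chart_map c (q t)) (velocity A I q t c) (X t c)
     else 0)"

definition acceleration ::
    "('q, 'e::euclidean_space) chart set \<Rightarrow> ('q, 'e) metric \<Rightarrow> real set \<Rightarrow> (real \<Rightarrow> 'q)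
      \<Rightarrow> real \<Rightarrow> ('q, 'e) tangent" where
  "acceleration A g I q = covariant_derivative A g I q (velocity A I q)"

definition C1_curve ::
    "('q::topological_space, 'e::euclidean_space) chart set \<Rightarrow> real \<Rightarrow> real \<Rightarrow> (real \<Rightarrow> 'q) \<Rightarrow> bool" where
  "C1_curve A a b \<gamma> \<longleftrightarrow> continuous_on {a..b} \<gamma> \<and>
     (\<forall>c\<in>A. \<forall>s u. a \<le> s \<and> s < u \<and> u \<le> b \<and> \<gamma> ` {s..u} \<subseteq> chart_dom c \<longrightarrow>
        (\<exists>D. continuous_on {s..u} D \<and>
           (\<forall>t\<in>{s..u}. ((\<lambda>t. chart_map c (\<gamma> t)) has_vector_derivative D t) (at t within {s..u}))))"

text \<open>\<open>K\<close> is the set of breakpoints.\<close>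

definition piecewise_C1_curve ::
    "('q::topological_space, 'e::euclidean_space) chart set \<Rightarrow> real \<Rightarrow> real \<Rightarrow> (real \<Rightarrow> 'q) \<Rightarrow> bool" where
  "piecewise_C1_curve A a b \<gamma> \<longleftrightarrow> continuous_on {a..b} \<gamma> \<and>
     (\<exists>K. finite K \<and>
        (\<forall>s u. a \<le> s \<and> s < u \<and> u \<le> b \<and> K \<inter> {s<..<u} = {} \<longrightarrow> C1_curve A s u \<gamma>))"

definition curve_length ::
    "('q, 'e::euclidean_space) chart set \<Rightarrow> ('q, 'e) metric \<Rightarrow> real \<Rightarrow> real \<Rightarrow> (real \<Rightarrow> 'q) \<Rightarrow> real" where
  "curve_length A g a b \<gamma> =
     (LINT t:{a..b}|lebesgue. tangent_norm g (\<gamma> t) (velocity A {a..b} \<gamma> t))"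

definition riem_dist ::
    "('q::topological_space, 'e::euclidean_space) chart set \<Rightarrow> ('q, 'e) metric \<Rightarrow> 'q \<Rightarrow> 'q \<Rightarrow> real" where
  "riem_dist A g x y = Inf {curve_length A g a b \<gamma> | a b \<gamma>.
     a < b \<and> piecewise_C1_curve A a b \<gamma> \<and> \<gamma> a = x \<and> \<gamma> b = y}"

definition riem_ball ::
    "('q::topological_space, 'e::euclidean_space) chart set \<Rightarrow> ('q, 'e) metric \<Rightarrow> 'q \<Rightarrow> real \<Rightarrow> 'q set" where
  "riem_ball A g p s = {x. riem_dist A g p x < s}"

definition complete_connected_riemannian_manifold ::
    "('q::{t2_space,second_countable_topology}, 'e::euclidean_space) chart set
      \<Rightarrow> ('q, 'e) metric \<Rightarrow> bool" where
  "complete_connected_riemannian_manifold A g \<longleftrightarrow>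
     smooth_atlas A \<and> riemannian_metric A g \<and> connected (UNIV :: 'q set) \<and>
     Metric_space.mcomplete UNIV (riem_dist A g)"

definition L2_on :: "real \<Rightarrow> real \<Rightarrow> (real \<Rightarrow> 'e::euclidean_space) \<Rightarrow> bool" where
  "L2_on a b f \<longleftrightarrow> set_borel_measurable lebesgue {a..b} f \<and>
     set_integrable lebesgue {a..b} (\<lambda>t. (norm (f t))\<^sup>2)"

definition test_function :: "real \<Rightarrow> real \<Rightarrow> (real \<Rightarrow> real) \<Rightarrow> bool" where
  "test_function a b \<phi> \<longleftrightarrow> smooth_on UNIV \<phi> \<and> closure {t. \<phi> t \<noteq> 0} \<subseteq> {a<..<b}"

definition weak_derivative ::
    "real \<Rightarrow> real \<Rightarrow> (real \<Rightarrow> 'e::euclidean_space) \<Rightarrow> (real \<Rightarrow> 'e) \<Rightarrow> bool" where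
  "weak_derivative a b f h \<longleftrightarrow> (\<forall>\<phi>. test_function a b \<phi> \<longrightarrow>
     (LINT t:{a..b}|lebesgue. deriv \<phi> t *\<^sub>R f t) = - (LINT t:{a..b}|lebesgue. \<phi> t *\<^sub>R h t))"

definition sobolev_W22 :: "real \<Rightarrow> real \<Rightarrow> (real \<Rightarrow> 'e::euclidean_space) \<Rightarrow> bool" where
  "sobolev_W22 a b f \<longleftrightarrow> L2_on a b f \<and>
     (\<exists>f1 f2. L2_on a b f1 \<and> L2_on a b f2 \<and> weak_derivative a b f f1 \<and> weak_derivative a b f1 f2)"

text \<open>Continuity fixes the representative.\<close>

definition H2_curve ::
    "('q::topological_space, 'e::euclidean_space) chart set \<Rightarrow> real \<Rightarrow> (real \<Rightarrow> 'q) \<Rightarrow> bool" where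
  "H2_curve A T q \<longleftrightarrow> continuous_on {0..T} q \<and>
     (\<forall>c\<in>A. \<forall>a b. 0 \<le> a \<and> a < b \<and> b \<le> T \<and> q ` {a..b} \<subseteq> chart_dom c \<longrightarrow>
        sobolev_W22 a b (\<lambda>t. chart_map c (q t)))"

text \<open>Admissible curves are functions on all of \<open>real\<close>, of which only the restriction to
  \<open>{0..T}\<close> matters.\<close>

definition admissible ::
    "('q::topological_space, 'e::euclidean_space) chart set \<Rightarrow> real
      \<Rightarrow> 'q \<times> ('q, 'e) tangent \<Rightarrow> 'q \<times> ('q, 'e) tangent \<Rightarrow> (real \<Rightarrow> 'q) set" where
  "admissible A T X0 XT = {q. H2_curve A T q \<and>
     (q 0, velocity A {0..T} q 0) = X0 \<and> (q T, velocity A {0..T} q T) = XT}"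

definition cost_J ::
    "('q, 'e::euclidean_space) chart set \<Rightarrow> ('q, 'e) metric \<Rightarrow> real \<Rightarrow> ('q \<Rightarrow> real)
      \<Rightarrow> (real \<Rightarrow> 'q) \<Rightarrow> real" where
  "cost_J A g T V q = 1 / 2 * (LINT t:{0..T}|lebesgue.
     (tangent_norm g (q t) (acceleration A g {0..T} q t))\<^sup>2 + V (q t))"

definition is_minimizer :: "('c \<Rightarrow> real) \<Rightarrow> 'c set \<Rightarrow> 'c \<Rightarrow> bool" where
  "is_minimizer J \<Omega> q \<longleftrightarrow> q \<in> \<Omega> \<and> (\<forall>q'\<in>\<Omega>. J q \<le> J q')"

definition avoids ::
    "('q::topological_space, 'e::euclidean_space) chart set \<Rightarrow> ('q, 'e) metric \<Rightarrow> real \<Rightarrow> 'q \<Rightarrow> real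
      \<Rightarrow> (real \<Rightarrow> 'q) \<Rightarrow> bool" where
  "avoids A g T p s q \<longleftrightarrow> (\<forall>t\<in>{0..T}. q t \<notin> riem_ball A g p s)"

definition avoidance_feasible ::
    "('q::topological_space, 'e::euclidean_space) chart set \<Rightarrow> ('q, 'e) metric \<Rightarrow> real \<Rightarrow> 'q \<Rightarrow> real
      \<Rightarrow> (real \<Rightarrow> 'q) set \<Rightarrow> bool" where
  "avoidance_feasible A g T p s \<Omega> \<longleftrightarrow> (\<exists>q\<in>\<Omega>. avoids A g T p s q)"

end

theory Submission
  imports Defs
begin

text \<open>Compare the minimizer \<open>qstar\<close> with the reference curve \<open>q\<close>: as \<open>q\<close> stays
where \<open>V\<close> is at most \<open>Vminus\<close>, twice its cost is at most \<open>c\<close>; hence so is twice the cost of \<open>qstar\<close>, and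
both the integral of its squared acceleration and the integral of \<open>V\<close> along it are at most \<open>c\<close>. The
derivative of the squared speed is twice the inner product of acceleration and velocity, so the first
bound limits the speed of \<open>qstar\<close> by \<open>v\<close> (\<open>speed_bound\<close>). If \<open>qstar\<close> met the ball of radius \<open>r\<close> it
would have to spend the time \<open>(rstar - r) / v\<close> inside the ball of radius \<open>rstar\<close> both before and after the
encounter, because distances from \<open>p\<close> change at most at the rate \<open>v\<close> (\<open>riem_dist_speed_bound\<close>) and the end
points lie outside. There \<open>V\<close> is at least \<open>Vstar\<close>, so the integral of \<open>V\<close> would be at least
\<open>2 Vstar (rstar - r) / v\<close>, which exceeds \<open>c\<close>.

The analytic content is to justify the energy identity for curves of class \<open>H\<^sup>2\<close>, which have a second
derivative only almost everywhere. Weak derivatives on an interval are shown to come from absolutely continuous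
functions (\<open>weak_derivative_imp_primitive\<close>), by testing against explicit bump functions; absolutely
continuous functions are differentiable almost everywhere (Lebesgue's differentiation theorem
\<open>ae_has_vector_derivative_indefinite_integral\<close>, from Vitali's covering theorem and Henstock's lemma) and are recovered
by integration (\<open>ac_on_FTC\<close>). Therefore in a chart the velocity is absolutely continuous, the
acceleration is given almost everywhere by the coordinate formula and is square integrable, and the energy
identity is the fundamental theorem of calculus; intervals that lie in a chart are then glued together
(\<open>energy_in_chart\<close>, \<open>energy\<close>).

The geometric content is that the acceleration is a tangent vector, so that its norm can be computed in any
chart. This is the transformation law \<open>christoffel_transform\<close>, which follows from the uniqueness of the
Levi-Civita connection (\<open>levi_civita_ex1\<close>) and the symmetry of second derivatives.\<close>

section \<open>Absolutely continuous functions on an interval\<close>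

text \<open>Absolute continuity on \<open>[a, b]\<close>, encoded by a dominating density: increments of \<open>F\<close> are bounded by
the integrals of one integrable \<open>k\<close>. This is equivalent to the \<open>\<epsilon>\<close>-\<open>\<delta>\<close> definition, is visibly stable
under sums and products, and is the form in which the gauge integral can use it.\<close>

definition ac_on :: "real \<Rightarrow> real \<Rightarrow> (real \<Rightarrow> 'b::real_normed_vector) \<Rightarrow> bool" where
  "ac_on a b F \<longleftrightarrow> (\<exists>k. k integrable_on {a..b} \<and>
     (\<forall>u v. a \<le> u \<longrightarrow> u \<le> v \<longrightarrow> v \<le> b \<longrightarrow> norm (F v - F u) \<le> integral {u..v} k))"

text \<open>The exceptional set \<open>N\<close> has to be paid for by absolute continuity. In a fine tagged division the pieces
with tag outside \<open>N\<close> are controlled by the derivative, as in the classical proof. For the pieces with tag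
in \<open>N\<close>, replace \<open>k\<close> by \<open>0\<close> on \<open>N\<close>, which changes no integral: Henstock's lemma then bounds
the sum of the integrals of \<open>k\<close> over these pieces, hence the sum of the increments of \<open>F\<close>.\<close>

lemma ac_on_FTC:
  fixes F :: "real \<Rightarrow> 'b::banach"
  assumes "a \<le> b" and "ac_on a b F" and N: "negligible N"
    and deriv: "\<And>x. x \<in> {a..b} - N \<Longrightarrow> (F has_vector_derivative h x) (at x within {a..b})"
  shows "(h has_integral (F b - F a)) {a..b}"
proof -
  obtain k where k: "k integrable_on {a..b}"
    and Fk: "\<And>u v. a \<le> u \<Longrightarrow> u \<le> v \<Longrightarrow> v \<le> b \<Longrightarrow> norm (F v - F u) \<le> integral {u..v} k"
    using assms(2) unfolding ac_on_def by blast
  define h0 where "h0 x = (if x \<in> N then 0 else h x)" for x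
  define k0 where "k0 x = (if x \<in> N then 0 else k x)" for x
  have k0: "k0 integrable_on cbox a b"
    using integrable_spike[OF k N, of k0] by (simp add: k0_def)
  have k0k: "integral {u..v} k0 = integral {u..v} k" for u v
    by (rule integral_spike[OF N]) (auto simp: k0_def)
  have "(h0 has_integral (F b - F a)) {a..b}"
    unfolding has_integral_real
  proof (intro allI impI)
    fix e :: real assume "e > 0"
    define e' where "e' = e / (2 * (b - a + 1))"
    have "e' > 0" "e' * (b - a) \<le> e / 2"
      using \<open>e > 0\<close> \<open>a \<le> b\<close> by (auto simp: e'_def field_simps)
    have "e / 2 > 0" using \<open>e > 0\<close> by simp
    with k0 obtain \<gamma> where "gauge \<gamma>"
      and \<gamma>: "\<And>p. \<lbrakk>p tagged_partial_division_of cbox a b; \<gamma> fine p\<rbrakk> \<Longrightarrow>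
             (\<Sum>(x,K)\<in>p. norm (measure lborel K *\<^sub>R k0 x - integral K k0)) < e / 2"
      by (rule Henstock_lemma) blast
    have "\<forall>x. \<exists>d>0. x \<in> {a..b} - N \<longrightarrow>
         (\<forall>y\<in>{a..b}. norm (y-x) < d \<longrightarrow> norm (F y - F x - (y-x) *\<^sub>R h x) \<le> e' * norm (y-x))"
      using deriv[unfolded has_vector_derivative_def has_derivative_within_alt] \<open>e' > 0\<close>
      by (metis zero_less_one)
    then obtain d where d: "\<And>x. 0 < d x"
      "\<And>x y. \<lbrakk>x \<in> {a..b} - N; y \<in> {a..b}; norm (y-x) < d x\<rbrakk>
          \<Longrightarrow> norm (F y - F x - (y-x) *\<^sub>R h x) \<le> e' * norm (y-x)"
      by metis
    show "\<exists>\<gamma>. gauge \<gamma> \<and> (\<forall>p. p tagged_division_of {a..b} \<and> \<gamma> fine p \<longrightarrow>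
        norm ((\<Sum>(x, K)\<in>p. measure lborel K *\<^sub>R h0 x) - (F b - F a)) < e)"
    proof (intro exI conjI allI impI)
      show "gauge (\<lambda>x. \<gamma> x \<inter> ball x (d x))"
        by (intro gauge_Int \<open>gauge \<gamma>\<close> gauge_ball_dependent allI d(1))
      fix p assume asm: "p tagged_division_of {a..b} \<and> (\<lambda>x. \<gamma> x \<inter> ball x (d x)) fine p"
      then have p: "p tagged_division_of {a..b}" and pc: "p tagged_division_of cbox a b"
        and f1: "\<gamma> fine p" and f2: "(\<lambda>x. ball x (d x)) fine p"
        by (auto simp: fine_Int)
      have F_eq: "F b - F a = (\<Sum>(x,K)\<in>p. F (Sup K) - F (Inf K))"
        and ba: "b - a = (\<Sum>(x,K)\<in>p. Sup K - Inf K)"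
        using additive_tagged_division_1[where f=F] additive_tagged_division_1[where f="\<lambda>x. x"]
          \<open>a \<le> b\<close> p by auto
      have bound: "norm (measure lborel K *\<^sub>R h0 x - (F (Sup K) - F (Inf K)))
           \<le> e' * (Sup K - Inf K) + norm (measure lborel K *\<^sub>R k0 x - integral K k0)"
        if xK: "(x, K) \<in> p" for x K
      proof -
        from xK p have "x \<in> K" and Kab: "K \<subseteq> {a..b}" by blast+
        from xK pc obtain u v where "K = cbox u v" by blast
        then have K: "K = {u..v}" by simp
        have uv: "u \<le> v" "a \<le> u" "v \<le> b" "x \<in> {a..b}" "u \<le> x" "x \<le> v"
          using \<open>x \<in> K\<close> Kab unfolding K by auto
        have SI: "Sup K = v" "Inf K = u" "measure lborel K = v - u"
          using uv by (simp_all add: K)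
        show ?thesis
        proof (cases "x \<in> N")
          case True
          have "norm (F v - F u) \<le> integral {u..v} k0"
            using Fk uv k0k by auto
          moreover have "0 \<le> e' * (v - u)" using \<open>e' > 0\<close> uv by simp
          ultimately show ?thesis
            unfolding SI using True by (auto simp: h0_def k0_def K norm_minus_commute)
        next
          case False
          have "K \<subseteq> ball x (d x)" using f2 xK by (auto simp: fine_def)
          moreover have "u \<in> K" "v \<in> K" using uv by (auto simp: K)
          ultimately have "u \<in> ball x (d x)" "v \<in> ball x (d x)" by blast+
          then have "norm (u - x) < d x" "norm (v - x) < d x"
            by (auto simp: dist_norm)
          then have 1: "norm (F u - F x - (u-x) *\<^sub>R h x) \<le> e' * norm (u-x)"
            and 2: "norm (F v - F x - (v-x) *\<^sub>R h x) \<le> e' * norm (v-x)"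
            using d(2)[of x u] d(2)[of x v] uv False by auto
          have "norm ((v - u) *\<^sub>R h x - (F v - F u))
              = norm ((F u - F x - (u - x) *\<^sub>R h x) - (F v - F x - (v - x) *\<^sub>R h x))"
            by (auto simp: algebra_simps)
          also have "\<dots> \<le> e' * norm (u-x) + e' * norm (v-x)"
            by (rule order_trans[OF norm_triangle_ineq4]) (use 1 2 in linarith)
          also have "\<dots> = e' * (v - u)"
            using uv by (simp add: algebra_simps)
          finally show ?thesis
            unfolding SI using False by (auto simp: h0_def intro: add_increasing2)
        qed
      qed
      have "norm ((\<Sum>(x, K)\<in>p. measure lborel K *\<^sub>R h0 x) - (F b - F a))
          = norm (\<Sum>(x,K)\<in>p. measure lborel K *\<^sub>R h0 x - (F (Sup K) - F (Inf K)))"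
        unfolding F_eq sum_subtractf[symmetric] by (simp add: split_def)
      also have "\<dots> \<le> (\<Sum>(x,K)\<in>p. e' * (Sup K - Inf K) + norm (measure lborel K *\<^sub>R k0 x - integral K k0))"
        by (rule sum_norm_le) (use bound in auto)
      also have "\<dots> = e' * (b - a) + (\<Sum>(x,K)\<in>p. norm (measure lborel K *\<^sub>R k0 x - integral K k0))"
        unfolding ba by (simp add: split_def sum.distrib sum_distrib_left)
      also have "\<dots> < e / 2 + e / 2"
      proof (rule add_le_less_mono)
        show "(\<Sum>(x,K)\<in>p. norm (measure lborel K *\<^sub>R k0 x - integral K k0)) < e / 2"
          using pc f1 by (intro \<gamma>) (simp add: tagged_division_of_def)
      qed fact
      finally show "norm ((\<Sum>(x, K)\<in>p. measure lborel K *\<^sub>R h0 x) - (F b - F a)) < e"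
        by simp
    qed
  qed
  then show ?thesis
    by (rule has_integral_spike[OF N, rotated]) (auto simp: h0_def)
qed

lemma integral_increment:
  fixes f :: "real \<Rightarrow> 'b::banach"
  assumes "f integrable_on {a..b}" "a \<le> u" "u \<le> v" "v \<le> b"
  shows "integral {a..v} f - integral {a..u} f = integral {u..v} f"
proof -
  have "f integrable_on {a..v}"
    using integrable_on_subinterval[OF assms(1), of a v] assms by auto
  from Henstock_Kurzweil_Integration.integral_combine[OF assms(2,3) this] show ?thesis
    by (metis add_diff_cancel_left')
qed

text \<open>The points where the difference quotients of the indefinite integral stay off \<open>f x\<close> by more than \<open>e\<close>
are covered, in the sense of Vitali, by balls around \<open>x\<close> whose radius \<open>\<bar>y - x\<bar>\<close> comes from a bad
quotient. On a disjoint subfamily, the segments from \<open>x\<close> to \<open>y\<close> tagged by \<open>x\<close> form a fine partial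
division on which each Riemann term misses the integral by more than \<open>e \<bar>y - x\<bar>\<close>; Henstock's lemma makes
the total length small.\<close>

lemma negligible_bad_difference_quotients:
  fixes f :: "real \<Rightarrow> 'b::euclidean_space"
  assumes f: "f integrable_on {a..b}" and "e > 0"
  defines "F \<equiv> \<lambda>t. integral {a..t} f"
  defines "E \<equiv> {x \<in> {a<..<b}. \<forall>d>0. \<exists>y\<in>{a..b}. y \<noteq> x \<and> \<bar>y - x\<bar> < d \<and>
      norm (F y - F x - (y - x) *\<^sub>R f x) > e * \<bar>y - x\<bar>}"
  shows "negligible E"
  unfolding negligible_outer_le
proof (intro allI impI)
  fix \<mu> :: real assume "\<mu> > 0"
  have inc: "F v - F u = integral {u..v} f" if "a \<le> u" "u \<le> v" "v \<le> b" for u v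
    unfolding F_def by (rule integral_increment[OF f that])
  have "f integrable_on cbox a b" using f by simp
  moreover have "e * \<mu> / 2 > 0" using \<open>e > 0\<close> \<open>\<mu> > 0\<close> by simp
  ultimately obtain \<gamma> where "gauge \<gamma>"
    and \<gamma>: "\<And>p. \<lbrakk>p tagged_partial_division_of cbox a b; \<gamma> fine p\<rbrakk> \<Longrightarrow>
           (\<Sum>(x,K)\<in>p. norm (measure lborel K *\<^sub>R f x - integral K f)) < e * \<mu> / 2"
    by (rule Henstock_lemma) blast
  define K where "K = {(x,y). x \<in> {a<..<b} \<and> y \<in> {a..b} \<and> y \<noteq> x \<and> cball x \<bar>y - x\<bar> \<subseteq> \<gamma> x \<and>
      norm (F y - F x - (y - x) *\<^sub>R f x) > e * \<bar>y - x\<bar>}"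
  define rad where "rad = (\<lambda>(x::real, y). \<bar>y - x\<bar>)"
  have vit: "\<exists>i. i \<in> K \<and> x \<in> cball (fst i) (rad i) \<and> rad i < d" if "x \<in> E" "d > 0" for x d
  proof -
    obtain \<delta> where "\<delta> > 0" "ball x \<delta> \<subseteq> \<gamma> x"
      using \<open>gauge \<gamma>\<close> unfolding gauge_def by (meson open_contains_ball)
    moreover have "min d \<delta> > 0" using that \<open>\<delta> > 0\<close> by simp
    with that(1)[unfolded E_def] obtain y where y: "y \<in> {a..b}" "y \<noteq> x" "\<bar>y - x\<bar> < min d \<delta>"
        "norm (F y - F x - (y - x) *\<^sub>R f x) > e * \<bar>y - x\<bar>"
      by blast
    ultimately have "cball x \<bar>y - x\<bar> \<subseteq> \<gamma> x"
      by (force simp: subset_iff)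
    then have "(x, y) \<in> K" using y that by (auto simp: K_def E_def)
    moreover have "x \<in> cball (fst (x,y)) (rad (x,y)) \<and> rad (x,y) < d" using y by (auto simp: rad_def)
    ultimately show ?thesis by blast
  qed
  have rpos: "0 < rad i" if "i \<in> K" for i using that by (auto simp: K_def rad_def)
  obtain C where "countable C" "C \<subseteq> K"
     and disj: "pairwise (\<lambda>i j. disjnt (cball (fst i) (rad i)) (cball (fst j) (rad j))) C"
     and neg: "negligible (E - (\<Union>i\<in>C. cball (fst i) (rad i)))"
    by (rule Vitali_covering_theorem_cballs[of K rad E fst, OF rpos vit])
  have fin: "measure lebesgue (\<Union>i\<in>I. cball (fst i) (rad i)) \<le> \<mu>" if I: "I \<subseteq> C" "finite I" for I
  proof -
    \<comment> \<open>The two-sided ball is needed for the covering theorem, the one-sided segment for the division.\<close>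
    define seg where "seg = (\<lambda>i::real \<times> real. {min (fst i) (snd i)..max (fst i) (snd i)})"
    have seg_sub: "seg i \<subseteq> cball (fst i) (rad i)" for i
      by (auto simp: seg_def rad_def dist_real_def split: prod.splits)
    have IK: "i \<in> K" if "i \<in> I" for i using that I \<open>C \<subseteq> K\<close> by blast
    have dI: "cball (fst i) (rad i) \<inter> cball (fst j) (rad j) = {}" if "i \<in> I" "j \<in> I" "i \<noteq> j" for i j
      using disj that I unfolding pairwise_def disjnt_def by blast
    define p where "p = (\<lambda>i. (fst i, seg i)) ` I"
    have inj: "inj_on (\<lambda>i. (fst i, seg i)) I"
    proof (rule inj_onI)
      fix i j assume ij: "i \<in> I" "j \<in> I" "(fst i, seg i) = (fst j, seg j)"
      then have "fst i = fst j" by simp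
      then have "fst i \<in> cball (fst i) (rad i)" "fst i \<in> cball (fst j) (rad j)"
        using rpos[OF IK[OF ij(1)]] rpos[OF IK[OF ij(2)]] by auto
      then show "i = j" using dI ij by blast
    qed
    have "p tagged_partial_division_of cbox a b"
      unfolding tagged_partial_division_of_def
    proof (intro conjI allI impI)
      show "finite p" using I by (simp add: p_def)
    next
      fix x k assume "(x, k) \<in> p"
      then obtain i where i: "i \<in> I" "x = fst i" "k = seg i" by (auto simp: p_def)
      then show "x \<in> k" "k \<subseteq> cbox a b" using IK[of i] by (auto simp: seg_def K_def)
      show "\<exists>a b. k = cbox a b" using i by (auto simp: seg_def)
    next
      fix x1 k1 x2 k2 assume asm: "(x1, k1) \<in> p \<and> (x2, k2) \<in> p \<and> (x1, k1) \<noteq> (x2, k2)"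
      then obtain i j where ij: "i \<in> I" "j \<in> I" "i \<noteq> j" "k1 = seg i" "k2 = seg j" by (auto simp: p_def)
      have "seg i \<inter> seg j = {}" using dI[OF ij(1-3)] seg_sub[of i] seg_sub[of j] by blast
      then show "interior k1 \<inter> interior k2 = {}" using ij interior_subset by blast
    qed
    moreover have "\<gamma> fine p"
      unfolding fine_def p_def
    proof safe
      fix u v t assume "(u, v) \<in> I" "t \<in> seg (u, v)"
      then show "t \<in> \<gamma> (fst (u,v))"
        using seg_sub[of "(u,v)"] IK[of "(u,v)"] by (auto simp: K_def rad_def)
    qed
    ultimately have "(\<Sum>(x,K)\<in>p. norm (measure lborel K *\<^sub>R f x - integral K f)) < e * \<mu> / 2"
      by (rule \<gamma>)
    then have sum: "(\<Sum>i\<in>I. norm (measure lborel (seg i) *\<^sub>R f (fst i) - integral (seg i) f)) < e * \<mu> / 2"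
      unfolding p_def by (subst (asm) sum.reindex[OF inj]) simp
    have "e * rad i \<le> norm (measure lborel (seg i) *\<^sub>R f (fst i) - integral (seg i) f)" if "i \<in> I" for i
    proof -
      obtain x y where i: "i = (x, y)" by force
      have K: "x \<in> {a<..<b}" "y \<in> {a..b}" "y \<noteq> x" "norm (F y - F x - (y - x) *\<^sub>R f x) > e * \<bar>y - x\<bar>"
        using IK[OF that] by (auto simp: K_def i)
      show ?thesis
      proof (cases "x < y")
        case True
        then show ?thesis using K inc[of x y]
          by (simp add: i seg_def rad_def norm_minus_commute)
      next
        case False
        then have "norm (F y - F x - (y - x) *\<^sub>R f x) = norm ((x - y) *\<^sub>R f x - integral {y..x} f)"
          using K inc[of y x] by (simp add: algebra_simps)
        then show ?thesis using K False
          by (simp add: i seg_def rad_def)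
      qed
    qed
    then have "(\<Sum>i\<in>I. e * rad i) \<le> e * \<mu> / 2"
      using sum by (smt (verit) sum_mono)
    then have "e * (2 * (\<Sum>i\<in>I. rad i)) \<le> e * \<mu>" by (simp add: sum_distrib_left[symmetric])
    then have "2 * (\<Sum>i\<in>I. rad i) \<le> \<mu>" using \<open>e > 0\<close> mult_le_cancel_left_pos by blast
    then have le: "(\<Sum>i\<in>I. 2 * rad i) \<le> \<mu>" by (simp add: sum_distrib_left)
    have "measure lebesgue (\<Union>i\<in>I. cball (fst i) (rad i)) \<le> (\<Sum>i\<in>I. measure lebesgue (cball (fst i) (rad i)))"
      by (rule measure_UNION_le) (use I in auto)
    also have "\<dots> = (\<Sum>i\<in>I. 2 * rad i)"
      by (rule sum.cong) (use rpos[OF IK] in \<open>auto simp: cball_eq_atLeastAtMost less_imp_le\<close>)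
    finally show ?thesis using le by simp
  qed
  let ?U = "\<Union>i\<in>C. cball (fst i) (rad i)"
  have U: "?U \<in> lmeasurable" "measure lebesgue ?U \<le> \<mu>"
    by (rule fmeasurable_UN_bound[OF \<open>countable C\<close> _ fin] measure_UN_bound[OF \<open>countable C\<close> _ fin]; simp)+
  show "\<exists>T. E \<subseteq> T \<and> T \<in> lmeasurable \<and> measure lebesgue T \<le> \<mu>"
  proof (intro exI conjI)
    show "E \<subseteq> ?U \<union> (E - ?U)" by blast
    have n: "E - ?U \<in> lmeasurable" "measure lebesgue (E - ?U) = 0"
      using neg negligible_imp_measurable negligible_imp_measure0 by blast+
    then show "?U \<union> (E - ?U) \<in> lmeasurable" using U by blast
    show "measure lebesgue (?U \<union> (E - ?U)) \<le> \<mu>"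
      using measure_Un_le[of ?U lebesgue "E - ?U"] U n by (auto simp: fmeasurableD)
  qed
qed

text \<open>Lebesgue's differentiation theorem on the line.\<close>

lemma ae_has_vector_derivative_indefinite_integral:
  fixes f :: "real \<Rightarrow> 'b::euclidean_space"
  assumes f: "f integrable_on {a..b}"
  obtains N where "negligible N"
    "\<And>x. x \<in> {a..b} - N \<Longrightarrow>
       ((\<lambda>t. integral {a..t} f) has_vector_derivative f x) (at x within {a..b})"
proof -
  let ?F = "\<lambda>t. integral {a..t} f"
  define E where "E e = {x \<in> {a<..<b}. \<forall>d>0. \<exists>y\<in>{a..b}. y \<noteq> x \<and> \<bar>y - x\<bar> < d \<and>
      norm (?F y - ?F x - (y - x) *\<^sub>R f x) > e * \<bar>y - x\<bar>}" for e :: real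
  define N where "N = {a, b} \<union> (\<Union>n. E (1 / real (Suc n)))"
  show ?thesis
  proof
    have "negligible (E (1 / real (Suc n)))" for n
      unfolding E_def using negligible_bad_difference_quotients[OF f, of "1 / real (Suc n)"] by simp
    then have "negligible (\<Union>n. E (1 / real (Suc n)))"
      by (intro negligible_countable_Union) auto
    then show "negligible N"
      unfolding N_def by (intro negligible_Un) (auto intro: negligible_finite)
  next
    fix x assume x: "x \<in> {a..b} - N"
    show "(?F has_vector_derivative f x) (at x within {a..b})"
      unfolding has_vector_derivative_def has_derivative_within_alt
    proof (intro conjI allI impI)
      fix e :: real assume "e > 0"
      then obtain n where n: "1 / real (Suc n) < e"
        using nat_approx_posE by blast
      have "x \<notin> E (1 / real (Suc n))" using x by (auto simp: N_def)
      moreover have "x \<in> {a<..<b}" using x by (auto simp: N_def)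
      ultimately obtain d where "d > 0" and d: "\<And>y. y \<in> {a..b} \<Longrightarrow> y \<noteq> x \<Longrightarrow> \<bar>y - x\<bar> < d \<Longrightarrow>
          norm (?F y - ?F x - (y - x) *\<^sub>R f x) \<le> 1 / real (Suc n) * \<bar>y - x\<bar>"
        unfolding E_def mem_Collect_eq using not_le by metis
      have "norm (?F y - ?F x - (y - x) *\<^sub>R f x) \<le> e * norm (y - x)" if "y \<in> {a..b}" "norm (y - x) < d" for y
      proof (cases "y = x")
        case False
        then have "norm (?F y - ?F x - (y - x) *\<^sub>R f x) \<le> 1 / real (Suc n) * \<bar>y - x\<bar>"
          using d that by auto
        also have "\<dots> \<le> e * \<bar>y - x\<bar>" using n by (intro mult_right_mono) auto
        finally show ?thesis by simp
      qed simp
      then show "\<exists>d>0. \<forall>y\<in>{a..b}. norm (y - x) < d \<longrightarrow>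
             norm (?F y - ?F x - (y - x) *\<^sub>R f x) \<le> e * norm (y - x)"
        using \<open>d > 0\<close> by blast
    qed (rule bounded_linear_scaleR_left)
  qed
qed

lemma ac_on_indefinite_integral:
  fixes h :: "real \<Rightarrow> 'b::euclidean_space"
  assumes "h absolutely_integrable_on {a..b}"
  shows "ac_on a b (\<lambda>t. C + integral {a..t} h)"
  unfolding ac_on_def
proof (intro exI conjI allI impI)
  show "(\<lambda>t. norm (h t)) integrable_on {a..b}"
    using assms absolutely_integrable_on_def by blast
  fix u v assume uv: "a \<le> u" "u \<le> v" "v \<le> b"
  have h: "h integrable_on {a..b}" using assms absolutely_integrable_on_def by blast
  have "(C + integral {a..v} h) - (C + integral {a..u} h) = integral {u..v} h"
    using integral_increment[OF h uv] by simp
  moreover have "h absolutely_integrable_on {u..v}"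
    using absolutely_integrable_on_subinterval[OF assms] uv by auto
  ultimately show "norm ((C + integral {a..v} h) - (C + integral {a..u} h)) \<le> integral {u..v} (\<lambda>t. norm (h t))"
    by (auto simp: absolutely_integrable_on_def intro!: integral_norm_bound_integral)
qed

lemma ac_on_C1:
  fixes F :: "real \<Rightarrow> 'b::euclidean_space"
  assumes "\<And>t. t \<in> {a..b} \<Longrightarrow> (F has_vector_derivative D t) (at t within {a..b})"
    and "continuous_on {a..b} D"
  shows "ac_on a b F"
  unfolding ac_on_def
proof (intro exI conjI allI impI)
  show "(\<lambda>t. norm (D t)) integrable_on {a..b}"
    using assms(2) by (intro integrable_continuous_real continuous_intros)
  fix u v assume uv: "a \<le> u" "u \<le> v" "v \<le> b"
  have c: "continuous_on {u..v} D" using assms(2) continuous_on_subset uv by fastforce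
  have "(D has_integral (F v - F u)) {u..v}"
  proof (rule fundamental_theorem_of_calculus[OF uv(2)])
    show "(F has_vector_derivative D t) (at t within {u..v})" if "t \<in> {u..v}" for t
      by (rule has_vector_derivative_within_subset[OF assms(1)]) (use uv that in auto)
  qed
  then have "F v - F u = integral {u..v} D" "D integrable_on {u..v}"
    by (auto simp: integral_unique)
  then show "norm (F v - F u) \<le> integral {u..v} (\<lambda>t. norm (D t))"
    using c by (auto intro!: integral_norm_bound_integral integrable_continuous_real continuous_intros)
qed

lemma ac_on_add:
  assumes "ac_on a b F" "ac_on a b G"
  shows "ac_on a b (\<lambda>t. F t + G t)"
proof -
  obtain k where k: "k integrable_on {a..b}"
    and Fk: "\<And>u v. a \<le> u \<Longrightarrow> u \<le> v \<Longrightarrow> v \<le> b \<Longrightarrow> norm (F v - F u) \<le> integral {u..v} k"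
    using assms(1) unfolding ac_on_def by blast
  obtain l where l: "l integrable_on {a..b}"
    and Gl: "\<And>u v. a \<le> u \<Longrightarrow> u \<le> v \<Longrightarrow> v \<le> b \<Longrightarrow> norm (G v - G u) \<le> integral {u..v} l"
    using assms(2) unfolding ac_on_def by blast
  show ?thesis unfolding ac_on_def
  proof (intro exI conjI allI impI)
    show "(\<lambda>t. k t + l t) integrable_on {a..b}" using k l by (rule integrable_add)
    fix u v assume uv: "a \<le> u" "u \<le> v" "v \<le> b"
    have "k integrable_on {u..v}" "l integrable_on {u..v}"
      using k l integrable_on_subinterval uv by (metis atLeastatMost_subset_iff)+
    then have "integral {u..v} (\<lambda>t. k t + l t) = integral {u..v} k + integral {u..v} l"
      by (rule integral_add)
    moreover have "norm (F v + G v - (F u + G u)) \<le> norm (F v - F u) + norm (G v - G u)"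
      by (metis add_diff_add norm_triangle_ineq)
    ultimately show "norm (F v + G v - (F u + G u)) \<le> integral {u..v} (\<lambda>t. k t + l t)"
      using Fk[OF uv] Gl[OF uv] by linarith
  qed
qed

lemma ac_on_bounded:
  assumes "ac_on a b F"
  obtains B where "B > 0" "\<And>t. t \<in> {a..b} \<Longrightarrow> norm (F t) \<le> B"
proof -
  obtain k where k: "k integrable_on {a..b}"
    and Fk: "\<And>u v. a \<le> u \<Longrightarrow> u \<le> v \<Longrightarrow> v \<le> b \<Longrightarrow> norm (F v - F u) \<le> integral {u..v} k"
    using assms unfolding ac_on_def by blast
  show ?thesis
  proof
    show "norm (F a) + \<bar>integral {a..b} k\<bar> + 1 > 0" by (smt (verit) norm_ge_zero)
    fix t assume t: "t \<in> {a..b}"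
    have "integral {a..t} k + integral {t..b} k = integral {a..b} k"
      using Henstock_Kurzweil_Integration.integral_combine[of a t b k] t k by auto
    moreover have "0 \<le> integral {t..b} k" using Fk[of t b] t by (smt (verit) norm_ge_zero atLeastAtMost_iff)
    moreover have "norm (F t - F a) \<le> integral {a..t} k" using Fk t by auto
    moreover have "norm (F t) \<le> norm (F a) + norm (F t - F a)"
      by (metis add.commute diff_add_cancel norm_triangle_ineq)
    ultimately show "norm (F t) \<le> norm (F a) + \<bar>integral {a..b} k\<bar> + 1" by linarith
  qed
qed

lemma ac_on_scaleR:
  fixes F :: "real \<Rightarrow> real"
  assumes F: "ac_on a b F" and G: "ac_on a b G"
  shows "ac_on a b (\<lambda>t. F t *\<^sub>R G t)"
proof -
  obtain k where k: "k integrable_on {a..b}"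
    and Fk: "\<And>u v. a \<le> u \<Longrightarrow> u \<le> v \<Longrightarrow> v \<le> b \<Longrightarrow> norm (F v - F u) \<le> integral {u..v} k"
    using F unfolding ac_on_def by blast
  obtain l where l: "l integrable_on {a..b}"
    and Gl: "\<And>u v. a \<le> u \<Longrightarrow> u \<le> v \<Longrightarrow> v \<le> b \<Longrightarrow> norm (G v - G u) \<le> integral {u..v} l"
    using G unfolding ac_on_def by blast
  obtain B where B: "B > 0" "\<And>t. t \<in> {a..b} \<Longrightarrow> norm (F t) \<le> B" by (rule ac_on_bounded[OF F]) blast
  obtain B' where B': "B' > 0" "\<And>t. t \<in> {a..b} \<Longrightarrow> norm (G t) \<le> B'" by (rule ac_on_bounded[OF G]) blast
  show ?thesis unfolding ac_on_def
  proof (intro exI conjI allI impI)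
    show "(\<lambda>t. k t * B' + B * l t) integrable_on {a..b}"
      using k l by (intro integrable_add integrable_on_mult_left integrable_on_mult_right)
    fix u v assume uv: "a \<le> u" "u \<le> v" "v \<le> b"
    have kl: "k integrable_on {u..v}" "l integrable_on {u..v}"
      using k l integrable_on_subinterval uv by (metis atLeastatMost_subset_iff)+
    have "integral {u..v} (\<lambda>t. k t * B' + B * l t) = integral {u..v} k * B' + B * integral {u..v} l"
      using kl by (subst integral_add) (auto intro: integrable_on_mult_left integrable_on_mult_right)
    moreover have "F v *\<^sub>R G v - F u *\<^sub>R G u = (F v - F u) *\<^sub>R G v + F u *\<^sub>R (G v - G u)"
      by (simp add: algebra_simps)
    then have "norm (F v *\<^sub>R G v - F u *\<^sub>R G u) \<le> norm (F v - F u) * norm (G v) + norm (F u) * norm (G v - G u)"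
      by (metis norm_scaleR norm_triangle_ineq real_norm_def)
    moreover have "norm (F v - F u) * norm (G v) \<le> integral {u..v} k * B'"
      using Fk[OF uv] B'(2)[of v] uv by (intro mult_mono) (auto intro: order_trans[OF norm_ge_zero])
    moreover have "norm (F u) * norm (G v - G u) \<le> B * integral {u..v} l"
      using Gl[OF uv] B uv by (intro mult_mono) auto
    ultimately show "norm (F v *\<^sub>R G v - F u *\<^sub>R G u) \<le> integral {u..v} (\<lambda>t. k t * B' + B * l t)"
      by linarith
  qed
qed

lemma ac_on_sum:
  assumes "\<And>i. i \<in> I \<Longrightarrow> ac_on a b (F i)"
  shows "ac_on a b (\<lambda>t. \<Sum>i\<in>I. F i t)"
proof (cases "finite I")
  case True
  then show ?thesis using assms
  proof (induction I)
    case empty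
    have "(\<lambda>t::real. 0::real) integrable_on {a..b}" by (rule integrable_0)
    then show ?case unfolding ac_on_def by (intro exI[of _ "\<lambda>_. 0"]) auto
  next
    case (insert x F)
    then show ?case by (simp add: ac_on_add)
  qed
next
  case False
  have "(\<lambda>t::real. 0::real) integrable_on {a..b}" by (rule integrable_0)
  then show ?thesis unfolding ac_on_def by (intro exI[of _ "\<lambda>_. 0"]) (use False in auto)
qed

lemma ac_on_inner:
  fixes F :: "real \<Rightarrow> 'b::real_inner"
  assumes "ac_on a b F"
  shows "ac_on a b (\<lambda>t. F t \<bullet> w)"
proof -
  obtain k where k: "k integrable_on {a..b}"
    and Fk: "\<And>u v. a \<le> u \<Longrightarrow> u \<le> v \<Longrightarrow> v \<le> b \<Longrightarrow> norm (F v - F u) \<le> integral {u..v} k"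
    using assms unfolding ac_on_def by blast
  show ?thesis unfolding ac_on_def
  proof (intro exI conjI allI impI)
    show "(\<lambda>t. k t * norm w) integrable_on {a..b}" using k by (rule integrable_on_mult_left)
    fix u v assume uv: "a \<le> u" "u \<le> v" "v \<le> b"
    have "norm (F v \<bullet> w - F u \<bullet> w) \<le> norm (F v - F u) * norm w"
      by (metis Cauchy_Schwarz_ineq2 inner_diff_left real_norm_def)
    also have "\<dots> \<le> integral {u..v} k * norm w" using Fk[OF uv] by (simp add: mult_right_mono)
    finally show "norm (F v \<bullet> w - F u \<bullet> w) \<le> integral {u..v} (\<lambda>t. k t * norm w)" by simp
  qed
qed

section \<open>Weak derivatives on an interval\<close>

lemma Ck_on_SucI:
  assumes "\<And>x. (f has_derivative f' x) (at x)" and "\<And>u. Ck_on k UNIV (\<lambda>x. f' x u)"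
  shows "Ck_on (Suc k) UNIV f"
proof -
  have "frechet_derivative f (at x) = f' x" for x
    using assms(1) frechet_derivative_at by metis
  then show ?thesis
    using assms by (auto simp: differentiable_def)
qed

lemma Ck_on_Suc_imp: "Ck_on (Suc k) S f \<Longrightarrow> Ck_on k S f"
proof (induction k arbitrary: f)
  case 0
  then show ?case
    by (auto intro!: continuous_at_imp_continuous_on differentiable_imp_continuous_within)
next
  case (Suc k)
  then show ?case by (metis Ck_on.simps(2))
qed

lemma Ck_on_const: "Ck_on k UNIV (\<lambda>x. c)"
proof (induction k arbitrary: c)
  case (Suc k)
  show ?case by (rule Ck_on_SucI[of _ "\<lambda>x h. 0"]) (auto intro: Suc)
qed simp

lemma Ck_on_add: "Ck_on k UNIV f \<Longrightarrow> Ck_on k UNIV g \<Longrightarrow> Ck_on k UNIV (\<lambda>x. f x + g x)"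
proof (induction k arbitrary: f g)
  case (Suc k)
  then show ?case
    by (intro Ck_on_SucI[where f' = "\<lambda>x h. frechet_derivative f (at x) h + frechet_derivative g (at x) h"])
      (auto intro!: has_derivative_add simp: frechet_derivative_works[symmetric])
qed (auto intro: continuous_on_add)

lemma Ck_on_mult:
  fixes f g :: "'a::euclidean_space \<Rightarrow> real"
  shows "Ck_on k UNIV f \<Longrightarrow> Ck_on k UNIV g \<Longrightarrow> Ck_on k UNIV (\<lambda>x. f x * g x)"
proof (induction k arbitrary: f g)
  case (Suc k)
  note ck = Suc.prems[THEN Ck_on_Suc_imp]
  show ?case
  proof (rule Ck_on_SucI[where f' = "\<lambda>x h. f x * frechet_derivative g (at x) h + frechet_derivative f (at x) h * g x"])
    show "((\<lambda>x. f x * g x) has_derivative (\<lambda>h. f x * frechet_derivative g (at x) h + frechet_derivative f (at x) h * g x)) (at x)" for x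
      using Suc.prems by (intro has_derivative_mult) (auto simp: frechet_derivative_works[symmetric])
    show "Ck_on k UNIV (\<lambda>x. f x * frechet_derivative g (at x) u + frechet_derivative f (at x) u * g x)" for u
      using Suc.prems ck by (intro Ck_on_add Suc.IH) auto
  qed
qed (auto intro: continuous_on_mult)

lemma Ck_on_affine:
  fixes f :: "real \<Rightarrow> real"
  shows "Ck_on k UNIV f \<Longrightarrow> Ck_on k UNIV (\<lambda>x. f (m * x + n))"
proof (induction k arbitrary: f)
  case 0
  then show ?case by (auto intro!: continuous_intros elim: continuous_on_compose2)
next
  case (Suc k)
  show ?case
  proof (rule Ck_on_SucI[where f' = "\<lambda>x h. frechet_derivative f (at (m * x + n)) (m * h)"])
    fix x
    have "(f has_derivative frechet_derivative f (at (m * x + n))) (at (m * x + n))"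
      using Suc.prems by (auto simp: frechet_derivative_works[symmetric])
    moreover have "((\<lambda>x. m * x + n) has_derivative (\<lambda>h. m * h)) (at x)"
      by (auto intro!: derivative_eq_intros)
    ultimately show "((\<lambda>x. f (m * x + n)) has_derivative (\<lambda>h. frechet_derivative f (at (m * x + n)) (m * h))) (at x)"
      by (rule has_derivative_compose[rotated])
  next
    show "Ck_on k UNIV (\<lambda>x. frechet_derivative f (at (m * x + n)) (m * u))" for u
      using Suc.prems by (intro Suc.IH[of "\<lambda>x. frechet_derivative f (at x) (m * u)"]) auto
  qed
qed

text \<open>The functions \<open>x\<^sup>-\<^sup>m exp (- 1 / x)\<close>, extended by \<open>0\<close>. The family is closed under differentiation up to
linear combinations, so the smoothness of all members follows by a single induction.\<close>

definition flat :: "nat \<Rightarrow> real \<Rightarrow> real" where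
  "flat m x = (if x > 0 then (1 / x) ^ m * exp (- (1 / x)) else 0)"

lemma flat_tendsto_0: "(flat m \<longlongrightarrow> 0) (at 0)"
proof -
  have "((\<lambda>x. inverse x ^ m / exp (inverse x)) \<longlongrightarrow> (0::real)) (at_right 0)"
    by (rule filterlim_compose[OF tendsto_power_div_exp_0 filterlim_inverse_at_top_right])
  then have "(flat m \<longlongrightarrow> 0) (at_right 0)"
    by (rule Lim_transform_eventually)
      (auto simp: eventually_at_filter flat_def exp_minus field_simps)
  moreover have "(flat m \<longlongrightarrow> 0) (at_left 0)"
    by (rule Lim_transform_eventually[OF tendsto_const[of 0]])
      (auto simp: eventually_at_filter flat_def)
  ultimately show ?thesis by (simp add: filterlim_split_at)
qed

lemma flat_has_derivative:
  "(flat m has_field_derivative (flat (m + 2) x - real m * flat (m + 1) x)) (at x)"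
proof -
  consider "x > 0" | "x < 0" | "x = 0" by linarith
  then show ?thesis
  proof cases
    case 1
    have d: "((\<lambda>x. 1 / x) has_field_derivative - ((1 / x)\<^sup>2)) (at x)"
      using 1 by (auto intro!: derivative_eq_intros simp: power2_eq_square)
    have e: "((\<lambda>x. exp (- (1 / x))) has_field_derivative exp (- (1 / x)) * (1 / x)\<^sup>2) (at x)"
      using DERIV_fun_exp[OF DERIV_minus[OF d]] by simp
    have "((\<lambda>x. (1 / x) ^ m * exp (- (1 / x))) has_field_derivative
       (flat (m + 2) x - real m * flat (m + 1) x)) (at x)"
    proof (cases m)
      case 0
      then show ?thesis using 1 e by (simp add: flat_def power2_eq_square)
    next
      case (Suc n)
      show ?thesis
        unfolding Suc
        by (rule DERIV_cong[OF DERIV_mult[OF DERIV_power_Suc[OF d, of n] e]])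
          (use 1 in \<open>auto simp: flat_def power2_eq_square algebra_simps\<close>)
    qed
    moreover have "eventually (\<lambda>y. y > 0) (nhds x)"
      using 1 eventually_nhds_in_open[of "{0<..}" x] by simp
    then have "eventually (\<lambda>y. (1 / y) ^ m * exp (- (1 / y)) = flat m y) (nhds x)"
      by (rule eventually_mono) (auto simp: flat_def)
    ultimately show ?thesis
      using DERIV_cong_ev[OF refl _ refl, of "\<lambda>x. (1 / x) ^ m * exp (- (1 / x))" "flat m" x] by blast
  next
    case 2
    have "((\<lambda>x. 0) has_field_derivative (flat (m + 2) x - real m * flat (m + 1) x)) (at x)"
      using 2 by (auto simp: flat_def)
    moreover have "eventually (\<lambda>y. y < 0) (nhds x)"
      using 2 eventually_nhds_in_open[of "{..<0}" x] by simp
    then have "eventually (\<lambda>y. 0 = flat m y) (nhds x)"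
      by (rule eventually_mono) (auto simp: flat_def)
    ultimately show ?thesis
      using DERIV_cong_ev[OF refl _ refl, of "\<lambda>x. 0" "flat m" x] by blast
  next
    case 3
    have "((\<lambda>h. (flat m (0 + h) - flat m 0) / h) \<longlongrightarrow> 0) (at 0)"
      by (rule Lim_transform_eventually[OF flat_tendsto_0[of "Suc m"]])
        (auto simp: eventually_at_filter flat_def)
    then show ?thesis using 3 by (simp add: DERIV_def flat_def)
  qed
qed

lemma smooth_flat: "smooth_on UNIV (flat m)"
  unfolding smooth_on_def
proof
  fix k show "Ck_on k UNIV (flat m)"
  proof (induction k arbitrary: m)
    case 0
    have "isCont (flat m) x" for x using flat_has_derivative DERIV_isCont by blast
    then show ?case by (simp add: continuous_at_imp_continuous_on)
  next
    case (Suc k)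
    show ?case
    proof (rule Ck_on_SucI)
      show "(flat m has_derivative (\<lambda>h. (flat (m + 2) x + (- real m) * flat (m + 1) x) * h)) (at x)" for x
        using flat_has_derivative[of m x] by (simp add: has_field_derivative_def)
      show "Ck_on k UNIV (\<lambda>x. (flat (m + 2) x + (- real m) * flat (m + 1) x) * u)" for u
        by (intro Ck_on_mult Ck_on_add Ck_on_const Suc)
    qed
  qed
qed

text \<open>Since \<open>exp (- 1 / (n x))\<close> tends to \<open>1\<close> for \<open>x > 0\<close>, these bumps increase to the indicator of
\<open>(s, t)\<close> and are both smooth cut-offs and approximations of intervals.\<close>

definition bump :: "real \<Rightarrow> real \<Rightarrow> nat \<Rightarrow> real \<Rightarrow> real" where
  "bump s t n x = flat 0 (real n * (x - s)) * flat 0 (real n * (t - x))"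

lemma smooth_bump: "smooth_on UNIV (bump s t n)"
proof -
  have "Ck_on k UNIV (\<lambda>x. flat 0 (real n * x + - (real n * s)) * flat 0 (- real n * x + real n * t))" for k
    using smooth_flat[of 0] unfolding smooth_on_def by (intro Ck_on_mult Ck_on_affine) auto
  then show ?thesis unfolding smooth_on_def bump_def
    by (simp add: algebra_simps)
qed

lemma bump_range: "0 \<le> bump s t n x" "bump s t n x \<le> 1"
proof -
  have "0 \<le> flat 0 y" "flat 0 y \<le> 1" for y by (auto simp: flat_def)
  then show "0 \<le> bump s t n x" "bump s t n x \<le> 1"
    unfolding bump_def by (auto intro: mult_le_one)
qed

lemma bump_outside: "x \<notin> {s<..<t} \<Longrightarrow> bump s t n x = 0"
  by (auto simp: bump_def flat_def not_less zero_less_mult_iff)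

lemma bump_pos: "x \<in> {s<..<t} \<Longrightarrow> n > 0 \<Longrightarrow> bump s t n x > 0"
  by (auto simp: bump_def flat_def)

lemma bump_tendsto_1:
  assumes "x \<in> {s<..<t}"
  shows "(\<lambda>n. bump s t n x) \<longlonglongrightarrow> 1"
proof -
  have f: "(\<lambda>n. flat 0 (real n * y)) \<longlonglongrightarrow> 1" if "y > 0" for y
  proof -
    have "(\<lambda>n. exp (- (inverse (real n) * (1 / y)))) \<longlonglongrightarrow> exp (- (0 * (1 / y)))"
      by (intro tendsto_intros lim_inverse_n)
    then have "(\<lambda>n. exp (- (inverse (real n) * (1 / y)))) \<longlonglongrightarrow> 1" by simp
    then show ?thesis
      by (rule Lim_transform_eventually)
        (use that in \<open>auto simp: flat_def eventually_sequentially field_simps intro!: exI[of _ 1]\<close>)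
  qed
  have "(\<lambda>n. flat 0 (real n * (x - s)) * flat 0 (real n * (t - x))) \<longlonglongrightarrow> 1 * 1"
    using assms by (intro tendsto_mult f) auto
  then show ?thesis by (simp add: bump_def)
qed

lemma smooth_on_real_imp:
  fixes \<phi> :: "real \<Rightarrow> real"
  assumes "smooth_on UNIV \<phi>"
  shows "(\<phi> has_field_derivative deriv \<phi> t) (at t)" "continuous_on UNIV \<phi>"
    "continuous_on UNIV (deriv \<phi>)"
proof -
  have ck: "Ck_on 0 UNIV \<phi>" "Ck_on (Suc 0) UNIV \<phi>" using assms unfolding smooth_on_def by blast+
  then have d: "\<phi> differentiable (at t)" for t by simp
  then show 1: "(\<phi> has_field_derivative deriv \<phi> t) (at t)" for t
    by (simp add: DERIV_deriv_iff_real_differentiable)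
  show "continuous_on UNIV \<phi>" using ck by simp
  have "frechet_derivative \<phi> (at t) 1 = deriv \<phi> t" for t
    using 1[of t] frechet_derivative_at[of \<phi> _ t] by (metis has_field_derivative_def mult.right_neutral)
  then show "continuous_on UNIV (deriv \<phi>)"
    using ck(2) by (simp) (metis (no_types, lifting) continuous_on_cong)
qed

text \<open>A smooth function with compact support and mean zero is the derivative of a test function: these are
the functions against which a weak derivative can be tested after one integration.\<close>

lemma test_function_primitive:
  fixes \<rho> :: "real \<Rightarrow> real"
  assumes "smooth_on UNIV \<rho>" and out: "\<And>x. x \<notin> {s..t} \<Longrightarrow> \<rho> x = 0"
    and "a < s" "s \<le> t" "t < b" and int: "(\<rho> has_integral 0) {s..t}"
  obtains \<phi> where "test_function a b \<phi>" "\<And>x. deriv \<phi> x = \<rho> x"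
proof -
  have cont: "continuous_on UNIV \<rho>" using smooth_on_real_imp[OF assms(1)] by blast
  obtain F where F: "\<And>x. (F has_vector_derivative \<rho> x) (at x)"
    using einterval_antiderivative[of "-\<infinity>" "\<infinity>" \<rho>] cont
    by (auto simp: continuous_on_eq_continuous_at)
  define \<phi> where "\<phi> x = F x - F s" for x
  have d: "(\<phi> has_field_derivative \<rho> x) (at x)" for x
    unfolding \<phi>_def using F[of x]
    by (auto intro!: derivative_eq_intros simp: has_real_derivative_iff_has_vector_derivative)
  have z: "\<phi> x = 0" if "x \<notin> {s..t}" for x
  proof -
    have "\<phi> t = 0"
    proof -
      have "(\<rho> has_integral (\<phi> t - \<phi> s)) {s..t}"
        using d \<open>s \<le> t\<close> by (intro fundamental_theorem_of_calculus)
          (auto simp: has_real_derivative_iff_has_vector_derivative[symmetric] intro: has_field_derivative_at_within)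
      then have "\<phi> t - \<phi> s = 0" using int by (rule has_integral_unique)
      then show ?thesis by (simp add: \<phi>_def)
    qed
    have "\<phi> y = \<phi> x" if "x < y" "\<And>z. x < z \<Longrightarrow> z < y \<Longrightarrow> \<rho> z = 0" for x y
    proof -
      have "continuous_on {x..y} \<phi>"
        using d DERIV_isCont by (blast intro: continuous_at_imp_continuous_on)
      then show ?thesis
        using DERIV_isconst_end[OF that(1)] d that(2) by metis
    qed
    note const = this
    show ?thesis
    proof (cases "x < s")
      case True
      then show ?thesis using const[of x s] out by (auto simp: \<phi>_def)
    next
      case False
      then show ?thesis using const[of t x] out that \<open>\<phi> t = 0\<close> by auto
    qed
  qed
  show ?thesis
  proof
    show "deriv \<phi> x = \<rho> x" for x using d DERIV_imp_deriv by blast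
    have "Ck_on k UNIV \<phi>" for k
    proof (cases k)
      case 0
      have "isCont \<phi> x" for x using d DERIV_isCont by blast
      then show ?thesis using 0 by (simp add: continuous_at_imp_continuous_on)
    next
      case (Suc j)
      show ?thesis unfolding Suc
      proof (rule Ck_on_SucI)
        show "(\<phi> has_derivative (\<lambda>h. \<rho> x * h)) (at x)" for x
          using d[of x] by (simp add: has_field_derivative_def)
        show "Ck_on j UNIV (\<lambda>x. \<rho> x * u)" for u
          using assms(1) unfolding smooth_on_def by (intro Ck_on_mult Ck_on_const) auto
      qed
    qed
    moreover have "closure {t. \<phi> t \<noteq> 0} \<subseteq> {s..t}"
      by (rule closure_minimal) (use z in blast, rule closed_real_atLeastAtMost)
    ultimately show "test_function a b \<phi>"
      using assms(3-5) unfolding test_function_def smooth_on_def by fastforce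
  qed
qed

lemma absolutely_integrable_continuous_scaleR:
  fixes f :: "real \<Rightarrow> 'b::euclidean_space"
  assumes "continuous_on {a..b} \<psi>" "f absolutely_integrable_on {a..b}"
  shows "(\<lambda>t. \<psi> t *\<^sub>R f t) absolutely_integrable_on {a..b}"
proof (rule absolutely_integrable_bounded_measurable_product[where h = "(*\<^sub>R)"])
  show "bilinear ((*\<^sub>R) :: real \<Rightarrow> 'b \<Rightarrow> 'b)"
    by (auto simp: bilinear_def linear_iff algebra_simps)
  show "\<psi> \<in> borel_measurable (lebesgue_on {a..b})"
    using assms by (intro continuous_imp_measurable_on_sets_lebesgue) auto
  show "bounded (\<psi> ` {a..b})"
    using assms by (intro compact_imp_bounded compact_continuous_image) auto
qed (use assms in auto)

text \<open>The lemma of du Bois-Reymond. Subtracting from a bump the multiple of a fixed bump \<open>\<psi>\<close> with the same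
mean leaves the derivative of a test function; so \<open>w\<close> pairs with every bump as a constant \<open>C\<close> does. In
the limit \<open>w\<close> and \<open>C\<close> have the same integral over every interval, and differentiating gives \<open>w = C\<close>
almost everywhere.\<close>

lemma ae_const_if_orthogonal_to_derivatives:
  fixes w :: "real \<Rightarrow> 'b::euclidean_space"
  assumes "a < b" and w: "w absolutely_integrable_on {a..b}"
    and orth: "\<And>\<phi>. test_function a b \<phi> \<Longrightarrow> ((\<lambda>t. deriv \<phi> t *\<^sub>R w t) has_integral 0) {a..b}"
  obtains C N where "negligible N" "\<And>t. t \<in> {a..b} - N \<Longrightarrow> w t = C"
proof -
  \<comment> \<open>Any two interior points would do as end points of the support of the reference bump.\<close>
  define m1 m2 where "m1 = (2 * a + b) / 3" and "m2 = (a + 2 * b) / 3"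
  have m: "a < m1" "m1 < m2" "m2 < b" using \<open>a < b\<close> by (auto simp: m1_def m2_def)
  define \<psi> where "\<psi> = bump m1 m2 1"
  note bump_cont = smooth_on_real_imp(2)[OF smooth_bump]
  define I where "I \<rho> = integral {a..b} \<rho>" for \<rho> :: "real \<Rightarrow> real"
  define L where "L \<rho> = integral {a..b} (\<lambda>t. \<rho> t *\<^sub>R w t)" for \<rho> :: "real \<Rightarrow> real"
  have int_bump: "bump s t n integrable_on {u..v}" for s t n u v
    using bump_cont continuous_on_subset by (intro integrable_continuous_real) blast
  have int_bump_w: "(\<lambda>x. bump s t n x *\<^sub>R w x) integrable_on {a..b}" for s t n
    using absolutely_integrable_continuous_scaleR[OF _ w] bump_cont continuous_on_subset
    by (metis absolutely_integrable_on_def top_greatest)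
  have "I \<psi> \<noteq> 0"
  proof
    assume "I \<psi> = 0"
    moreover have "continuous_on {a..b} \<psi>"
      using bump_cont continuous_on_subset unfolding \<psi>_def by blast
    ultimately have "\<forall>x\<in>{a..b}. \<psi> x = 0"
      using integral_eq_0_iff[of a b \<psi>] \<open>a < b\<close> bump_range(1) unfolding I_def \<psi>_def by blast
    then have "\<psi> ((m1+m2)/2) = 0" using m by auto
    then show False using bump_pos[of "(m1+m2)/2" m1 m2 1] m by (simp add: \<psi>_def)
  qed
  define C where "C = (1 / I \<psi>) *\<^sub>R L \<psi>"
  have L_bump: "L (bump s t n) = I (bump s t n) *\<^sub>R C" if st: "a < s" "s < t" "t < b" for s t n
  proof -
    define \<kappa> where "\<kappa> = I (bump s t n) / I \<psi>"
    define \<rho> where "\<rho> x = bump s t n x + (-\<kappa>) * \<psi> x" for x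
    let ?s = "min s m1" and ?t = "max t m2"
    have sm: "smooth_on UNIV \<rho>"
      using smooth_bump[of s t n] smooth_bump[of m1 m2 1] unfolding smooth_on_def \<rho>_def \<psi>_def
      by (intro allI Ck_on_add Ck_on_mult Ck_on_const) auto
    have out: "\<rho> x = 0" if "x \<notin> {?s..?t}" for x
    proof -
      have "x \<notin> {s<..<t}" "x \<notin> {m1<..<m2}" using that by auto
      then show ?thesis by (simp add: \<rho>_def \<psi>_def bump_outside del: greaterThanLessThan_iff)
    qed
    have "(\<rho> has_integral (I (bump s t n) + (-\<kappa>) * I \<psi>)) {a..b}"
      unfolding \<rho>_def I_def \<psi>_def using int_bump
      by (intro has_integral_add has_integral_mult_right integrable_integral)
    then have "(\<rho> has_integral 0) {a..b}" using \<open>I \<psi> \<noteq> 0\<close> by (simp add: \<kappa>_def)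
    moreover have i: "\<rho> integrable_on {?s..?t}"
      using smooth_on_real_imp(2)[OF sm] continuous_on_subset by (intro integrable_continuous_real) blast
    have "(\<rho> has_integral integral {?s..?t} \<rho>) {a..b}"
      by (rule has_integral_on_superset[OF integrable_integral[OF i]]) (use out st m in auto)
    ultimately have "(\<rho> has_integral 0) {?s..?t}"
      using i has_integral_unique integrable_integral by metis
    moreover have "a < ?s" "?s \<le> ?t" "?t < b" using st m by auto
    ultimately obtain \<phi> where \<phi>: "test_function a b \<phi>" "\<And>x. deriv \<phi> x = \<rho> x"
      using test_function_primitive[OF sm out] by blast
    have "((\<lambda>t. \<rho> t *\<^sub>R w t) has_integral 0) {a..b}" using orth[OF \<phi>(1)] \<phi>(2) by simp
    moreover have "((\<lambda>x. bump s t n x *\<^sub>R w x + (-\<kappa>) *\<^sub>R (\<psi> x *\<^sub>R w x)) has_integral (L (bump s t n) + (-\<kappa>) *\<^sub>R L \<psi>)) {a..b}"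
      unfolding L_def \<psi>_def using int_bump_w
      by (intro has_integral_add has_integral_cmul integrable_integral)
    then have "((\<lambda>t. \<rho> t *\<^sub>R w t) has_integral (L (bump s t n) + (-\<kappa>) *\<^sub>R L \<psi>)) {a..b}"
      by (simp add: \<rho>_def scaleR_add_left scaleR_diff_left)
    ultimately have "L (bump s t n) + (-\<kappa>) *\<^sub>R L \<psi> = 0" using has_integral_unique by blast
    then show ?thesis by (simp add: \<kappa>_def C_def)
  qed
  have lim: "(\<lambda>n. integral {a..b} (\<lambda>x. bump s t n x *\<^sub>R f x)) \<longlonglongrightarrow> integral {s..t} f"
    if st: "a < s" "s < t" "t < b" and f: "f absolutely_integrable_on {a..b}" for s t and f :: "real \<Rightarrow> 'c::euclidean_space"
  proof -
    have "(\<lambda>n. integral {a..b} (\<lambda>x. bump s t n x *\<^sub>R f x)) \<longlonglongrightarrow> integral {a..b} (\<lambda>x. if x \<in> {s<..<t} then f x else 0)"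
    proof (rule dominated_convergence(2))
      show "(\<lambda>x. bump s t n x *\<^sub>R f x) integrable_on {a..b}" for n
        using absolutely_integrable_continuous_scaleR[OF _ f] bump_cont continuous_on_subset
        by (metis absolutely_integrable_on_def top_greatest)
      show "(\<lambda>x. norm (f x)) integrable_on {a..b}" using f absolutely_integrable_on_def by blast
      show "norm (bump s t n x *\<^sub>R f x) \<le> norm (f x)" for n x
        using bump_range[of s t n x] by (simp add: mult_left_le_one_le)
      show "(\<lambda>n. bump s t n x *\<^sub>R f x) \<longlonglongrightarrow> (if x \<in> {s<..<t} then f x else 0)" for x
        using tendsto_scaleR[OF bump_tendsto_1[of x s t] tendsto_const[of "f x"]] bump_outside[of x s t]
        by auto
    qed
    also have "integral {a..b} (\<lambda>x. if x \<in> {s<..<t} then f x else 0) = integral {s<..<t} f"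
    proof -
      have "{s<..<t} \<inter> {a..b} = {s<..<t}" using st by auto
      then show ?thesis by (simp only: integral_restrict_Int)
    qed
    also have "\<dots> = integral {s..t} f"
      by (rule integral_open_interval_real[symmetric])
    finally show ?thesis .
  qed
  have int_w: "integral {s..t} w = (t - s) *\<^sub>R C" if st: "a < s" "s < t" "t < b" for s t
  proof -
    have "(\<lambda>n. L (bump s t n)) \<longlonglongrightarrow> integral {s..t} w"
      unfolding L_def using lim[OF st w] .
    moreover have "(\<lambda>n. I (bump s t n)) \<longlonglongrightarrow> integral {s..t} (\<lambda>x. 1::real)"
      using lim[OF st, of "\<lambda>_. 1::real"] unfolding I_def by simp
    then have "(\<lambda>n. I (bump s t n) *\<^sub>R C) \<longlonglongrightarrow> (t - s) *\<^sub>R C"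
      using st by (intro tendsto_scaleR) auto
    ultimately show ?thesis using L_bump[OF st] LIMSEQ_unique by fastforce
  qed
  have wi: "w integrable_on {a..b}" using w absolutely_integrable_on_def by blast
  obtain N where N: "negligible N" "\<And>x. x \<in> {a..b} - N \<Longrightarrow>
       ((\<lambda>t. integral {a..t} w) has_vector_derivative w x) (at x within {a..b})"
    by (rule ae_has_vector_derivative_indefinite_integral[OF wi]) blast
  show ?thesis
  proof
    show "negligible (N \<union> {a, b})" using N(1) by (intro negligible_Un) (auto intro: negligible_finite)
    fix x assume x: "x \<in> {a..b} - (N \<union> {a, b})"
    have W: "integral {a..t} w = integral {a..m1} w + (t - m1) *\<^sub>R C" if "t \<in> {a<..<b}" for t
    proof (cases "m1" t rule: linorder_cases)
      case less
      then have "integral {a..t} w - integral {a..m1} w = (t - m1) *\<^sub>R C"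
        using integral_increment[OF wi, of m1 t] int_w[of m1 t] m that by simp
      then show ?thesis by (metis add.commute diff_add_cancel)
    next
      case greater
      have "integral {a..m1} w - integral {a..t} w = (m1 - t) *\<^sub>R C"
        using integral_increment[OF wi, of t m1] int_w[of t m1] greater m that by simp
      then have "integral {a..t} w = integral {a..m1} w - (m1 - t) *\<^sub>R C"
        by (metis diff_diff_eq2 add_diff_cancel_left')
      then show ?thesis by (simp add: algebra_simps)
    qed simp
    have x': "x \<in> {a<..<b}" using x by auto
    have "at x within {a..b} = at x" using x' by (simp add: at_within_Icc_at)
    then have "((\<lambda>t. integral {a..t} w) has_vector_derivative w x) (at x)" using N(2)[of x] x by auto
    moreover have "((\<lambda>t. integral {a..m1} w + (t - m1) *\<^sub>R C) has_vector_derivative C) (at x)"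
      by (auto intro!: derivative_eq_intros simp: has_vector_derivative_def)
    then have "((\<lambda>t. integral {a..t} w) has_vector_derivative C) (at x)"
      by (rule has_vector_derivative_transform_within_open[of _ _ _ "{a<..<b}"]) (use W x' in auto)
    ultimately show "w x = C" by (rule vector_derivative_unique_at)
  qed
qed

lemma test_function_boundary:
  assumes "test_function a b \<phi>" "t \<notin> {a<..<b}"
  shows "\<phi> t = 0"
  using assms closure_subset[of "{t. \<phi> t \<noteq> 0}"] unfolding test_function_def by blast

text \<open>The primitive \<open>H\<close> of \<open>h\<close> is absolutely continuous, so integrating \<open>(\<phi> H)' = \<phi> h + \<phi>' H\<close> shows
that \<open>h\<close> is a weak derivative of \<open>H\<close> too; \<open>f - H\<close> then has weak derivative \<open>0\<close>.\<close>

lemma weak_derivative_imp_primitive: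
  fixes f h :: "real \<Rightarrow> 'b::euclidean_space"
  assumes "a < b" and f: "f absolutely_integrable_on {a..b}" and h: "h absolutely_integrable_on {a..b}"
    and wd: "weak_derivative a b f h"
  obtains C N where "negligible N" "\<And>t. t \<in> {a..b} - N \<Longrightarrow> f t = C + integral {a..t} h"
proof -
  define H where "H t = integral {a..t} h" for t
  have hi: "h integrable_on {a..b}" using h absolutely_integrable_on_def by blast
  have H_cont: "continuous_on {a..b} H"
    unfolding H_def by (rule indefinite_integral_continuous_1[OF hi])
  have H_abs: "H absolutely_integrable_on {a..b}"
    by (rule absolutely_integrable_continuous_real[OF H_cont])
  have acH: "ac_on a b H" using ac_on_indefinite_integral[OF h, of 0] by (simp add: H_def[abs_def])
  obtain N where N: "negligible N" "\<And>x. x \<in> {a..b} - N \<Longrightarrow> (H has_vector_derivative h x) (at x within {a..b})"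
    using ae_has_vector_derivative_indefinite_integral[OF hi] unfolding H_def[abs_def] by metis
  have orth: "((\<lambda>t. deriv \<phi> t *\<^sub>R (f t - H t)) has_integral 0) {a..b}" if \<phi>: "test_function a b \<phi>" for \<phi>
  proof -
    have sm: "smooth_on UNIV \<phi>" using \<phi> unfolding test_function_def by blast
    note d = smooth_on_real_imp(1)[OF sm]
    have c: "continuous_on {a..b} \<phi>" "continuous_on {a..b} (deriv \<phi>)"
      using smooth_on_real_imp(2,3)[OF sm] continuous_on_subset by blast+
    have "ac_on a b \<phi>"
      by (rule ac_on_C1[where D = "deriv \<phi>"])
        (use c d in \<open>auto simp: has_real_derivative_iff_has_vector_derivative intro: has_vector_derivative_at_within\<close>)
    then have "((\<lambda>t. \<phi> t *\<^sub>R h t + deriv \<phi> t *\<^sub>R H t) has_integral (\<phi> b *\<^sub>R H b - \<phi> a *\<^sub>R H a)) {a..b}"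
      using \<open>a < b\<close> d N(2)
      by (intro ac_on_FTC[OF _ _ N(1)] ac_on_scaleR acH has_vector_derivative_scaleR)
        (auto intro: has_field_derivative_at_within)
    then have 1: "((\<lambda>t. \<phi> t *\<^sub>R h t + deriv \<phi> t *\<^sub>R H t) has_integral 0) {a..b}"
      using test_function_boundary[OF \<phi>] by simp
    note i1 = absolutely_integrable_continuous_scaleR[OF c(1) h]
      and i2 = absolutely_integrable_continuous_scaleR[OF c(2) f]
    have "integral {a..b} (\<lambda>t. deriv \<phi> t *\<^sub>R f t) = - integral {a..b} (\<lambda>t. \<phi> t *\<^sub>R h t)"
      using wd \<phi> set_lebesgue_integral_eq_integral(2)[OF i1] set_lebesgue_integral_eq_integral(2)[OF i2]
      unfolding weak_derivative_def by metis
    moreover have i12: "((\<lambda>t. deriv \<phi> t *\<^sub>R f t) has_integral integral {a..b} (\<lambda>t. deriv \<phi> t *\<^sub>R f t)) {a..b}"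
       "((\<lambda>t. \<phi> t *\<^sub>R h t) has_integral integral {a..b} (\<lambda>t. \<phi> t *\<^sub>R h t)) {a..b}"
      using i1 i2 absolutely_integrable_on_def by (blast intro: integrable_integral)+
    ultimately have "((\<lambda>t. deriv \<phi> t *\<^sub>R f t + \<phi> t *\<^sub>R h t) has_integral 0) {a..b}"
      using has_integral_add[OF i12] by simp
    from has_integral_diff[OF this 1] show ?thesis
      by (simp add: algebra_simps)
  qed
  obtain C N where "negligible N" "\<And>t. t \<in> {a..b} - N \<Longrightarrow> f t - H t = C"
    using ae_const_if_orthogonal_to_derivatives[OF \<open>a < b\<close> set_integral_diff(1)[OF f H_abs] orth] by metis
  then show thesis using that[of N C] unfolding H_def by (metis diff_add_cancel)
qed

lemma L2_on_imp_absolutely_integrable: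
  fixes f :: "real \<Rightarrow> 'b::euclidean_space"
  assumes "L2_on a b f"
  shows "f absolutely_integrable_on {a..b}" "(\<lambda>t. (norm (f t))\<^sup>2) integrable_on {a..b}"
    "f \<in> borel_measurable (lebesgue_on {a..b})"
proof -
  show 1: "f \<in> borel_measurable (lebesgue_on {a..b})"
    using assms unfolding L2_on_def set_borel_measurable_def
    by (simp add: borel_measurable_restrict_space_iff)
  show 2: "(\<lambda>t. (norm (f t))\<^sup>2) integrable_on {a..b}"
    using assms set_lebesgue_integral_eq_integral(1) unfolding L2_on_def by blast
  show "f absolutely_integrable_on {a..b}"
  proof (rule measurable_bounded_by_integrable_imp_absolutely_integrable[OF 1])
    show "(\<lambda>t. 1 + (norm (f t))\<^sup>2) integrable_on {a..b}" using 2 by (intro integrable_add) auto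
    show "norm (f x) \<le> 1 + (norm (f x))\<^sup>2" for x
    proof -
      have "0 \<le> (norm (f x) - 1)\<^sup>2" "0 \<le> norm (f x)" by auto
      moreover have "(norm (f x) - 1)\<^sup>2 = (norm (f x))\<^sup>2 - 2 * norm (f x) + 1"
        by (simp add: power2_diff)
      ultimately show ?thesis by linarith
    qed
  qed auto
qed

lemma continuous_ae_eq_imp_eq:
  fixes f g :: "real \<Rightarrow> 'b::euclidean_space"
  assumes "a < b" "continuous_on {a..b} f" "continuous_on {a..b} g" "negligible N"
    and "\<And>t. t \<in> {a..b} - N \<Longrightarrow> f t = g t" and "t \<in> {a..b}"
  shows "f t = g t"
proof (rule ccontr)
  assume "f t \<noteq> g t"
  define d where "d s = norm (f s - g s)" for s
  have c: "continuous_on {a..b} d" unfolding d_def using assms(2,3) by (intro continuous_intros)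
  have "d t > 0" using \<open>f t \<noteq> g t\<close> by (simp add: d_def)
  then obtain \<delta> where "\<delta> > 0" and \<delta>: "\<And>s. s \<in> {a..b} \<Longrightarrow> dist s t < \<delta> \<Longrightarrow> dist (d s) (d t) < d t"
    using c \<open>t \<in> {a..b}\<close> unfolding continuous_on_iff by blast
  have pos: "d s > 0" if "s \<in> {a..b}" "dist s t < \<delta>" for s
    using \<delta>[OF that] by (auto simp: dist_real_def)
  define u v where "u = max a (t - \<delta>)" and "v = min b (t + \<delta>)"
  have uv: "u < v" using \<open>a < b\<close> \<open>t \<in> {a..b}\<close> \<open>\<delta> > 0\<close> by (auto simp: u_def v_def)
  have "{u<..<v} \<subseteq> N"
  proof
    fix s assume "s \<in> {u<..<v}"
    then have "s \<in> {a..b}" "dist s t < \<delta>" by (auto simp: u_def v_def dist_real_def)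
    then have "f s \<noteq> g s" using pos by (force simp: d_def)
    then show "s \<in> N" using assms(5) \<open>s \<in> {a..b}\<close> by blast
  qed
  then have "negligible {u<..<v}" using assms(4) negligible_subset by blast
  then show False using uv open_not_negligible[of "{u<..<v}"] by simp
qed

text \<open>In one dimension a continuous representative of a \<open>W\<^sup>2\<^sup>,\<^sup>2\<close> function is continuously differentiable
with absolutely continuous derivative, so the weak calculus can be traded for the classical one.\<close>

lemma sobolev_W22_imp:
  fixes f :: "real \<Rightarrow> 'b::euclidean_space"
  assumes "a < b" "sobolev_W22 a b f" "continuous_on {a..b} f"
  obtains u h where "\<And>t. t \<in> {a..b} \<Longrightarrow> (f has_vector_derivative u t) (at t within {a..b})"
    "\<And>t. t \<in> {a..b} \<Longrightarrow> u t = u a + integral {a..t} h" "L2_on a b h"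
proof -
  obtain f1 f2 where L: "L2_on a b f" "L2_on a b f1" "L2_on a b f2"
    and W: "weak_derivative a b f f1" "weak_derivative a b f1 f2"
    using assms(2) unfolding sobolev_W22_def by blast
  note ai = L[THEN L2_on_imp_absolutely_integrable(1)]
  obtain C N where 1: "negligible N" "\<And>t. t \<in> {a..b} - N \<Longrightarrow> f1 t = C + integral {a..t} f2"
    by (rule weak_derivative_imp_primitive[OF \<open>a < b\<close> ai(2,3) W(2)]) blast
  obtain C' N' where 2: "negligible N'" "\<And>t. t \<in> {a..b} - N' \<Longrightarrow> f t = C' + integral {a..t} f1"
    by (rule weak_derivative_imp_primitive[OF \<open>a < b\<close> ai(1,2) W(1)]) blast
  define u where "u t = C + integral {a..t} f2" for t
  have int: "f1 integrable_on {a..b}" "f2 integrable_on {a..b}" using ai absolutely_integrable_on_def by blast+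
  have u_cont: "continuous_on {a..b} u"
    unfolding u_def by (intro continuous_intros indefinite_integral_continuous_1 int)
  have f1u: "integral {a..t} f1 = integral {a..t} u" if "t \<in> {a..b}" for t
    by (rule integral_spike[OF 1(1)]) (use 1(2) that in \<open>auto simp: u_def\<close>)
  have f_eq: "f t = C' + integral {a..t} u" if "t \<in> {a..b}" for t
  proof (rule continuous_ae_eq_imp_eq[OF \<open>a < b\<close> assms(3) _ 2(1) _ that])
    show "continuous_on {a..b} (\<lambda>t. C' + integral {a..t} u)"
      by (intro continuous_intros indefinite_integral_continuous_1 integrable_continuous_real u_cont)
    show "f s = C' + integral {a..s} u" if "s \<in> {a..b} - N'" for s
      using 2(2)[OF that] f1u that by simp
  qed
  show thesis
  proof
    fix t assume t: "t \<in> {a..b}"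
    have "((\<lambda>t. C' + integral {a..t} u) has_vector_derivative 0 + u t) (at t within {a..b})"
      by (intro has_vector_derivative_add has_vector_derivative_const integral_has_vector_derivative u_cont t)
    then show "(f has_vector_derivative u t) (at t within {a..b})"
      using f_eq t by (auto intro: has_vector_derivative_transform)
    show "u t = u a + integral {a..t} f2" by (simp add: u_def)
  qed (rule L)
qed

section \<open>Linear algebra and calculus of fields of bilinear forms\<close>

lemma linear_basis_expansion:
  fixes l :: "'e::euclidean_space \<Rightarrow> 'f::real_vector"
  assumes "linear l"
  shows "l e = (\<Sum>i\<in>Basis. (e \<bullet> i) *\<^sub>R l i)"
proof -
  interpret linear l by fact
  have "l e = l (\<Sum>i\<in>Basis. (e \<bullet> i) *\<^sub>R i)" by (simp add: euclidean_representation)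
  then show ?thesis by (simp add: sum scale)
qed

lemma bilinear_basis_expansion:
  fixes B :: "'e::euclidean_space \<Rightarrow> 'e \<Rightarrow> 'f::real_vector"
  assumes "bilinear B"
  shows "B x y = (\<Sum>i\<in>Basis. \<Sum>j\<in>Basis. ((x \<bullet> i) * (y \<bullet> j)) *\<^sub>R B i j)"
proof -
  have "B x y = (\<Sum>i\<in>Basis. (x \<bullet> i) *\<^sub>R B i y)"
    using assms by (intro linear_basis_expansion) (simp add: bilinear_def)
  also have "\<dots> = (\<Sum>i\<in>Basis. (x \<bullet> i) *\<^sub>R (\<Sum>j\<in>Basis. (y \<bullet> j) *\<^sub>R B i j))"
    using assms by (intro sum.cong refl arg_cong2[of _ _ _ _ scaleR] linear_basis_expansion) (simp add: bilinear_def)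
  finally show ?thesis by (simp add: scaleR_sum_right)
qed

text \<open>Product rules for linear and bilinear maps that depend on a point and are known only through their
values on fixed vectors, as Jacobians and metric tensors in a chart are. The set \<open>S\<close> may be
an open set of a chart or a time interval.\<close>

lemma has_derivative_linear_field:
  fixes L :: "'p::real_normed_vector \<Rightarrow> 'e::euclidean_space \<Rightarrow> 'f::real_normed_vector"
  assumes "x \<in> S" and lin: "\<And>s. s \<in> S \<Longrightarrow> linear (L s)"
    and L': "\<And>e. ((\<lambda>s. L s e) has_derivative (\<lambda>h. L' h e)) (at x within S)"
    and lin': "\<And>h. linear (L' h)"
    and A: "(a has_derivative a') (at x within S)"
  shows "((\<lambda>s. L s (a s)) has_derivative (\<lambda>h. L' h (a x) + L x (a' h))) (at x within S)"
proof -
  note expand = linear_basis_expansion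
  have a_i: "((\<lambda>s. a s \<bullet> i) has_derivative (\<lambda>h. a' h \<bullet> i)) (at x within S)" for i
    by (rule bounded_linear.has_derivative[OF bounded_linear_inner_left A])
  have "((\<lambda>s. \<Sum>i\<in>Basis. (a s \<bullet> i) *\<^sub>R L s i) has_derivative
      (\<lambda>h. \<Sum>i\<in>Basis. (a x \<bullet> i) *\<^sub>R L' h i + (a' h \<bullet> i) *\<^sub>R L x i)) (at x within S)"
    by (intro has_derivative_sum has_derivative_scaleR a_i L')
  moreover have "(\<Sum>i\<in>Basis. (a x \<bullet> i) *\<^sub>R L' h i + (a' h \<bullet> i) *\<^sub>R L x i) = L' h (a x) + L x (a' h)" for h
    by (simp add: sum.distrib expand[OF lin'[of h], of "a x"] expand[OF lin[OF \<open>x \<in> S\<close>], of "a' h"])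
  ultimately have "((\<lambda>s. \<Sum>i\<in>Basis. (a s \<bullet> i) *\<^sub>R L s i) has_derivative (\<lambda>h. L' h (a x) + L x (a' h))) (at x within S)"
    by simp
  then show ?thesis
    by (rule has_derivative_transform[OF \<open>x \<in> S\<close>, rotated]) (simp add: expand[OF lin])
qed

lemma has_derivative_bilinear_field:
  fixes M :: "'p::real_normed_vector \<Rightarrow> 'e::euclidean_space \<Rightarrow> 'e \<Rightarrow> 'f::real_normed_vector"
  assumes "x \<in> S" and bil: "\<And>s. s \<in> S \<Longrightarrow> bilinear (M s)"
    and M': "\<And>e e'. ((\<lambda>s. M s e e') has_derivative (\<lambda>h. M' h e e')) (at x within S)"
    and bil': "\<And>h. bilinear (M' h)"
    and A: "(a has_derivative a') (at x within S)" and B: "(b has_derivative b') (at x within S)"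
  shows "((\<lambda>s. M s (a s) (b s)) has_derivative
     (\<lambda>h. M' h (a x) (b x) + M x (a' h) (b x) + M x (a x) (b' h))) (at x within S)"
proof -
  have "((\<lambda>s. M s e (b s)) has_derivative (\<lambda>h. M' h e (b x) + M x e (b' h))) (at x within S)" for e
    by (rule has_derivative_linear_field[OF \<open>x \<in> S\<close> _ M' _ B])
      (use bil bil' in \<open>auto simp: bilinear_def\<close>)
  moreover have "linear (\<lambda>e. M s e (b s))" if "s \<in> S" for s
    using bil[OF that] by (auto simp: bilinear_def)
  moreover have "linear (\<lambda>e. M' h e (b x) + M x e (b' h))" for h
    using bil[OF \<open>x \<in> S\<close>] bil'[of h] by (intro linear_compose_add) (auto simp: bilinear_def)
  ultimately have "((\<lambda>s. M s (a s) (b s)) has_derivative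
     (\<lambda>h. (M' h (a x) (b x) + M x (a x) (b' h)) + M x (a' h) (b x))) (at x within S)"
    using has_derivative_linear_field[OF \<open>x \<in> S\<close>, of "\<lambda>s e. M s e (b s)" "\<lambda>h e. M' h e (b x) + M x e (b' h)" a a'] A
    by blast
  then show ?thesis by (simp add: algebra_simps)
qed

text \<open>Two applications of the mean value theorem to the second difference. The left-hand side of the equation is
symmetric in \<open>u\<close> and \<open>w\<close>, which is where the symmetry of second derivatives comes from.\<close>

lemma mixed_difference_mvt:
  fixes f :: "'a::euclidean_space \<Rightarrow> real"
  assumes S: "ball x \<delta> \<subseteq> S"
    and Df: "\<And>y. y \<in> S \<Longrightarrow> (f has_derivative (\<lambda>u. Df u y)) (at y)"
    and DDf: "\<And>u y. y \<in> S \<Longrightarrow> (Df u has_derivative (\<lambda>w. DDf u w y)) (at y)"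
    and h: "0 < h" "h * (norm u + norm w) < \<delta>"
  obtains y where "y \<in> ball x \<delta>"
    "f (x + h *\<^sub>R u + h *\<^sub>R w) - f (x + h *\<^sub>R u) - f (x + h *\<^sub>R w) + f x = h * h * DDf u w y"
proof -
  have in_ball: "x + s *\<^sub>R u + t *\<^sub>R w \<in> ball x \<delta>" if "0 \<le> s" "s \<le> h" "0 \<le> t" "t \<le> h" for s t
  proof -
    have "norm (s *\<^sub>R u + t *\<^sub>R w) \<le> s * norm u + t * norm w"
      using norm_triangle_ineq[of "s *\<^sub>R u" "t *\<^sub>R w"] that by simp
    also have "\<dots> \<le> h * norm u + h * norm w"
      using that by (intro add_mono mult_right_mono) auto
    also have "\<dots> < \<delta>" using h by (simp add: algebra_simps)
    finally have "norm (- (s *\<^sub>R u + t *\<^sub>R w)) < \<delta>" by (simp only: norm_minus_cancel)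
    then show ?thesis by (simp add: dist_norm)
  qed
  have lin1: "linear (\<lambda>u. Df u y)" if "y \<in> S" for y using Df[OF that] has_derivative_linear by blast
  have lin2: "linear (\<lambda>w. DDf u w y)" if "y \<in> S" for u y using DDf[OF that] has_derivative_linear by blast
  have dg: "((\<lambda>s. f (x + s *\<^sub>R u + t *\<^sub>R w)) has_derivative (\<lambda>r. r * Df u (x + s *\<^sub>R u + t *\<^sub>R w))) (at s within T)"
    if "0 \<le> s" "s \<le> h" "0 \<le> t" "t \<le> h" for s t T
  proof -
    have y: "x + s *\<^sub>R u + t *\<^sub>R w \<in> S" using in_ball[OF that] S by blast
    have "((\<lambda>s. x + s *\<^sub>R u + t *\<^sub>R w) has_derivative (\<lambda>r. r *\<^sub>R u)) (at s within T)"
      by (auto intro!: derivative_eq_intros)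
    from has_derivative_compose[OF this Df[OF y]] show ?thesis
      by (simp add: linear_cmul[OF lin1[OF y]])
  qed
  have "\<exists>\<xi>\<in>{0<..<h}. (f (x + h *\<^sub>R u + h *\<^sub>R w) - f (x + h *\<^sub>R u + 0 *\<^sub>R w))
       - (f (x + 0 *\<^sub>R u + h *\<^sub>R w) - f (x + 0 *\<^sub>R u + 0 *\<^sub>R w))
     = (h - 0) * Df u (x + \<xi> *\<^sub>R u + h *\<^sub>R w) - (h - 0) * Df u (x + \<xi> *\<^sub>R u + 0 *\<^sub>R w)"
    by (rule mvt_simple[OF h(1), where f = "\<lambda>s. f (x + s *\<^sub>R u + h *\<^sub>R w) - f (x + s *\<^sub>R u + 0 *\<^sub>R w)"])
      (intro has_derivative_diff dg; use h in auto)
  then obtain \<xi> where \<xi>: "0 < \<xi>" "\<xi> < h" and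
    1: "f (x + h *\<^sub>R u + h *\<^sub>R w) - f (x + h *\<^sub>R u) - f (x + h *\<^sub>R w) + f x
     = h * (Df u (x + \<xi> *\<^sub>R u + h *\<^sub>R w) - Df u (x + \<xi> *\<^sub>R u + 0 *\<^sub>R w))"
    by (auto simp: algebra_simps)
  have "\<exists>\<eta>\<in>{0<..<h}. Df u (x + \<xi> *\<^sub>R u + h *\<^sub>R w) - Df u (x + \<xi> *\<^sub>R u + 0 *\<^sub>R w)
      = (h - 0) * DDf u w (x + \<xi> *\<^sub>R u + \<eta> *\<^sub>R w)"
  proof (rule mvt_simple[OF h(1), where f = "\<lambda>t. Df u (x + \<xi> *\<^sub>R u + t *\<^sub>R w)"])
    fix t assume t: "0 \<le> t" "t \<le> h"
    then have y: "x + \<xi> *\<^sub>R u + t *\<^sub>R w \<in> S" using in_ball[of \<xi> t] \<xi> S by auto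
    have "((\<lambda>t. x + \<xi> *\<^sub>R u + t *\<^sub>R w) has_derivative (\<lambda>r. r *\<^sub>R w)) (at t within {0..h})"
      by (auto intro!: derivative_eq_intros)
    from has_derivative_compose[OF this DDf[OF y]]
    show "((\<lambda>t. Df u (x + \<xi> *\<^sub>R u + t *\<^sub>R w)) has_derivative (\<lambda>r. r * DDf u w (x + \<xi> *\<^sub>R u + t *\<^sub>R w))) (at t within {0..h})"
      by (simp add: linear_cmul[OF lin2[OF y]])
  qed
  then obtain \<eta> where \<eta>: "0 < \<eta>" "\<eta> < h" and
    2: "Df u (x + \<xi> *\<^sub>R u + h *\<^sub>R w) - Df u (x + \<xi> *\<^sub>R u + 0 *\<^sub>R w) = h * DDf u w (x + \<xi> *\<^sub>R u + \<eta> *\<^sub>R w)"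
    by auto
  show thesis
    by (rule that[OF in_ball[of \<xi> \<eta>]]) (use \<xi> \<eta> 1 2 in auto)
qed

lemma second_derivative_symmetric_real:
  fixes f :: "'a::euclidean_space \<Rightarrow> real"
  assumes "open S" "x \<in> S"
    and Df: "\<And>y. y \<in> S \<Longrightarrow> (f has_derivative (\<lambda>u. Df u y)) (at y)"
    and DDf: "\<And>u y. y \<in> S \<Longrightarrow> (Df u has_derivative (\<lambda>w. DDf u w y)) (at y)"
    and cont: "\<And>u w. continuous_on S (DDf u w)"
  shows "DDf u w x = DDf w u x"
proof (rule ccontr)
  assume "DDf u w x \<noteq> DDf w u x"
  define d where "d = \<bar>DDf u w x - DDf w u x\<bar>"
  have "d / 2 > 0" using \<open>DDf u w x \<noteq> DDf w u x\<close> by (simp add: d_def)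
  have near: "\<exists>\<delta>>0. \<forall>y\<in>ball x \<delta>. \<bar>DDf u w y - DDf u w x\<bar> < d / 2" for u w
  proof -
    have "isCont (DDf u w) x" using cont assms(1,2) continuous_on_eq_continuous_at by blast
    then obtain \<delta> where "\<delta> > 0" "\<And>y. dist y x < \<delta> \<Longrightarrow> dist (DDf u w y) (DDf u w x) < d / 2"
      using \<open>d / 2 > 0\<close> unfolding continuous_at_eps_delta dist_norm by metis
    then show ?thesis by (auto simp: dist_real_def dist_commute)
  qed
  obtain \<delta>1 where \<delta>1: "\<delta>1 > 0" "\<And>y. y \<in> ball x \<delta>1 \<Longrightarrow> \<bar>DDf u w y - DDf u w x\<bar> < d / 2"
    using near[of u w] by blast
  obtain \<delta>2 where \<delta>2: "\<delta>2 > 0" "\<And>y. y \<in> ball x \<delta>2 \<Longrightarrow> \<bar>DDf w u y - DDf w u x\<bar> < d / 2"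
    using near[of w u] by blast
  obtain \<delta>3 where \<delta>3: "\<delta>3 > 0" "ball x \<delta>3 \<subseteq> S" using assms(1,2) open_contains_ball by blast
  define \<delta> where "\<delta> = min \<delta>1 (min \<delta>2 \<delta>3)"
  have "\<delta> > 0" using \<delta>1 \<delta>2 \<delta>3 by (simp add: \<delta>_def)
  have sub: "ball x \<delta> \<subseteq> ball x \<delta>1" "ball x \<delta> \<subseteq> ball x \<delta>2" "ball x \<delta> \<subseteq> S"
    using \<delta>3 by (auto simp: \<delta>_def)
  define h where "h = \<delta> / (norm u + norm w + 1)"
  have pos: "norm u + norm w + 1 > 0" by (smt (verit) norm_ge_zero)
  have h: "h > 0" "h * (norm u + norm w) < \<delta>" "h * (norm w + norm u) < \<delta>"
    using \<open>\<delta> > 0\<close> pos by (auto simp: h_def field_simps)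
  obtain y where y: "y \<in> ball x \<delta>"
    "f (x + h *\<^sub>R u + h *\<^sub>R w) - f (x + h *\<^sub>R u) - f (x + h *\<^sub>R w) + f x = h * h * DDf u w y"
    by (rule mixed_difference_mvt[OF sub(3) Df DDf h(1,2)])
  obtain z where z: "z \<in> ball x \<delta>"
    "f (x + h *\<^sub>R w + h *\<^sub>R u) - f (x + h *\<^sub>R w) - f (x + h *\<^sub>R u) + f x = h * h * DDf w u z"
    by (rule mixed_difference_mvt[OF sub(3) Df DDf h(1,3)])
  have "x + h *\<^sub>R w + h *\<^sub>R u = x + h *\<^sub>R u + h *\<^sub>R w" by (simp add: add_ac)
  then have "f (x + h *\<^sub>R w + h *\<^sub>R u) = f (x + h *\<^sub>R u + h *\<^sub>R w)" by (rule arg_cong)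
  then have "h * h * DDf u w y = h * h * DDf w u z" using y(2) z(2) by linarith
  then have "DDf u w y = DDf w u z" using h by simp
  moreover have "\<bar>DDf u w y - DDf u w x\<bar> < d / 2" using \<delta>1(2) y sub by blast
  moreover have "\<bar>DDf w u z - DDf w u x\<bar> < d / 2" using \<delta>2(2) z sub by blast
  moreover have "d \<le> \<bar>DDf u w y - DDf u w x\<bar> + \<bar>DDf u w y - DDf w u x\<bar>"
    unfolding d_def by arith
  ultimately show False by simp
qed

lemma second_derivative_symmetric:
  fixes f :: "'a::euclidean_space \<Rightarrow> 'b::euclidean_space"
  assumes "open S" "x \<in> S"
    and Df: "\<And>y. y \<in> S \<Longrightarrow> (f has_derivative (\<lambda>u. Df u y)) (at y)"
    and DDf: "\<And>u y. y \<in> S \<Longrightarrow> (Df u has_derivative (\<lambda>w. DDf u w y)) (at y)"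
    and cont: "\<And>u w. continuous_on S (DDf u w)"
  shows "DDf u w x = DDf w u x"
proof (rule euclidean_eqI)
  fix b :: 'b
  note i = bounded_linear.has_derivative[OF bounded_linear_inner_left]
  have 1: "((\<lambda>y. f y \<bullet> b) has_derivative (\<lambda>u. Df u y \<bullet> b)) (at y)" if "y \<in> S" for y
    by (rule i[OF Df[OF that]])
  have 2: "((\<lambda>y. Df u y \<bullet> b) has_derivative (\<lambda>w. DDf u w y \<bullet> b)) (at y)" if "y \<in> S" for u y
    by (rule i[OF DDf[OF that]])
  have 3: "continuous_on S (\<lambda>y. DDf u w y \<bullet> b)" for u w
    by (intro continuous_intros cont)
  show "DDf u w x \<bullet> b = DDf w u x \<bullet> b"
    using second_derivative_symmetric_real[OF assms(1,2), of "\<lambda>y. f y \<bullet> b" "\<lambda>u y. Df u y \<bullet> b"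
       "\<lambda>u w y. DDf u w y \<bullet> b", OF 1 2 3] .
qed

lemma posdef_lower_bound:
  fixes B :: "'e::euclidean_space \<Rightarrow> 'e \<Rightarrow> real"
  assumes bil: "bilinear B" and pos: "\<And>x. x \<noteq> 0 \<Longrightarrow> B x x > 0"
  obtains l where "l > 0" "\<And>x. l * (norm x)\<^sup>2 \<le> B x x"
proof -
  interpret bounded_bilinear B using bil bilinear_conv_bounded_bilinear by blast
  have scale: "B (r *\<^sub>R x) (r *\<^sub>R x) = r\<^sup>2 * B x x" for r x
    by (simp add: scaleR_left scaleR_right power2_eq_square)
  have "compact (sphere (0::'e) 1)" "sphere (0::'e) 1 \<noteq> {}" by auto
  moreover have "continuous_on (sphere 0 1) (\<lambda>x. B x x)" by (intro continuous_on continuous_intros)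
  ultimately obtain s where s: "s \<in> sphere 0 1" "\<And>x. x \<in> sphere 0 1 \<Longrightarrow> B s s \<le> B x x"
    by (meson continuous_attains_inf)
  show thesis
  proof
    show "B s s > 0" using s(1) by (intro pos) auto
    fix x :: 'e
    show "B s s * (norm x)\<^sup>2 \<le> B x x"
    proof (cases "x = 0")
      case False
      then have "(1 / norm x) *\<^sub>R x \<in> sphere 0 1" by simp
      from s(2)[OF this] have "B s s \<le> (1 / norm x)\<^sup>2 * B x x" by (simp only: scale)
      then have "B s s * (norm x)\<^sup>2 \<le> ((1 / norm x)\<^sup>2 * B x x) * (norm x)\<^sup>2"
        by (rule mult_right_mono) simp
      then show ?thesis using False by (simp add: power_divide)
    qed (simp add: zero_left)
  qed
qed

lemma riesz_representation:
  fixes B :: "'e::euclidean_space \<Rightarrow> 'e \<Rightarrow> real"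
  assumes bil: "bilinear B" and pos: "\<And>x. x \<noteq> 0 \<Longrightarrow> B x x > 0" and l: "linear l"
  obtains x where "\<And>w. B x w = l w"
proof -
  have lin: "linear (\<lambda>x. B x w)" "linear (B w)" for w using bil by (auto simp: bilinear_def)
  define L where "L x = (\<Sum>b\<in>Basis. B x b *\<^sub>R b)" for x
  have "linear L"
    by (rule linearI) (simp_all add: L_def bilinear_ladd[OF bil] bilinear_lmul[OF bil]
        scaleR_add_left sum.distrib scaleR_sum_right)
  have Lb: "L x \<bullet> b = B x b" if "b \<in> Basis" for x b
    using that by (simp add: L_def inner_sum_left inner_Basis if_distrib sum.delta cong: if_cong)
  have "inj L"
    unfolding linear_injective_0[OF \<open>linear L\<close>]
  proof (intro allI impI)
    fix x assume "L x = 0"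
    then have "B x b = 0" if "b \<in> Basis" for b using Lb[OF that, of x] by simp
    then have "B x x = 0"
      using linear_eq_stdbasis[OF lin(2)[of x] linear_zero] by (metis (no_types, lifting))
    then show "x = 0" using pos by force
  qed
  then have "surj L" using linear_injective_imp_surjective \<open>linear L\<close> by blast
  then obtain x where "L x = (\<Sum>b\<in>Basis. l b *\<^sub>R b)" by (metis surjD)
  then have "B x b = l b" if "b \<in> Basis" for b
    using Lb[OF that, of x] that
    by (simp add: inner_sum_left inner_Basis if_distrib sum.delta cong: if_cong)
  then have "B x = l" by (intro linear_eq_stdbasis lin l)
  then show thesis using that by blast
qed

lemma nondegenerate:
  fixes B :: "'e::euclidean_space \<Rightarrow> 'e \<Rightarrow> real"
  assumes bil: "bilinear B" and pos: "\<And>x. x \<noteq> 0 \<Longrightarrow> B x x > 0" and eq: "\<And>w. B x w = B y w"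
  shows "x = y"
proof (rule ccontr)
  assume "x \<noteq> y"
  then have "B (x - y) (x - y) > 0" by (intro pos) simp
  then show False using eq[of "x - y"] bilinear_lsub[OF bil] by simp
qed

text \<open>The right-hand side of Koszul's formula for constant, hence commuting, vector fields; \<open>dB z\<close> stands
for the derivative of the metric in the direction \<open>z\<close>.\<close>

definition koszul :: "('e \<Rightarrow> 'e \<Rightarrow> 'e \<Rightarrow> real) \<Rightarrow> 'e \<Rightarrow> 'e \<Rightarrow> 'e \<Rightarrow> real" where
  "koszul dB z u w = (dB z u w + dB u z w - dB w z u) / 2"

text \<open>Substitute the compatibility condition for each of the three cyclic permutations of the arguments; by
symmetry of \<open>\<Gamma>\<close> all terms but twice \<open>B (\<Gamma> z u) w\<close> cancel.\<close>

lemma levi_civita_koszul: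
  fixes B :: "'e::euclidean_space \<Rightarrow> 'e \<Rightarrow> real"
  assumes sym: "\<And>x y. B x y = B y x"
    and \<Gamma>: "\<And>z u. \<Gamma> z u = \<Gamma> u z" "\<And>z u w. dB z u w = B (\<Gamma> z u) w + B u (\<Gamma> z w)"
  shows "B (\<Gamma> z u) w = koszul dB z u w"
  unfolding koszul_def \<Gamma>(2) using \<Gamma>(1)[of w u] \<Gamma>(1)[of w z] \<Gamma>(1)[of u z] sym by simp

text \<open>The fundamental theorem of Riemannian geometry at one point: Koszul's formula determines \<open>B (\<Gamma> z u)\<close>,
and nondegeneracy of \<open>B\<close> turns this linear form into a vector.\<close>

lemma levi_civita_ex1:
  fixes B :: "'e::euclidean_space \<Rightarrow> 'e \<Rightarrow> real"
  assumes bil: "bilinear B" and sym: "\<And>x y. B x y = B y x" and pos: "\<And>x. x \<noteq> 0 \<Longrightarrow> B x x > 0"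
    and dB: "\<And>z. bilinear (dB z)" "\<And>u w. linear (\<lambda>z. dB z u w)" "\<And>z u w. dB z u w = dB z w u"
  shows "\<exists>!\<Gamma>. bilinear \<Gamma> \<and> (\<forall>z u. \<Gamma> z u = \<Gamma> u z) \<and>
    (\<forall>z u w. dB z u w = B (\<Gamma> z u) w + B u (\<Gamma> z w))"
proof (rule ex_ex1I)
  note add = bilinear_ladd[OF dB(1)] bilinear_radd[OF dB(1)] linear_add[OF dB(2)]
  note mul = bilinear_lmul[OF dB(1)] bilinear_rmul[OF dB(1)] linear_cmul[OF dB(2)]
  have "linear (koszul dB z u)" for z u
    by (rule linearI) (simp_all add: koszul_def add mul algebra_simps diff_divide_distrib add_divide_distrib)
  then have "\<exists>x. \<forall>w. B x w = koszul dB z u w" for z u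
    using riesz_representation[OF bil pos] by metis
  then obtain \<Gamma> where \<Gamma>: "\<And>z u w. B (\<Gamma> z u) w = koszul dB z u w" by metis
  have "bilinear \<Gamma>"
    unfolding bilinear_def
    by (intro conjI allI linearI nondegenerate[OF bil pos];
      simp add: \<Gamma> bilinear_ladd[OF bil] bilinear_lmul[OF bil] koszul_def add mul algebra_simps
        diff_divide_distrib add_divide_distrib)
  moreover have "\<Gamma> z u = \<Gamma> u z" for z u
    by (rule nondegenerate[OF bil pos]) (simp_all add: \<Gamma> koszul_def dB(3)[of _ u z] add.commute)
  moreover have "dB z u w = B (\<Gamma> z u) w + B u (\<Gamma> z w)" for z u w
    unfolding sym[of u] \<Gamma> using dB(3) by (simp add: koszul_def field_simps)
  ultimately show "\<exists>\<Gamma>. bilinear \<Gamma> \<and> (\<forall>z u. \<Gamma> z u = \<Gamma> u z) \<and>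
    (\<forall>z u w. dB z u w = B (\<Gamma> z u) w + B u (\<Gamma> z w))" by blast
next
  fix \<Gamma> \<Gamma>'
  assume 1: "bilinear \<Gamma> \<and> (\<forall>z u. \<Gamma> z u = \<Gamma> u z) \<and> (\<forall>z u w. dB z u w = B (\<Gamma> z u) w + B u (\<Gamma> z w))"
    and 2: "bilinear \<Gamma>' \<and> (\<forall>z u. \<Gamma>' z u = \<Gamma>' u z) \<and> (\<forall>z u w. dB z u w = B (\<Gamma>' z u) w + B u (\<Gamma>' z w))"
  show "\<Gamma> = \<Gamma>'"
  proof (intro ext nondegenerate[OF bil pos])
    fix z u w
    have "B (\<Gamma> z u) w = koszul dB z u w"
      by (rule levi_civita_koszul[OF sym]) (use 1 in blast)+
    moreover have "B (\<Gamma>' z u) w = koszul dB z u w"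
      by (rule levi_civita_koszul[OF sym]) (use 2 in blast)+
    ultimately show "B (\<Gamma> z u) w = B (\<Gamma>' z u) w" by simp
  qed
qed

text \<open>Continuity of Riesz representatives, without inverting matrices: with \<open>d = X y - X y0\<close>, the form
\<open>B y d\<close> is small because \<open>B y (X y0)\<close> is close to \<open>l y\<close>, while \<open>B y d d\<close> dominates \<open>\<parallel>d\<parallel>\<^sup>2\<close>
uniformly for \<open>y\<close> near \<open>y0\<close>.\<close>

lemma continuous_on_riesz_representative:
  fixes B :: "'p::topological_space \<Rightarrow> 'e::euclidean_space \<Rightarrow> 'e \<Rightarrow> real"
  assumes bil: "\<And>y. y \<in> S \<Longrightarrow> bilinear (B y)"
    and pos: "\<And>y x. y \<in> S \<Longrightarrow> x \<noteq> 0 \<Longrightarrow> B y x x > 0"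
    and B_cont: "\<And>e e'. continuous_on S (\<lambda>y. B y e e')"
    and l_cont: "\<And>w. continuous_on S (\<lambda>y. l y w)"
    and X: "\<And>y w. y \<in> S \<Longrightarrow> B y (X y) w = l y w"
  shows "continuous_on S X"
  unfolding continuous_on_def
proof
  fix y0 assume y0: "y0 \<in> S"
  obtain k where k: "k > 0" "\<And>x. k * (norm x)\<^sup>2 \<le> B y0 x x"
    using posdef_lower_bound[OF bil[OF y0] pos[OF y0]] by blast
  \<comment> \<open>The perturbation of the form, and of the equation that defines the representative.\<close>
  define M where "M y = (\<Sum>i\<in>Basis. \<Sum>j\<in>Basis. \<bar>B y i j - B y0 i j\<bar>)" for y
  define E where "E y = (\<Sum>b\<in>Basis. \<bar>l y b - B y (X y0) b\<bar>)" for y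
  have M0: "(M \<longlongrightarrow> 0) (at y0 within S)"
  proof -
    have "continuous_on S M" unfolding M_def by (intro continuous_intros B_cont)
    then have "(M \<longlongrightarrow> M y0) (at y0 within S)" using y0 continuous_on_def by blast
    then show ?thesis by (simp add: M_def)
  qed
  have E0: "(E \<longlongrightarrow> 0) (at y0 within S)"
  proof -
    have "continuous_on S E" unfolding E_def by (intro continuous_intros B_cont l_cont)
    then have "(E \<longlongrightarrow> E y0) (at y0 within S)" using y0 continuous_on_def by blast
    then show ?thesis by (simp add: E_def X[OF y0])
  qed
  have bound: "norm (X y - X y0) \<le> 2 * E y / k" if y: "y \<in> S" and My: "M y < k / 2" for y
  proof -
    define d where "d = X y - X y0"
    interpret b: bounded_bilinear "B y" using bil[OF y] bilinear_conv_bounded_bilinear by blast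
    have "B y0 d d - B y d d = (\<Sum>i\<in>Basis. \<Sum>j\<in>Basis. (d \<bullet> i) * (d \<bullet> j) * (B y0 i j - B y i j))"
    proof -
      have "B y0 d d = (\<Sum>i\<in>Basis. \<Sum>j\<in>Basis. (d \<bullet> i) * (d \<bullet> j) * B y0 i j)"
        by (subst bilinear_basis_expansion[OF bil[OF y0]]) simp
      moreover have "B y d d = (\<Sum>i\<in>Basis. \<Sum>j\<in>Basis. (d \<bullet> i) * (d \<bullet> j) * B y i j)"
        by (subst bilinear_basis_expansion[OF bil[OF y]]) simp
      ultimately show ?thesis by (simp add: sum_subtractf right_diff_distrib)
    qed
    also have "\<dots> \<le> (\<Sum>i\<in>Basis. \<Sum>j\<in>Basis. (norm d)\<^sup>2 * \<bar>B y i j - B y0 i j\<bar>)"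
    proof (intro sum_mono)
      fix i j :: 'e assume "i \<in> Basis" "j \<in> Basis"
      then have "\<bar>d \<bullet> i\<bar> * \<bar>d \<bullet> j\<bar> \<le> norm d * norm d"
        by (intro mult_mono Basis_le_norm) auto
      then have "\<bar>(d \<bullet> i) * (d \<bullet> j) * (B y0 i j - B y i j)\<bar> \<le> (norm d)\<^sup>2 * \<bar>B y i j - B y0 i j\<bar>"
        unfolding abs_mult power2_eq_square abs_minus_commute[of "B y i j"] by (intro mult_right_mono) auto
      then show "(d \<bullet> i) * (d \<bullet> j) * (B y0 i j - B y i j) \<le> (norm d)\<^sup>2 * \<bar>B y i j - B y0 i j\<bar>" by linarith
    qed
    also have "\<dots> = (norm d)\<^sup>2 * M y" by (simp add: M_def sum_distrib_left)
    also have "\<dots> \<le> (norm d)\<^sup>2 * (k / 2)" using My by (intro mult_left_mono) auto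
    finally have lower: "k / 2 * (norm d)\<^sup>2 \<le> B y d d" using k(2)[of d] by argo
    have "B y d d = l y d - B y (X y0) d" by (simp add: X[OF y, symmetric] d_def b.diff_left)
    also have "\<dots> = (\<Sum>i\<in>Basis. (d \<bullet> i) * (l y i - B y (X y0) i))"
    proof -
      have "B y e d = (\<Sum>i\<in>Basis. (d \<bullet> i) * B y e i)" for e
        using linear_basis_expansion[of "B y e" d] bil[OF y] by (simp add: bilinear_def)
      from this[of "X y"] this[of "X y0"] show ?thesis
        by (simp add: X[OF y] sum_subtractf right_diff_distrib)
    qed
    also have "\<dots> \<le> (\<Sum>i\<in>Basis. norm d * \<bar>l y i - B y (X y0) i\<bar>)"
    proof (intro sum_mono)
      fix i :: 'e assume "i \<in> Basis"
      then have "\<bar>(d \<bullet> i) * (l y i - B y (X y0) i)\<bar> \<le> norm d * \<bar>l y i - B y (X y0) i\<bar>"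
        unfolding abs_mult by (intro mult_right_mono Basis_le_norm) auto
      then show "(d \<bullet> i) * (l y i - B y (X y0) i) \<le> norm d * \<bar>l y i - B y (X y0) i\<bar>" by linarith
    qed
    also have "\<dots> = norm d * E y" by (simp add: E_def sum_distrib_left)
    finally have "k / 2 * (norm d)\<^sup>2 \<le> norm d * E y" using lower by (rule order_trans[rotated])
    then have "(k / 2 * norm d) * norm d \<le> E y * norm d" by (simp add: power2_eq_square mult_ac)
    moreover have "E y \<ge> 0" by (simp add: E_def sum_nonneg)
    ultimately have "k / 2 * norm d \<le> E y" by (cases "norm d = 0") (auto simp: mult_le_cancel_right)
    then show ?thesis using k(1) by (simp add: d_def field_simps)
  qed
  have "eventually (\<lambda>y. M y < k / 2) (at y0 within S)"
    using k(1) by (intro order_tendstoD(2)[OF M0]) simp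
  moreover have "eventually (\<lambda>y. y \<in> S) (at y0 within S)" by (auto simp: eventually_at_filter)
  ultimately have ev: "eventually (\<lambda>y. norm (X y - X y0) \<le> 2 * E y / k) (at y0 within S)"
    by eventually_elim (rule bound)
  have lim: "((\<lambda>y. 2 * E y / k) \<longlongrightarrow> 0) (at y0 within S)"
    using tendsto_divide[OF tendsto_mult[OF tendsto_const[of 2] E0] tendsto_const[of k]] k(1) by simp
  have "((\<lambda>y. X y - X y0) \<longlongrightarrow> 0) (at y0 within S)"
    by (rule Lim_null_comparison[OF ev lim])
  then show "(X \<longlongrightarrow> X y0) (at y0 within S)" by (simp add: LIM_zero_iff)
qed

section \<open>Charts, tangent vectors and the Levi-Civita connection\<close>

locale riemannian =
  fixes A :: "('q::{t2_space,second_countable_topology}, 'e::euclidean_space) chart set"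
    and g :: "('q, 'e) metric"
  assumes atlas: "smooth_atlas A" and metric: "riemannian_metric A g"
begin

lemma chart: "c \<in> A \<Longrightarrow> is_chart c"
  using atlas unfolding smooth_atlas_def by blast

lemma open_chart_dom: "c \<in> A \<Longrightarrow> open (chart_dom c)"
  and open_chart_image: "c \<in> A \<Longrightarrow> open (chart_map c ` chart_dom c)"
  and chart_map_continuous: "c \<in> A \<Longrightarrow> continuous_on (chart_dom c) (chart_map c)"
  and chart_inv_continuous: "c \<in> A \<Longrightarrow> continuous_on (chart_map c ` chart_dom c) (chart_inv c)"
  and chart_inv_map: "c \<in> A \<Longrightarrow> x \<in> chart_dom c \<Longrightarrow> chart_inv c (chart_map c x) = x"
  using chart[of c] unfolding is_chart_def homeomorphism_def by auto

lemma ex_chart: "\<exists>c\<in>A. x \<in> chart_dom c"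
  using atlas unfolding smooth_atlas_def by blast

abbreviation overlap :: "('q, 'e) chart \<Rightarrow> ('q, 'e) chart \<Rightarrow> 'e set" where
  "overlap c c' \<equiv> chart_map c ` (chart_dom c \<inter> chart_dom c')"

lemma open_overlap:
  assumes "c \<in> A" "c' \<in> A"
  shows "open (overlap c c')"
proof -
  have "overlap c c' = chart_map c ` chart_dom c \<inter> chart_inv c -` chart_dom c'"
    using chart_inv_map[OF assms(1)] by auto
  then show ?thesis
    using continuous_open_preimage[OF chart_inv_continuous[OF assms(1)] open_chart_image[OF assms(1)]
        open_chart_dom[OF assms(2)]] by simp
qed

lemma transition_map: "c \<in> A \<Longrightarrow> x \<in> chart_dom c \<Longrightarrow> transition c c' (chart_map c x) = chart_map c' x"
  by (simp add: transition_def chart_inv_map)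

lemma transition_Ck: "c \<in> A \<Longrightarrow> c' \<in> A \<Longrightarrow> Ck_on k (overlap c c') (transition c c')"
  using atlas unfolding smooth_atlas_def smooth_on_def by blast

definition jac :: "('q, 'e) chart \<Rightarrow> ('q, 'e) chart \<Rightarrow> 'e \<Rightarrow> 'e \<Rightarrow> 'e" where
  "jac c c' y = frechet_derivative (transition c c') (at y)"

definition hess :: "('q, 'e) chart \<Rightarrow> ('q, 'e) chart \<Rightarrow> 'e \<Rightarrow> 'e \<Rightarrow> 'e \<Rightarrow> 'e" where
  "hess c c' y u = frechet_derivative (\<lambda>y. jac c c' y u) (at y)"

context
  fixes c c' :: "('q, 'e) chart"
  assumes c: "c \<in> A" "c' \<in> A"
begin

lemma transition_has_derivative:
  "y \<in> overlap c c' \<Longrightarrow> (transition c c' has_derivative jac c c' y) (at y)"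
  using transition_Ck[OF c, of "Suc 0"] by (auto simp: jac_def frechet_derivative_works[symmetric])

lemma jac_linear: "y \<in> overlap c c' \<Longrightarrow> linear (jac c c' y)"
  using transition_has_derivative has_derivative_linear by blast

lemma jac_has_derivative:
  "y \<in> overlap c c' \<Longrightarrow> ((\<lambda>y. jac c c' y u) has_derivative hess c c' y u) (at y)"
  using transition_Ck[OF c, of "Suc (Suc 0)"]
  by (auto simp: hess_def jac_def frechet_derivative_works[symmetric])

lemma hess_sym:
  assumes y: "y \<in> overlap c c'"
  shows "hess c c' y u w = hess c c' y w u"
proof (rule second_derivative_symmetric[OF open_overlap[OF c] y, where Df = "\<lambda>u y. jac c c' y u"
      and DDf = "\<lambda>u w y. hess c c' y u w"])
  show "continuous_on (overlap c c') (\<lambda>y. hess c c' y u w)" for u w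
    using transition_Ck[OF c, of "Suc (Suc 0)"] by (simp add: hess_def jac_def)
qed (use transition_has_derivative jac_has_derivative in auto)

lemma hess_bilinear:
  assumes y: "y \<in> overlap c c'"
  shows "bilinear (hess c c' y)"
proof -
  have "linear (hess c c' y u)" for u
    using jac_has_derivative[OF y] has_derivative_linear by blast
  then show ?thesis
    unfolding bilinear_def using hess_sym[OF y] by (metis (no_types, lifting) ext)
qed

end

lemma jac_cocycle:
  assumes c: "c \<in> A" "c' \<in> A" "c'' \<in> A" and x: "x \<in> chart_dom c" "x \<in> chart_dom c'" "x \<in> chart_dom c''"
  shows "jac c' c'' (chart_map c' x) (jac c c' (chart_map c x) e) = jac c c'' (chart_map c x) e"
proof -
  have 1: "(transition c c' has_derivative jac c c' (chart_map c x)) (at (chart_map c x))"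
    using c x by (intro transition_has_derivative) auto
  have "(transition c' c'' has_derivative jac c' c'' (chart_map c' x)) (at (transition c c' (chart_map c x)))"
    using c x transition_map[OF c(1) x(1)] by (auto intro: transition_has_derivative)
  from has_derivative_compose[OF 1 this]
  have "((\<lambda>y. transition c' c'' (transition c c' y)) has_derivative
      (\<lambda>e. jac c' c'' (chart_map c' x) (jac c c' (chart_map c x) e))) (at (chart_map c x))" .
  then have "(transition c c'' has_derivative
      (\<lambda>e. jac c' c'' (chart_map c' x) (jac c c' (chart_map c x) e))) (at (chart_map c x))"
    by (rule has_derivative_transform_within_open[OF _ open_overlap[OF c(1,2)]])
      (use c x in \<open>auto simp: transition_map\<close>)
  moreover have "(transition c c'' has_derivative jac c c'' (chart_map c x)) (at (chart_map c x))"
    using c x by (intro transition_has_derivative) auto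
  ultimately show ?thesis using has_derivative_unique by metis
qed

lemma jac_same:
  assumes c: "c \<in> A" and x: "x \<in> chart_dom c"
  shows "jac c c (chart_map c x) e = e"
proof -
  have "(transition c c has_derivative (\<lambda>e. e)) (at (chart_map c x))"
    by (rule has_derivative_transform_within_open[OF has_derivative_ident open_chart_image[OF c]])
      (use c x in \<open>auto simp: transition_map\<close>)
  moreover have "(transition c c has_derivative jac c c (chart_map c x)) (at (chart_map c x))"
    using c x by (intro transition_has_derivative) auto
  ultimately show ?thesis using has_derivative_unique by metis
qed

lemma coord_vector_in:
  "c' \<in> A \<Longrightarrow> x \<in> chart_dom c' \<Longrightarrow> coord_vector A c x e c' = jac c c' (chart_map c x) e"
  by (simp add: coord_vector_def jac_def)

lemma coord_vector_same: "c \<in> A \<Longrightarrow> x \<in> chart_dom c \<Longrightarrow> coord_vector A c x e c = e"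
  by (simp add: coord_vector_in jac_same)

lemma coord_vector_tangent:
  assumes "c \<in> A" "x \<in> chart_dom c"
  shows "coord_vector A c x e \<in> tangent_space A x"
  unfolding tangent_space_def
  using assms jac_cocycle[OF assms(1) _ _ assms(2)]
  by (auto simp: coord_vector_in jac_def[symmetric]) (auto simp: coord_vector_def)

lemma tangent_component:
  assumes "v \<in> tangent_space A x" "c \<in> A" "c' \<in> A" "x \<in> chart_dom c" "x \<in> chart_dom c'"
  shows "v c' = jac c c' (chart_map c x) (v c)"
  using assms unfolding tangent_space_def jac_def by blast

lemma tangent_outside: "v \<in> tangent_space A x \<Longrightarrow> c \<notin> A \<or> x \<notin> chart_dom c \<Longrightarrow> v c = 0"
  unfolding tangent_space_def by blast

lemma tangent_eq_coord_vector:
  assumes "v \<in> tangent_space A x" "c \<in> A" "x \<in> chart_dom c"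
  shows "v = coord_vector A c x (v c)"
proof
  fix c'
  show "v c' = coord_vector A c x (v c) c'"
  proof (cases "c' \<in> A \<and> x \<in> chart_dom c'")
    case True
    then show ?thesis using tangent_component[OF assms(1,2) _ assms(3)] by (simp add: coord_vector_in)
  next
    case False
    then have "v c' = 0" using tangent_outside[OF assms(1)] by blast
    then show ?thesis using False by (auto simp: coord_vector_def)
  qed
qed

lemma tangentI:
  assumes "c \<in> A" "x \<in> chart_dom c"
    and "\<And>c'. c' \<in> A \<Longrightarrow> x \<in> chart_dom c' \<Longrightarrow> v c' = jac c c' (chart_map c x) (v c)"
    and "\<And>c'. c' \<notin> A \<or> x \<notin> chart_dom c' \<Longrightarrow> v c' = 0"
  shows "v \<in> tangent_space A x"
proof -
  have "v = coord_vector A c x (v c)"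
  proof
    fix c' show "v c' = coord_vector A c x (v c) c'"
      using assms(3,4)[of c'] by (cases "c' \<in> A \<and> x \<in> chart_dom c'") (auto simp: coord_vector_def jac_def)
  qed
  then show ?thesis using coord_vector_tangent[OF assms(1,2)] by metis
qed

lemma tangent_lincomb:
  assumes "u \<in> tangent_space A x" "v \<in> tangent_space A x"
  shows "(\<lambda>c. a *\<^sub>R u c + b *\<^sub>R v c) \<in> tangent_space A x"
proof -
  obtain c where c: "c \<in> A" "x \<in> chart_dom c" using ex_chart by blast
  show ?thesis
  proof (rule tangentI[OF c])
    fix c' assume c': "c' \<in> A" "x \<in> chart_dom c'"
    have "linear (jac c c' (chart_map c x))" using c c' by (intro jac_linear) auto
    then show "a *\<^sub>R u c' + b *\<^sub>R v c' = jac c c' (chart_map c x) (a *\<^sub>R u c + b *\<^sub>R v c)"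
      using tangent_component[OF _ c(1) c'(1) c(2) c'(2)] assms by (simp add: linear_add linear_cmul)
  next
    fix c' assume "c' \<notin> A \<or> x \<notin> chart_dom c'"
    then show "a *\<^sub>R u c' + b *\<^sub>R v c' = 0"
      using tangent_outside[OF assms(1), of c'] tangent_outside[OF assms(2), of c'] by simp
  qed
qed

lemma zero_tangent: "(\<lambda>_. 0) \<in> tangent_space A x"
proof -
  obtain c where "c \<in> A" "x \<in> chart_dom c" using ex_chart by blast
  then show ?thesis
    using tangent_lincomb[OF coord_vector_tangent coord_vector_tangent, of c x c 0 0 0 0] by simp
qed

lemma g_lincomb:
  "u \<in> tangent_space A x \<Longrightarrow> v \<in> tangent_space A x \<Longrightarrow> w \<in> tangent_space A x \<Longrightarrow>
    g x (\<lambda>c. a *\<^sub>R u c + b *\<^sub>R v c) w = a * g x u w + b * g x v w"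
  and g_sym: "u \<in> tangent_space A x \<Longrightarrow> v \<in> tangent_space A x \<Longrightarrow> g x u v = g x v u"
  and g_pos: "u \<in> tangent_space A x \<Longrightarrow> u \<noteq> (\<lambda>_. 0) \<Longrightarrow> g x u u > 0"
  and metric_in_chart_Ck: "c \<in> A \<Longrightarrow> Ck_on k (chart_map c ` chart_dom c) (\<lambda>y. metric_in_chart A g c y e e')"
  using metric unfolding riemannian_metric_def smooth_on_def by blast+

lemma g_scale:
  assumes "u \<in> tangent_space A x"
  shows "g x (\<lambda>c. a *\<^sub>R u c) (\<lambda>c. a *\<^sub>R u c) = a\<^sup>2 * g x u u"
proof -
  have s: "(\<lambda>c. a *\<^sub>R u c) \<in> tangent_space A x"
    using tangent_lincomb[OF assms assms, of a 0] by simp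
  have l: "g x (\<lambda>c. a *\<^sub>R u c) w = a * g x u w" if "w \<in> tangent_space A x" for w
    using g_lincomb[OF assms assms that, of a 0] by simp
  show ?thesis using l[OF s] l[OF assms] g_sym[OF assms s] by (simp add: power2_eq_square)
qed

lemma g_zero: "g x (\<lambda>_. 0) (\<lambda>_. 0) = 0"
  using g_scale[OF zero_tangent, of x 0] by simp

lemma g_nonneg: "u \<in> tangent_space A x \<Longrightarrow> g x u u \<ge> 0"
  using g_pos[of u x] g_zero[of x] by (cases "u = (\<lambda>_. 0)") auto

lemma tangent_norm_sq: "u \<in> tangent_space A x \<Longrightarrow> (tangent_norm g x u)\<^sup>2 = g x u u"
  and tangent_norm_nonneg: "u \<in> tangent_space A x \<Longrightarrow> tangent_norm g x u \<ge> 0"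
  by (simp_all add: tangent_norm_def g_nonneg)

lemma g_eq_metric_in_chart:
  assumes "c \<in> A" "x \<in> chart_dom c" "u \<in> tangent_space A x" "v \<in> tangent_space A x"
  shows "g x u v = metric_in_chart A g c (chart_map c x) (u c) (v c)"
  using tangent_eq_coord_vector[OF assms(3,1,2)] tangent_eq_coord_vector[OF assms(4,1,2)] assms
  by (simp add: metric_in_chart_def chart_inv_map)

text \<open>The usual discriminant argument, for the vector \<open>g(v,v) u - g(u,v) v\<close>.\<close>

lemma g_Cauchy_Schwarz:
  assumes "u \<in> tangent_space A x" "v \<in> tangent_space A x"
  shows "\<bar>g x u v\<bar> \<le> tangent_norm g x u * tangent_norm g x v"
proof -
  let ?a = "g x u u" and ?b = "g x u v" and ?c = "g x v v"
  have "(?b)\<^sup>2 \<le> ?a * ?c"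
  proof (cases "v = (\<lambda>_. 0)")
    case True
    have "?b = g x v u" using g_sym assms by simp
    also have "\<dots> = 0" using g_lincomb[OF assms(2,2,1), of 0 0] True by simp
    finally show ?thesis using g_nonneg[OF assms(1)] g_nonneg[OF assms(2)] by simp
  next
    case False
    then have pos: "?c > 0" using g_pos assms by blast
    define w where "w = (\<lambda>c. ?c *\<^sub>R u c + (- ?b) *\<^sub>R v c)"
    have w: "w \<in> tangent_space A x" unfolding w_def by (rule tangent_lincomb[OF assms])
    have wy: "g x w y = ?c * g x u y + (- ?b) * g x v y" if "y \<in> tangent_space A x" for y
      unfolding w_def by (rule g_lincomb[OF assms that])
    have "g x w w = ?c * (?c * ?a - ?b * ?b)"
    proof -
      have "g x w w = ?c * g x w u + (- ?b) * g x w v"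
        using wy[OF w] g_sym[OF w assms(1)] g_sym[OF w assms(2)] by simp
      then show ?thesis using wy[OF assms(1)] wy[OF assms(2)] g_sym[OF assms] by (simp add: algebra_simps)
    qed
    then have "0 \<le> ?c * (?c * ?a - ?b * ?b)" using g_nonneg[OF w] by simp
    then show ?thesis using pos by (simp add: zero_le_mult_iff power2_eq_square mult.commute)
  qed
  then have "sqrt (?b\<^sup>2) \<le> sqrt (?a * ?c)" by (rule real_sqrt_le_mono)
  then show ?thesis by (simp add: tangent_norm_def real_sqrt_mult)
qed

definition dmetric :: "('q, 'e) chart \<Rightarrow> 'e \<Rightarrow> 'e \<Rightarrow> 'e \<Rightarrow> 'e \<Rightarrow> real" where
  "dmetric c y z e e' = frechet_derivative (\<lambda>y'. metric_in_chart A g c y' e e') (at y) z"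

context
  fixes c :: "('q, 'e) chart"
  assumes c: "c \<in> A"
begin

lemma metric_in_chart_bilinear:
  assumes "y \<in> chart_map c ` chart_dom c"
  shows "bilinear (metric_in_chart A g c y)"
proof -
  obtain x where x: "x \<in> chart_dom c" "y = chart_map c x" using assms by blast
  let ?v = "coord_vector A c x"
  have t: "?v e \<in> tangent_space A x" for e using coord_vector_tangent c x by blast
  have eq: "metric_in_chart A g c y e e' = g x (?v e) (?v e')" for e e'
    using c x by (simp add: metric_in_chart_def chart_inv_map)
  have lc: "?v (a *\<^sub>R e + b *\<^sub>R e') = (\<lambda>c'. a *\<^sub>R ?v e c' + b *\<^sub>R ?v e' c')" for a b e e'
    using tangent_eq_coord_vector[OF tangent_lincomb[OF t[of e] t[of e'], of a b] c x(1)]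
    by (simp add: coord_vector_same[OF c x(1)])
  have l: "metric_in_chart A g c y (a *\<^sub>R e + b *\<^sub>R e') w
      = a * metric_in_chart A g c y e w + b * metric_in_chart A g c y e' w" for a b e e' w
    unfolding eq lc by (rule g_lincomb[OF t t t])
  have s: "metric_in_chart A g c y e w = metric_in_chart A g c y w e" for e w
    unfolding eq by (rule g_sym[OF t t])
  have "linear (\<lambda>e. metric_in_chart A g c y e w)" for w
    using l[of 1 _ 1] l[of _ _ 0] by (intro linearI) simp_all
  then show ?thesis unfolding bilinear_def using s by (metis (no_types, lifting) ext)
qed

lemma metric_in_chart_sym:
  assumes "y \<in> chart_map c ` chart_dom c"
  shows "metric_in_chart A g c y e e' = metric_in_chart A g c y e' e"
  using assms c unfolding metric_in_chart_def
  by (auto simp: chart_inv_map intro!: g_sym coord_vector_tangent)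

lemma metric_in_chart_pos:
  assumes "y \<in> chart_map c ` chart_dom c" "e \<noteq> 0"
  shows "metric_in_chart A g c y e e > 0"
proof -
  obtain x where x: "x \<in> chart_dom c" "y = chart_map c x" using assms by blast
  have "coord_vector A c x e \<noteq> (\<lambda>_. 0)"
    using coord_vector_same[OF c x(1)] assms(2) by metis
  then show ?thesis using c x
    by (auto simp: metric_in_chart_def chart_inv_map intro!: g_pos coord_vector_tangent)
qed

lemma metric_in_chart_continuous: "continuous_on (chart_map c ` chart_dom c) (\<lambda>y. metric_in_chart A g c y e e')"
  using metric_in_chart_Ck[OF c, of 0] by simp

lemma metric_in_chart_has_derivative:
  "y \<in> chart_map c ` chart_dom c \<Longrightarrow>
    ((\<lambda>y. metric_in_chart A g c y e e') has_derivative (\<lambda>z. dmetric c y z e e')) (at y)"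
  using metric_in_chart_Ck[OF c, of "Suc 0"] by (auto simp: dmetric_def frechet_derivative_works[symmetric])

lemma dmetric_continuous: "continuous_on (chart_map c ` chart_dom c) (\<lambda>y. dmetric c y z e e')"
  using metric_in_chart_Ck[OF c, of "Suc 0"] by (simp add: dmetric_def)

lemma dmetric_linear: "y \<in> chart_map c ` chart_dom c \<Longrightarrow> linear (\<lambda>z. dmetric c y z e e')"
  using metric_in_chart_has_derivative has_derivative_linear by blast

text \<open>The algebraic properties of the derivative of the metric are inherited from the metric through
the uniqueness of derivatives.\<close>

lemma dmetric_unique:
  assumes y: "y \<in> chart_map c ` chart_dom c"
    and "(f has_derivative f') (at y)"
    and "\<And>y. y \<in> chart_map c ` chart_dom c \<Longrightarrow> f y = metric_in_chart A g c y e e'"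
  shows "dmetric c y z e e' = f' z"
proof -
  have "((\<lambda>y. metric_in_chart A g c y e e') has_derivative f') (at y)"
    by (rule has_derivative_transform_within_open[OF assms(2) open_chart_image[OF c] y assms(3)])
  then show ?thesis using metric_in_chart_has_derivative[OF y] has_derivative_unique by metis
qed

lemma dmetric_sym:
  assumes y: "y \<in> chart_map c ` chart_dom c"
  shows "dmetric c y z e e' = dmetric c y z e' e"
  by (rule dmetric_unique[OF y metric_in_chart_has_derivative[OF y]]) (rule metric_in_chart_sym)

lemma dmetric_bilinear:
  assumes y: "y \<in> chart_map c ` chart_dom c"
  shows "bilinear (dmetric c y z)"
proof -
  note d = metric_in_chart_has_derivative[OF y] and b = metric_in_chart_bilinear
  have "dmetric c y z (e + e') w = dmetric c y z e w + dmetric c y z e' w" for e e' w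
    by (rule dmetric_unique[OF y has_derivative_add[OF d d]]) (simp add: bilinear_ladd[OF b])
  moreover have "dmetric c y z (r *\<^sub>R e) w = r * dmetric c y z e w" for r e w
    by (rule dmetric_unique[OF y has_derivative_mult_right[OF d]]) (simp add: bilinear_lmul[OF b])
  ultimately have "linear (\<lambda>e. dmetric c y z e w)" for w
    by (intro linearI) auto
  then show ?thesis unfolding bilinear_def using dmetric_sym[OF y] by (metis (no_types, lifting) ext)
qed

lemma christoffel_ex1:
  assumes y: "y \<in> chart_map c ` chart_dom c"
  shows "\<exists>!\<Gamma>. bilinear \<Gamma> \<and> (\<forall>z u. \<Gamma> z u = \<Gamma> u z) \<and>
    (\<forall>z u w. dmetric c y z u w = metric_in_chart A g c y (\<Gamma> z u) w + metric_in_chart A g c y u (\<Gamma> z w))"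
  by (rule levi_civita_ex1[OF metric_in_chart_bilinear[OF y] metric_in_chart_sym[OF y] metric_in_chart_pos[OF y]
       dmetric_bilinear[OF y] dmetric_linear[OF y] dmetric_sym[OF y]])

lemma christoffel_eq:
  "christoffel A g c y = (THE \<Gamma>. bilinear \<Gamma> \<and> (\<forall>z u. \<Gamma> z u = \<Gamma> u z) \<and>
    (\<forall>z u w. dmetric c y z u w = metric_in_chart A g c y (\<Gamma> z u) w + metric_in_chart A g c y u (\<Gamma> z w)))"
  unfolding christoffel_def dmetric_def ..

lemma christoffel_unique:
  assumes y: "y \<in> chart_map c ` chart_dom c" and "bilinear \<Gamma>" "\<And>z u. \<Gamma> z u = \<Gamma> u z"
    "\<And>z u w. dmetric c y z u w = metric_in_chart A g c y (\<Gamma> z u) w + metric_in_chart A g c y u (\<Gamma> z w)"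
  shows "christoffel A g c y = \<Gamma>"
  unfolding christoffel_eq by (rule the1_equality[OF christoffel_ex1[OF y]]) (use assms in blast)

lemma
  assumes y: "y \<in> chart_map c ` chart_dom c"
  shows christoffel_bilinear: "bilinear (christoffel A g c y)"
    and christoffel_sym: "christoffel A g c y z u = christoffel A g c y u z"
    and christoffel_compat: "dmetric c y z u w = metric_in_chart A g c y (christoffel A g c y z u) w
        + metric_in_chart A g c y u (christoffel A g c y z w)"
  using theI'[OF christoffel_ex1[OF y]] unfolding christoffel_eq[symmetric] by blast+

lemma christoffel_continuous:
  "continuous_on (chart_map c ` chart_dom c) (\<lambda>y. christoffel A g c y z u)"
proof (rule continuous_on_riesz_representative[where B = "metric_in_chart A g c"
      and l = "\<lambda>y. koszul (dmetric c y) z u"])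
  show "continuous_on (chart_map c ` chart_dom c) (\<lambda>y. koszul (dmetric c y) z u w)" for w
    unfolding koszul_def by (intro continuous_intros dmetric_continuous) auto
  show "metric_in_chart A g c y (christoffel A g c y z u) w = koszul (dmetric c y) z u w"
    if "y \<in> chart_map c ` chart_dom c" for y w
    using that by (intro levi_civita_koszul metric_in_chart_sym christoffel_sym christoffel_compat)
qed (use metric_in_chart_bilinear metric_in_chart_pos metric_in_chart_continuous in auto)

end

lemma metric_in_chart_pullback:
  assumes c: "c \<in> A" "c' \<in> A" and y: "y \<in> overlap c c'"
  shows "metric_in_chart A g c y e e' = metric_in_chart A g c' (transition c c' y) (jac c c' y e) (jac c c' y e')"
proof -
  obtain x where x: "x \<in> chart_dom c" "x \<in> chart_dom c'" "y = chart_map c x" using y by blast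
  have t: "coord_vector A c x e \<in> tangent_space A x" for e using coord_vector_tangent c x by blast
  have "metric_in_chart A g c y e e' = g x (coord_vector A c x e) (coord_vector A c x e')"
    using c x by (simp add: metric_in_chart_def chart_inv_map)
  also have "\<dots> = metric_in_chart A g c' (chart_map c' x) (coord_vector A c x e c') (coord_vector A c x e' c')"
    by (rule g_eq_metric_in_chart[OF c(2) x(2) t t])
  finally show ?thesis using c x by (simp add: transition_map coord_vector_in)
qed

text \<open>The inhomogeneous transformation law of the Christoffel symbols. The symbols of \<open>c'\<close>, pulled back to \<open>c\<close>
and corrected by the second derivative of the transition map, are symmetric (because second derivatives
are) and compatible with the metric (by differentiating the pullback formula of the metric); so
they are the symbols of \<open>c\<close>. The Hessian term is what cancels the second derivatives that appear when the
velocity of a curve is transformed, making the acceleration a tangent vector.\<close>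

lemma christoffel_transform:
  assumes c: "c \<in> A" "c' \<in> A" and x: "x \<in> chart_dom c" "x \<in> chart_dom c'"
  defines "y \<equiv> chart_map c x" and "y' \<equiv> chart_map c' x"
  shows "jac c c' y (christoffel A g c y z u)
     = christoffel A g c' y' (jac c c' y z) (jac c c' y u) + hess c c' y z u"
proof -
  let ?L = "jac c c' y" and ?M = "jac c' c y'" and ?\<Gamma>' = "christoffel A g c' y'"
  have y: "y \<in> overlap c c'" and yc: "y \<in> chart_map c ` chart_dom c"
    and y'c: "y' \<in> chart_map c' ` chart_dom c'" and y': "y' \<in> overlap c' c"
    using x unfolding y_def y'_def by auto
  have \<tau>y: "transition c c' y = y'" unfolding y_def y'_def by (rule transition_map[OF c(1) x(1)])
  have left_inv: "?M (?L e) = e" for e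
    unfolding y_def y'_def using jac_cocycle[OF c c(1) x x(1)] jac_same[OF c(1) x(1)] by simp
  have right_inv: "?L (?M e) = e" for e
    unfolding y_def y'_def using jac_cocycle[OF c(2,1,2) x(2,1,2)] jac_same[OF c(2) x(2)] by simp
  note linL = jac_linear[OF c y] and linM = jac_linear[OF c(2,1) y']
  note b\<Gamma>' = christoffel_bilinear[OF c(2) y'c] and bH = hess_bilinear[OF c y]
  define \<Gamma> where "\<Gamma> z u = ?M (?\<Gamma>' (?L z) (?L u) + hess c c' y z u)" for z u
  have L\<Gamma>: "?L (\<Gamma> z u) = ?\<Gamma>' (?L z) (?L u) + hess c c' y z u" for z u
    by (simp add: \<Gamma>_def right_inv)
  have "christoffel A g c y = \<Gamma>"
  proof (rule christoffel_unique[OF c(1) yc])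
    show "bilinear \<Gamma>"
      unfolding bilinear_def \<Gamma>_def
      by (intro conjI allI linearI)
        (simp_all add: linear_add[OF linL] linear_add[OF linM] linear_cmul[OF linL] linear_cmul[OF linM]
          bilinear_ladd[OF b\<Gamma>'] bilinear_radd[OF b\<Gamma>'] bilinear_lmul[OF b\<Gamma>'] bilinear_rmul[OF b\<Gamma>']
          bilinear_ladd[OF bH] bilinear_radd[OF bH] bilinear_lmul[OF bH] bilinear_rmul[OF bH] algebra_simps)
    show "\<Gamma> z u = \<Gamma> u z" for z u
      unfolding \<Gamma>_def by (simp add: christoffel_sym[OF c(2) y'c, of "?L z"] hess_sym[OF c y, of z])
    fix z u w
    let ?G' = "metric_in_chart A g c' y'"
    have im: "transition c c' s \<in> chart_map c' ` chart_dom c'" if "s \<in> overlap c c'" for s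
      using that c by (auto simp: transition_map)
    have "((\<lambda>s. metric_in_chart A g c' (transition c c' s) (jac c c' s u) (jac c c' s w)) has_derivative
        (\<lambda>h. dmetric c' y' (?L h) (?L u) (?L w) + metric_in_chart A g c' (transition c c' y) (hess c c' y u h) (?L w)
           + metric_in_chart A g c' (transition c c' y) (?L u) (hess c c' y w h))) (at y within overlap c c')"
    proof (rule has_derivative_bilinear_field[OF y])
      show "bilinear (metric_in_chart A g c' (transition c c' s))" if "s \<in> overlap c c'" for s
        by (rule metric_in_chart_bilinear[OF c(2) im[OF that]])
      show "((\<lambda>s. metric_in_chart A g c' (transition c c' s) e e') has_derivative
         (\<lambda>h. dmetric c' y' (?L h) e e')) (at y within overlap c c')" for e e'
      proof -
        have "((\<lambda>y. metric_in_chart A g c' y e e') has_derivative (\<lambda>z. dmetric c' y' z e e')) (at (transition c c' y))"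
          unfolding \<tau>y by (rule metric_in_chart_has_derivative[OF c(2) y'c])
        from has_derivative_compose[OF has_derivative_at_withinI[OF transition_has_derivative[OF c y]] this]
        show ?thesis .
      qed
      show "bilinear (dmetric c' y' (?L h))" for h
        by (rule dmetric_bilinear[OF c(2) y'c])
      show "((\<lambda>s. jac c c' s u) has_derivative (\<lambda>h. hess c c' y u h)) (at y within overlap c c')"
        "((\<lambda>s. jac c c' s w) has_derivative (\<lambda>h. hess c c' y w h)) (at y within overlap c c')"
        by (rule has_derivative_at_withinI[OF jac_has_derivative[OF c y]])+
    qed
    then have "((\<lambda>s. metric_in_chart A g c' (transition c c' s) (jac c c' s u) (jac c c' s w)) has_derivative
        (\<lambda>h. dmetric c' y' (?L h) (?L u) (?L w) + ?G' (hess c c' y u h) (?L w) + ?G' (?L u) (hess c c' y w h))) (at y)"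
      using at_within_open[OF y open_overlap[OF c]] by (simp add: \<tau>y)
    then have "((\<lambda>y. metric_in_chart A g c y u w) has_derivative
        (\<lambda>h. dmetric c' y' (?L h) (?L u) (?L w) + ?G' (hess c c' y u h) (?L w) + ?G' (?L u) (hess c c' y w h))) (at y)"
      by (rule has_derivative_transform_within_open[OF _ open_overlap[OF c] y])
        (simp add: metric_in_chart_pullback[OF c])
    then have "dmetric c y z u w
       = dmetric c' y' (?L z) (?L u) (?L w) + ?G' (hess c c' y u z) (?L w) + ?G' (?L u) (hess c c' y w z)"
      by (rule dmetric_unique[OF c(1) yc]) simp
    also have "\<dots> = ?G' (?L (\<Gamma> z u)) (?L w) + ?G' (?L u) (?L (\<Gamma> z w))"
      unfolding L\<Gamma> christoffel_compat[OF c(2) y'c] hess_sym[OF c y, of _ z]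
      using metric_in_chart_bilinear[OF c(2) y'c]
      by (simp add: bilinear_ladd bilinear_radd)
    finally show "dmetric c y z u w = metric_in_chart A g c y (\<Gamma> z u) w + metric_in_chart A g c y u (\<Gamma> z w)"
      unfolding metric_in_chart_pullback[OF c y] \<tau>y .
  qed
  then show ?thesis using L\<Gamma> by simp
qed

end

section \<open>The energy identity for curves of class \<open>H\<^sup>2\<close>\<close>

lemma stays_in_open:
  fixes q :: "real \<Rightarrow> 'q::topological_space"
  assumes "continuous_on S q" "t \<in> S" "open U" "q t \<in> U"
  obtains \<delta> where "\<delta> > 0" "\<And>s. s \<in> S \<Longrightarrow> \<bar>s - t\<bar> < \<delta> \<Longrightarrow> q s \<in> U"
proof -
  have "(q \<longlongrightarrow> q t) (at t within S)" using assms(1,2) continuous_on_def by blast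
  then have "eventually (\<lambda>s. q s \<in> U) (at t within S)" using assms(3,4) topological_tendstoD by blast
  then obtain \<delta> where "\<delta> > 0" "\<And>s. s \<in> S \<Longrightarrow> s \<noteq> t \<Longrightarrow> dist s t < \<delta> \<Longrightarrow> q s \<in> U"
    unfolding eventually_at by blast
  then show thesis using that[of \<delta>] assms(4) by (metis dist_real_def)
qed

lemma at_within_near:
  fixes t :: real
  assumes "\<delta> > 0"
  shows "at t within (S \<inter> {t-\<delta><..<t+\<delta>}) = at t within S"
  by (rule at_within_nhd[of t "{t-\<delta><..<t+\<delta>}"]) (use assms in auto)

lemma has_vector_derivative_eq_near:
  fixes f h :: "real \<Rightarrow> 'b::real_normed_vector"
  assumes "t \<in> S" "\<delta> > 0" "\<And>s. s \<in> S \<Longrightarrow> \<bar>s - t\<bar> < \<delta> \<Longrightarrow> f s = h s"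
    and "(f has_vector_derivative d) (at t within S)"
  shows "(h has_vector_derivative d) (at t within S)"
proof -
  have "(f has_vector_derivative d) (at t within (S \<inter> {t-\<delta><..<t+\<delta>}))"
    using assms(4) by (simp add: at_within_near[OF assms(2)])
  then have "(h has_vector_derivative d) (at t within (S \<inter> {t-\<delta><..<t+\<delta>}))"
    by (rule has_vector_derivative_transform[rotated -1]) (use assms in auto)
  then show ?thesis by (simp add: at_within_near[OF assms(2)])
qed

lemma ac_on_cong:
  assumes "ac_on a b F" "\<And>t. t \<in> {a..b} \<Longrightarrow> F t = G t"
  shows "ac_on a b G"
proof -
  have "G v - G u = F v - F u" if "a \<le> u" "u \<le> v" "v \<le> b" for u v
    using assms(2)[of u] assms(2)[of v] that by simp
  then show ?thesis using assms(1) unfolding ac_on_def by metis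
qed

context riemannian
begin

text \<open>This makes the velocity a tangent vector field along the curve: its components are vector derivatives,
which are arbitrary values where the curve is not differentiable.\<close>

definition regular_curve :: "real \<Rightarrow> real \<Rightarrow> (real \<Rightarrow> 'q) \<Rightarrow> bool" where
  "regular_curve a b q \<longleftrightarrow> a < b \<and> continuous_on {a..b} q \<and>
     (\<forall>t\<in>{a..b}. \<forall>c\<in>A. q t \<in> chart_dom c \<longrightarrow>
        (\<lambda>s. chart_map c (q s)) differentiable (at t within {a..b}))"

lemma derivative_change_chart:
  assumes c: "c \<in> A" "c' \<in> A" and t: "t \<in> S" "continuous_on S q" "q t \<in> chart_dom c" "q t \<in> chart_dom c'"
    and d: "((\<lambda>s. chart_map c (q s)) has_vector_derivative d) (at t within S)"
  shows "((\<lambda>s. chart_map c' (q s)) has_vector_derivative jac c c' (chart_map c (q t)) d) (at t within S)"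
proof -
  have y: "chart_map c (q t) \<in> overlap c c'" using t by auto
  obtain \<delta> where \<delta>: "\<delta> > 0" "\<And>s. s \<in> S \<Longrightarrow> \<bar>s - t\<bar> < \<delta> \<Longrightarrow> q s \<in> chart_dom c"
    by (rule stays_in_open[OF t(2,1) open_chart_dom[OF c(1)] t(3)]) blast
  have "((\<lambda>s. transition c c' (chart_map c (q s))) has_vector_derivative jac c c' (chart_map c (q t)) d) (at t within S)"
    unfolding has_vector_derivative_def
    using has_derivative_compose[OF d[unfolded has_vector_derivative_def] transition_has_derivative[OF c y]]
    by (simp add: linear_cmul[OF jac_linear[OF c y]])
  then show ?thesis
    by (rule has_vector_derivative_eq_near[OF t(1) \<delta>(1), rotated]) (use \<delta>(2) c in \<open>auto simp: transition_map\<close>)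
qed

lemma velocity_component:
  assumes "a < b" "t \<in> {a..b}" "c \<in> A" "q t \<in> chart_dom c"
    and "((\<lambda>s. chart_map c (q s)) has_vector_derivative d) (at t within {a..b})"
  shows "velocity A {a..b} q t c = d"
  using assms by (simp add: velocity_def vector_derivative_within_closed_interval)

lemma velocity_tangent:
  assumes "a < b" "t \<in> {a..b}" "c \<in> A" "q t \<in> chart_dom c" "continuous_on {a..b} q"
    and d: "((\<lambda>s. chart_map c (q s)) has_vector_derivative d) (at t within {a..b})"
  shows "velocity A {a..b} q t \<in> tangent_space A (q t)"
proof (rule tangentI[OF assms(3,4)])
  fix c' assume c': "c' \<in> A" "q t \<in> chart_dom c'"
  show "velocity A {a..b} q t c' = jac c c' (chart_map c (q t)) (velocity A {a..b} q t c)"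
    using velocity_component[OF assms(1,2) c' derivative_change_chart[OF assms(3) c'(1) assms(2,5,4) c'(2) d]]
      velocity_component[OF assms(1-4) d] by simp
qed (auto simp: velocity_def)

lemma regular_curve_velocity:
  assumes "regular_curve a b q" "t \<in> {a..b}"
  shows "velocity A {a..b} q t \<in> tangent_space A (q t)"
    and "c \<in> A \<Longrightarrow> q t \<in> chart_dom c \<Longrightarrow>
      ((\<lambda>s. chart_map c (q s)) has_vector_derivative velocity A {a..b} q t c) (at t within {a..b})"
proof -
  have r: "a < b" "continuous_on {a..b} q"
    "\<And>c. c \<in> A \<Longrightarrow> q t \<in> chart_dom c \<Longrightarrow> (\<lambda>s. chart_map c (q s)) differentiable (at t within {a..b})"
    using assms unfolding regular_curve_def by blast+
  show "c \<in> A \<Longrightarrow> q t \<in> chart_dom c \<Longrightarrow>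
      ((\<lambda>s. chart_map c (q s)) has_vector_derivative velocity A {a..b} q t c) (at t within {a..b})"
    using r(3) by (simp add: velocity_def vector_derivative_works)
  obtain c where c: "c \<in> A" "q t \<in> chart_dom c" using ex_chart by blast
  then show "velocity A {a..b} q t \<in> tangent_space A (q t)"
    using velocity_tangent[OF r(1) assms(2) c r(2)] r(3) vector_derivative_works by blast
qed

text \<open>Components of the velocity transform by the Jacobian at the moving point; the product rule produces the
Hessian term. In particular differentiability of the components does not depend on the chart.\<close>

lemma velocity_derivative_change_chart:
  assumes reg: "regular_curve a b q" and t: "t \<in> {a..b}"
    and c: "c \<in> A" "c' \<in> A" "q t \<in> chart_dom c" "q t \<in> chart_dom c'"
    and d: "((\<lambda>s. velocity A {a..b} q s c) has_vector_derivative d) (at t within {a..b})"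
  defines "y \<equiv> chart_map c (q t)" and "u \<equiv> velocity A {a..b} q t c"
  shows "((\<lambda>s. velocity A {a..b} q s c') has_vector_derivative (hess c c' y u u + jac c c' y d)) (at t within {a..b})"
proof -
  let ?X = "velocity A {a..b} q"
  have q: "continuous_on {a..b} q" using reg unfolding regular_curve_def by blast
  have "open (chart_dom c \<inter> chart_dom c')" using open_chart_dom c by blast
  then obtain \<delta> where \<delta>: "\<delta> > 0" "\<And>s. s \<in> {a..b} \<Longrightarrow> \<bar>s - t\<bar> < \<delta> \<Longrightarrow> q s \<in> chart_dom c \<inter> chart_dom c'"
    by (rule stays_in_open[OF q t]) (use c in auto)
  define S where "S = {a..b} \<inter> {t-\<delta><..<t+\<delta>}"
  have S: "t \<in> S" "at t within S = at t within {a..b}"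
    using t \<delta>(1) by (auto simp: S_def at_within_near)
  have qS: "s \<in> {a..b}" "q s \<in> chart_dom c" "q s \<in> chart_dom c'" "chart_map c (q s) \<in> overlap c c'" if "s \<in> S" for s
    using \<delta>(2)[of s] that by (auto simp: S_def)
  have y: "y \<in> overlap c c'" using c by (auto simp: y_def)
  have hl: "linear (hess c c' y e)" for e using hess_bilinear[OF c(1,2) y] by (simp add: bilinear_def)
  have yd: "((\<lambda>s. chart_map c (q s)) has_derivative (\<lambda>r. r *\<^sub>R u)) (at t within S)"
    using regular_curve_velocity(2)[OF reg t c(1,3)] unfolding S(2) u_def has_vector_derivative_def .
  have "((\<lambda>s. jac c c' (chart_map c (q s)) (?X s c)) has_derivative
     (\<lambda>r. r *\<^sub>R hess c c' y (?X t c) u + jac c c' (chart_map c (q t)) (r *\<^sub>R d))) (at t within S)"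
  proof (rule has_derivative_linear_field[OF S(1), where L = "\<lambda>s. jac c c' (chart_map c (q s))"
        and L' = "\<lambda>r e. r *\<^sub>R hess c c' y e u"])
    show "linear (jac c c' (chart_map c (q s)))" if "s \<in> S" for s
      by (rule jac_linear[OF c(1,2) qS(4)[OF that]])
    show "((\<lambda>s. jac c c' (chart_map c (q s)) e) has_derivative (\<lambda>r. r *\<^sub>R hess c c' y e u)) (at t within S)" for e
      using has_derivative_compose[OF yd jac_has_derivative[OF c(1,2) y[unfolded y_def]]]
      by (simp add: linear_cmul[OF hl] y_def[symmetric])
    show "linear (\<lambda>e. r *\<^sub>R hess c c' y e u)" for r
      using hess_bilinear[OF c(1,2) y] by (intro linear_compose_scale_right) (simp add: bilinear_def)
    show "((\<lambda>s. ?X s c) has_derivative (\<lambda>r. r *\<^sub>R d)) (at t within S)"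
      using d unfolding S(2) has_vector_derivative_def .
  qed
  then have "((\<lambda>s. jac c c' (chart_map c (q s)) (?X s c)) has_vector_derivative
     (hess c c' y u u + jac c c' y d)) (at t within S)"
    unfolding has_vector_derivative_def
    by (simp add: linear_cmul[OF jac_linear[OF c(1,2) y]] y_def[symmetric] u_def[symmetric] scaleR_add_right)
  then have "((\<lambda>s. ?X s c') has_vector_derivative (hess c c' y u u + jac c c' y d)) (at t within S)"
  proof (rule has_vector_derivative_transform[OF S(1), rotated])
    show "?X s c' = jac c c' (chart_map c (q s)) (?X s c)" if "s \<in> S" for s
      using tangent_component[OF regular_curve_velocity(1)[OF reg qS(1)[OF that]] c(1,2)] qS(2,3)[OF that] .
  qed
  then show ?thesis by (simp only: S(2))
qed

lemma acceleration_component: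
  assumes "regular_curve a b q" "t \<in> {a..b}" "c \<in> A" "q t \<in> chart_dom c"
    and "((\<lambda>s. velocity A {a..b} q s c) has_vector_derivative d) (at t within {a..b})"
  shows "acceleration A g {a..b} q t c = d + christoffel A g c (chart_map c (q t))
           (velocity A {a..b} q t c) (velocity A {a..b} q t c)"
proof -
  have "a < b" using assms(1) unfolding regular_curve_def by blast
  then show ?thesis
    using assms differentiableI_vector[OF assms(5)]
    by (simp add: acceleration_def covariant_derivative_def vector_derivative_within_closed_interval)
qed

text \<open>At times where the velocity is differentiable, the Hessian terms of the two transformation laws cancel.
At all other times every component is \<open>0\<close> by convention, in all charts at once.\<close>

lemma acceleration_tangent:
  assumes reg: "regular_curve a b q" and t: "t \<in> {a..b}"
  shows "acceleration A g {a..b} q t \<in> tangent_space A (q t)"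
proof -
  let ?X = "velocity A {a..b} q"
  obtain c where c: "c \<in> A" "q t \<in> chart_dom c" using ex_chart by blast
  show ?thesis
  proof (cases "(\<lambda>s. ?X s c) differentiable (at t within {a..b})")
    case True
    then obtain d where d: "((\<lambda>s. ?X s c) has_vector_derivative d) (at t within {a..b})"
      using vector_derivative_works by blast
    show ?thesis
    proof (rule tangentI[OF c])
      fix c' assume c': "c' \<in> A" "q t \<in> chart_dom c'"
      let ?y = "chart_map c (q t)" and ?u = "?X t c"
      have y: "?y \<in> overlap c c'" using c c' by auto
      have "?X t c' = jac c c' ?y ?u"
        by (rule tangent_component[OF regular_curve_velocity(1)[OF reg t] c(1) c'(1) c(2) c'(2)])
      moreover note acceleration_component[OF reg t c' velocity_derivative_change_chart[OF reg t c(1) c'(1) c(2) c'(2) d]]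
        and acceleration_component[OF reg t c d]
        and christoffel_transform[OF c(1) c'(1) c(2) c'(2), of ?u ?u]
      ultimately show "acceleration A g {a..b} q t c' = jac c c' ?y (acceleration A g {a..b} q t c)"
        by (simp add: linear_add[OF jac_linear[OF c(1) c'(1) y]] algebra_simps)
    qed (auto simp: acceleration_def covariant_derivative_def)
  next
    case False
    have "acceleration A g {a..b} q t c' = 0" for c'
    proof (rule ccontr)
      assume "acceleration A g {a..b} q t c' \<noteq> 0"
      then have c': "c' \<in> A" "q t \<in> chart_dom c'" "(\<lambda>s. ?X s c') differentiable (at t within {a..b})"
        unfolding acceleration_def covariant_derivative_def by presburger+
      then show False
        using velocity_derivative_change_chart[OF reg t c'(1) c(1) c'(2) c(2)] False
          vector_derivative_works differentiableI_vector by blast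
    qed
    then have "acceleration A g {a..b} q t = (\<lambda>_. 0)" by auto
    then show ?thesis using zero_tangent by simp
  qed
qed

lemma H2_chart_C1:
  assumes "H2_curve A T q" "c \<in> A" "0 \<le> \<alpha>" "\<alpha> < \<beta>" "\<beta> \<le> T" "q ` {\<alpha>..\<beta>} \<subseteq> chart_dom c"
  obtains u h where "\<And>t. t \<in> {\<alpha>..\<beta>} \<Longrightarrow> ((\<lambda>s. chart_map c (q s)) has_vector_derivative u t) (at t within {\<alpha>..\<beta>})"
    "\<And>t. t \<in> {\<alpha>..\<beta>} \<Longrightarrow> u t = u \<alpha> + integral {\<alpha>..t} h" "L2_on \<alpha> \<beta> h"
proof -
  have "sobolev_W22 \<alpha> \<beta> (\<lambda>s. chart_map c (q s))" using assms unfolding H2_curve_def by blast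
  moreover have "continuous_on {0..T} q" using assms(1) unfolding H2_curve_def by blast
  then have "continuous_on {\<alpha>..\<beta>} q" by (rule continuous_on_subset) (use assms in auto)
  then have "continuous_on {\<alpha>..\<beta>} (\<lambda>s. chart_map c (q s))"
    using continuous_on_compose2[OF chart_map_continuous[OF assms(2)] _ assms(6)] by blast
  ultimately show thesis using sobolev_W22_imp[OF assms(4)] that by metis
qed

lemma H2_regular:
  assumes H2: "H2_curve A T q" and "T > 0"
  shows "regular_curve 0 T q"
  unfolding regular_curve_def
proof (intro conjI ballI impI)
  show q: "continuous_on {0..T} q" using H2 unfolding H2_curve_def by blast
  fix t c assume t: "t \<in> {0..T}" and c: "c \<in> A" "q t \<in> chart_dom c"
  obtain \<delta> where \<delta>: "\<delta> > 0" "\<And>s. s \<in> {0..T} \<Longrightarrow> \<bar>s - t\<bar> < \<delta> \<Longrightarrow> q s \<in> chart_dom c"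
    by (rule stays_in_open[OF q t open_chart_dom[OF c(1)] c(2)]) blast
  define \<alpha> \<beta> where "\<alpha> = max 0 (t - \<delta> / 2)" and "\<beta> = min T (t + \<delta> / 2)"
  have ab: "0 \<le> \<alpha>" "\<alpha> < \<beta>" "\<beta> \<le> T" "t \<in> {\<alpha>..\<beta>}"
    using t \<open>T > 0\<close> \<delta>(1) by (auto simp: \<alpha>_def \<beta>_def)
  have "q ` {\<alpha>..\<beta>} \<subseteq> chart_dom c"
  proof
    fix x assume "x \<in> q ` {\<alpha>..\<beta>}"
    then obtain s where s: "s \<in> {\<alpha>..\<beta>}" "x = q s" by blast
    have "s \<in> {0..T}" "\<bar>s - t\<bar> < \<delta>" using s(1) ab \<delta>(1) unfolding \<alpha>_def \<beta>_def by auto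
    then show "x \<in> chart_dom c" using \<delta>(2) s(2) by blast
  qed
  then obtain u where "((\<lambda>s. chart_map c (q s)) has_vector_derivative u t) (at t within {\<alpha>..\<beta>})"
    using H2_chart_C1[OF H2 c(1) ab(1-3)] ab(4) by metis
  moreover have "at t within {\<alpha>..\<beta>} = at t within {0..T}"
    by (rule at_within_nhd[of t "{t - \<delta>/2<..<t + \<delta>/2}"]) (use \<delta>(1) in \<open>auto simp: \<alpha>_def \<beta>_def\<close>)
  ultimately show "(\<lambda>s. chart_map c (q s)) differentiable (at t within {0..T})"
    by (auto intro: differentiableI_vector)
qed (rule \<open>T > 0\<close>)

text \<open>In a chart, the velocity of an \<open>H\<^sup>2\<close> curve is a primitive of some \<open>h\<close> in \<open>L\<^sup>2\<close>, and almost
everywhere the acceleration is given by its coordinate formula with \<open>h\<close> for the second derivative.\<close>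

lemma H2_chart_velocity:
  assumes H2: "H2_curve A T q" and T: "T > 0"
    and c: "c \<in> A" and ab: "0 \<le> \<alpha>" "\<alpha> < \<beta>" "\<beta> \<le> T" and im: "q ` {\<alpha>..\<beta>} \<subseteq> chart_dom c"
  obtains h N where "L2_on \<alpha> \<beta> h" "negligible N"
    "\<And>t. t \<in> {\<alpha>..\<beta>} \<Longrightarrow> velocity A {0..T} q t c = velocity A {0..T} q \<alpha> c + integral {\<alpha>..t} h"
    "\<And>t. t \<in> {\<alpha>..\<beta>} - N \<Longrightarrow> ((\<lambda>s. velocity A {0..T} q s c) has_vector_derivative h t) (at t within {\<alpha>..\<beta>})"
    "\<And>t. t \<in> {\<alpha>..\<beta>} - N \<Longrightarrow> acceleration A g {0..T} q t c = h t + christoffel A g c (chart_map c (q t))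
           (velocity A {0..T} q t c) (velocity A {0..T} q t c)"
proof -
  let ?X = "velocity A {0..T} q"
  have reg: "regular_curve 0 T q" by (rule H2_regular[OF H2 T])
  obtain u h where u: "\<And>t. t \<in> {\<alpha>..\<beta>} \<Longrightarrow> ((\<lambda>s. chart_map c (q s)) has_vector_derivative u t) (at t within {\<alpha>..\<beta>})"
    "\<And>t. t \<in> {\<alpha>..\<beta>} \<Longrightarrow> u t = u \<alpha> + integral {\<alpha>..t} h" "L2_on \<alpha> \<beta> h"
    by (rule H2_chart_C1[OF H2 c ab im]) blast
  have sub: "{\<alpha>..\<beta>} \<subseteq> {0..T}" using ab by auto
  have Xu: "?X t c = u t" if t: "t \<in> {\<alpha>..\<beta>}" for t
  proof -
    have "((\<lambda>s. chart_map c (q s)) has_vector_derivative ?X t c) (at t within {\<alpha>..\<beta>})"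
      by (rule has_vector_derivative_within_subset[OF regular_curve_velocity(2)[OF reg _ c] sub])
        (use t sub im in auto)
    then show ?thesis
      using vector_derivative_within_closed_interval[OF ab(2) t] u(1)[OF t] by metis
  qed
  have h: "h integrable_on {\<alpha>..\<beta>}"
    using L2_on_imp_absolutely_integrable(1)[OF u(3)] absolutely_integrable_on_def by blast
  obtain N where N: "negligible N" "\<And>t. t \<in> {\<alpha>..\<beta>} - N \<Longrightarrow>
       ((\<lambda>s. integral {\<alpha>..s} h) has_vector_derivative h t) (at t within {\<alpha>..\<beta>})"
    by (rule ae_has_vector_derivative_indefinite_integral[OF h]) blast
  have X: "?X t c = ?X \<alpha> c + integral {\<alpha>..t} h" if "t \<in> {\<alpha>..\<beta>}" for t
    using u(2)[OF that] Xu[OF that] Xu[of \<alpha>] ab by simp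
  have d: "((\<lambda>s. ?X s c) has_vector_derivative h t) (at t within {\<alpha>..\<beta>})" if t: "t \<in> {\<alpha>..\<beta>} - N" for t
  proof -
    have "((\<lambda>s. ?X \<alpha> c + integral {\<alpha>..s} h) has_vector_derivative 0 + h t) (at t within {\<alpha>..\<beta>})"
      by (intro has_vector_derivative_add has_vector_derivative_const N(2) t)
    then have "((\<lambda>s. ?X \<alpha> c + integral {\<alpha>..s} h) has_vector_derivative h t) (at t within {\<alpha>..\<beta>})"
      by simp
    then show ?thesis
      by (rule has_vector_derivative_transform[rotated 2]) (use t in blast, rule X)
  qed
  show thesis
  proof
    show "L2_on \<alpha> \<beta> h" by (rule u)
    \<comment> \<open>The end points are discarded so that derivatives within the subinterval and within the whole time interval agree.\<close>
    show "negligible (N \<union> {\<alpha>, \<beta>})" using N(1) by (intro negligible_Un) (auto intro: negligible_finite)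
    show "?X t c = ?X \<alpha> c + integral {\<alpha>..t} h" if "t \<in> {\<alpha>..\<beta>}" for t by (rule X[OF that])
    fix t assume t: "t \<in> {\<alpha>..\<beta>} - (N \<union> {\<alpha>, \<beta>})"
    then show d': "((\<lambda>s. ?X s c) has_vector_derivative h t) (at t within {\<alpha>..\<beta>})" by (intro d) auto
    have "at t within {\<alpha>..\<beta>} = at t" "at t within {0..T} = at t"
      using t ab by (auto intro!: at_within_Icc_at)
    then have "((\<lambda>s. ?X s c) has_vector_derivative h t) (at t within {0..T})" using d' by simp
    moreover have "t \<in> {0..T}" "q t \<in> chart_dom c" using t sub im by blast+
    ultimately show "acceleration A g {0..T} q t c = h t + christoffel A g c (chart_map c (q t)) (?X t c) (?X t c)"
      using acceleration_component[OF reg _ c] by blast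
  qed
qed

lemma metric_along_curve_abs_integrable:
  fixes a :: "real \<Rightarrow> 'e"
  assumes G: "\<And>i j. continuous_on {\<alpha>..\<beta>} (\<lambda>t. G t i j)" "\<And>t. t \<in> {\<alpha>..\<beta>} \<Longrightarrow> bilinear (G t)"
    and a: "a \<in> borel_measurable (lebesgue_on {\<alpha>..\<beta>})" "(\<lambda>t. (norm (a t))\<^sup>2) integrable_on {\<alpha>..\<beta>}"
  shows "(\<lambda>t. G t (a t) (a t) :: real) absolutely_integrable_on {\<alpha>..\<beta>}"
proof -
  have "(\<lambda>t. (a t \<bullet> i) * (a t \<bullet> j)) absolutely_integrable_on {\<alpha>..\<beta>}" if "i \<in> Basis" "j \<in> Basis" for i j
  proof (rule measurable_bounded_by_integrable_imp_absolutely_integrable[OF _ _ a(2)])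
    show "(\<lambda>t. (a t \<bullet> i) * (a t \<bullet> j)) \<in> borel_measurable (lebesgue_on {\<alpha>..\<beta>})"
      using a(1) by (intro borel_measurable_times borel_measurable_inner borel_measurable_const)
    show "norm ((a t \<bullet> i) * (a t \<bullet> j)) \<le> (norm (a t))\<^sup>2" for t
      unfolding norm_mult power2_eq_square using that Basis_le_norm by (intro mult_mono) auto
  qed simp
  then have "(\<lambda>t. G t i j *\<^sub>R ((a t \<bullet> i) * (a t \<bullet> j))) absolutely_integrable_on {\<alpha>..\<beta>}"
    if "i \<in> Basis" "j \<in> Basis" for i j
    using that by (intro absolutely_integrable_continuous_scaleR G)
  then have "(\<lambda>t. \<Sum>i\<in>Basis. \<Sum>j\<in>Basis. G t i j *\<^sub>R ((a t \<bullet> i) * (a t \<bullet> j))) absolutely_integrable_on {\<alpha>..\<beta>}"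
    by (intro absolutely_integrable_sum finite_Basis)
  then show ?thesis
    by (rule absolutely_integrable_spike[OF _ negligible_empty])
      (use bilinear_basis_expansion[OF G(2)] in \<open>auto simp: mult.commute\<close>)
qed

context
  fixes T q
  assumes H2: "H2_curve A T q" and T: "T > 0"
begin

abbreviation vel where "vel \<equiv> velocity A {0..T} q"
abbreviation acc where "acc \<equiv> acceleration A g {0..T} q"

lemma vel_tangent: "t \<in> {0..T} \<Longrightarrow> vel t \<in> tangent_space A (q t)"
  and acc_tangent: "t \<in> {0..T} \<Longrightarrow> acc t \<in> tangent_space A (q t)"
  using regular_curve_velocity(1) acceleration_tangent H2_regular[OF H2 T] by blast+

lemma vel_continuous_in_chart:
  assumes c: "c \<in> A" and ab: "0 \<le> \<alpha>" "\<alpha> < \<beta>" "\<beta> \<le> T" and im: "q ` {\<alpha>..\<beta>} \<subseteq> chart_dom c"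
  shows "continuous_on {\<alpha>..\<beta>} (\<lambda>t. vel t c)"
proof -
  obtain h N where h: "L2_on \<alpha> \<beta> h" "\<And>t. t \<in> {\<alpha>..\<beta>} \<Longrightarrow> vel t c = vel \<alpha> c + integral {\<alpha>..t} h"
    by (rule H2_chart_velocity[OF H2 T c ab im]) blast
  have "h integrable_on {\<alpha>..\<beta>}"
    using L2_on_imp_absolutely_integrable(1)[OF h(1)] absolutely_integrable_on_def by blast
  then have "continuous_on {\<alpha>..\<beta>} (\<lambda>t. vel \<alpha> c + integral {\<alpha>..t} h)"
    by (intro continuous_intros indefinite_integral_continuous_1)
  then show ?thesis using continuous_on_cong h(2) by (metis (no_types, lifting))
qed

text \<open>The squared speed is a sum of products of absolutely continuous functions, and compatibility of the
connection with the metric identifies its derivative almost everywhere. Integrability of the squared acceleration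
holds because \<open>h\<close> is square integrable and the Christoffel term is continuous; without it the integral in
the cost would be the default value \<open>0\<close>.\<close>

lemma energy_in_chart:
  assumes c: "c \<in> A" and ab: "0 \<le> \<alpha>" "\<alpha> < \<beta>" "\<beta> \<le> T" and im: "q ` {\<alpha>..\<beta>} \<subseteq> chart_dom c"
  shows "(\<lambda>t. g (q t) (acc t) (acc t)) integrable_on {\<alpha>..\<beta>}"
    and "((\<lambda>t. 2 * g (q t) (acc t) (vel t)) has_integral
      (g (q \<beta>) (vel \<beta>) (vel \<beta>) - g (q \<alpha>) (vel \<alpha>) (vel \<alpha>))) {\<alpha>..\<beta>}"
proof -
  define y where "y t = chart_map c (q t)" for t
  define u where "u t = vel t c" for t
  define \<Gamma> where "\<Gamma> t = christoffel A g c (y t)" for t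
  define G where "G t = metric_in_chart A g c (y t)" for t
  define dG where "dG t = dmetric c (y t)" for t
  let ?I = "{\<alpha>..\<beta>}" and ?Y = "chart_map c ` chart_dom c"
  have sub: "?I \<subseteq> {0..T}" using ab by auto
  have reg: "regular_curve 0 T q" by (rule H2_regular[OF H2 T])
  have qd: "q t \<in> chart_dom c" if "t \<in> ?I" for t using im that by blast
  have yY: "y ` ?I \<subseteq> ?Y" "\<And>t. t \<in> ?I \<Longrightarrow> y t \<in> ?Y" using qd by (auto simp: y_def)
  have yd: "(y has_vector_derivative u t) (at t within ?I)" if "t \<in> ?I" for t
    unfolding y_def u_def
    by (rule has_vector_derivative_within_subset[OF regular_curve_velocity(2)[OF reg _ c] sub])
      (use that sub im in auto)
  have yc: "continuous_on ?I y"
    by (rule continuous_on_vector_derivative[OF yd])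
  have uc: "continuous_on ?I u"
    unfolding u_def by (rule vel_continuous_in_chart[OF c ab im])
  obtain h N where h: "L2_on \<alpha> \<beta> h" and N: "negligible N"
    and u_int: "\<And>t. t \<in> ?I \<Longrightarrow> u t = u \<alpha> + integral {\<alpha>..t} h"
    and ud: "\<And>t. t \<in> ?I - N \<Longrightarrow> (u has_vector_derivative h t) (at t within ?I)"
    and acc_eq: "\<And>t. t \<in> ?I - N \<Longrightarrow> acc t c = h t + \<Gamma> t (u t) (u t)"
    unfolding u_def \<Gamma>_def y_def by (rule H2_chart_velocity[OF H2 T c ab im]) blast
  note h' = L2_on_imp_absolutely_integrable[OF h]
  have bil: "bilinear (G t)" "bilinear (\<Gamma> t)" "\<And>z. bilinear (dG t z)" if "t \<in> ?I" for t
    using yY(2)[OF that] unfolding G_def \<Gamma>_def dG_def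
    by (auto intro: metric_in_chart_bilinear[OF c] christoffel_bilinear[OF c] dmetric_bilinear[OF c])
  have cont: "continuous_on ?I (\<lambda>t. G t i j)" "continuous_on ?I (\<lambda>t. \<Gamma> t i j)" "continuous_on ?I (\<lambda>t. dG t k i j)" for i j k
    unfolding G_def \<Gamma>_def dG_def
    by (rule continuous_on_compose2[OF _ yc yY(1)],
        rule metric_in_chart_continuous[OF c] christoffel_continuous[OF c] dmetric_continuous[OF c])+
  have \<Gamma>c: "continuous_on ?I (\<lambda>t. \<Gamma> t (u t) (u t))"
  proof -
    have "continuous_on ?I (\<lambda>t. \<Sum>i\<in>Basis. \<Sum>j\<in>Basis. ((u t \<bullet> i) * (u t \<bullet> j)) *\<^sub>R \<Gamma> t i j)"
      by (intro continuous_intros uc cont)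
    then show ?thesis
      by (rule continuous_on_eq) (simp add: bilinear_basis_expansion[OF bil(2), symmetric])
  qed
  have G_eq: "g (q t) v w = G t (v c) (w c)" if "t \<in> ?I" "v \<in> tangent_space A (q t)" "w \<in> tangent_space A (q t)" for t v w
    unfolding G_def y_def by (rule g_eq_metric_in_chart[OF c qd[OF that(1)] that(2,3)])
  define a where "a t = h t + \<Gamma> t (u t) (u t)" for t
  have gaa: "g (q t) (acc t) (acc t) = G t (a t) (a t)"
    and gau: "g (q t) (acc t) (vel t) = G t (a t) (u t)" if "t \<in> ?I - N" for t
    using that sub acc_eq[OF that] acc_tangent[of t] vel_tangent[of t]
    by (auto simp: G_eq a_def u_def)
  have guu: "g (q t) (vel t) (vel t) = G t (u t) (u t)" if "t \<in> ?I" for t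
    using that sub vel_tangent[of t] by (auto simp: G_eq u_def)

  have "(\<lambda>t. G t (a t) (a t)) absolutely_integrable_on ?I"
  proof (rule metric_along_curve_abs_integrable[OF cont(1) bil(1)])
    have "(\<lambda>t. \<Gamma> t (u t) (u t)) \<in> borel_measurable (lebesgue_on ?I)"
      using \<Gamma>c by (intro continuous_imp_measurable_on_sets_lebesgue) auto
    then show am: "a \<in> borel_measurable (lebesgue_on ?I)"
      unfolding a_def[abs_def] using h'(3) by (intro borel_measurable_add)
    have "(\<lambda>t. (norm (a t))\<^sup>2) absolutely_integrable_on ?I"
    proof (rule measurable_bounded_by_integrable_imp_absolutely_integrable)
      show "(\<lambda>t. (norm (a t))\<^sup>2) \<in> borel_measurable (lebesgue_on ?I)"
        using measurable_compose[OF am borel_measurable_norm] by (rule borel_measurable_power)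
      show "(\<lambda>t. 2 * (norm (h t))\<^sup>2 + 2 * (norm (\<Gamma> t (u t) (u t)))\<^sup>2) integrable_on ?I"
      proof (rule integrable_add)
        show "(\<lambda>t. 2 * (norm (h t))\<^sup>2) integrable_on ?I" using h'(2) by (rule integrable_on_mult_right)
        show "(\<lambda>t. 2 * (norm (\<Gamma> t (u t) (u t)))\<^sup>2) integrable_on ?I"
          by (intro integrable_continuous_real continuous_intros \<Gamma>c)
      qed
      show "norm ((norm (a t))\<^sup>2) \<le> 2 * (norm (h t))\<^sup>2 + 2 * (norm (\<Gamma> t (u t) (u t)))\<^sup>2" for t
      proof -
        let ?m = "norm (h t)" and ?n = "norm (\<Gamma> t (u t) (u t))"
        have "(norm (a t))\<^sup>2 \<le> (?m + ?n)\<^sup>2" unfolding a_def by (intro power_mono norm_triangle_ineq) auto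
        also have "\<dots> = 2 * ?m\<^sup>2 + 2 * ?n\<^sup>2 - (?m - ?n)\<^sup>2" by (simp add: power2_eq_square algebra_simps)
        finally show ?thesis by (smt (verit) zero_le_power2 real_norm_def)
      qed
    qed simp
    then show "(\<lambda>t. (norm (a t))\<^sup>2) integrable_on ?I" using absolutely_integrable_on_def by blast
  qed
  then have "(\<lambda>t. G t (a t) (a t)) integrable_on ?I" using absolutely_integrable_on_def by blast
  then show "(\<lambda>t. g (q t) (acc t) (acc t)) integrable_on ?I"
    by (rule integrable_spike[OF _ N]) (use gaa in auto)

  have Gd: "((\<lambda>s. G s e e') has_vector_derivative dG t (u t) e e') (at t within ?I)" if t: "t \<in> ?I" for t e e'
    unfolding has_vector_derivative_def G_def dG_def
    using has_derivative_compose[OF yd[OF t, unfolded has_vector_derivative_def]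
        metric_in_chart_has_derivative[OF c yY(2)[OF t]]]
    by (simp add: linear_cmul[OF dmetric_linear[OF c yY(2)[OF t]]])
  have acG: "ac_on \<alpha> \<beta> (\<lambda>t. G t i j)" for i j
  proof (rule ac_on_C1[OF Gd])
    have "continuous_on ?I (\<lambda>t. \<Sum>k\<in>Basis. (u t \<bullet> k) *\<^sub>R dG t k i j)"
      by (intro continuous_intros uc cont)
    then show "continuous_on ?I (\<lambda>t. dG t (u t) i j)"
      by (rule continuous_on_eq) 
        (use linear_basis_expansion[OF dmetric_linear[OF c yY(2)]] in \<open>simp add: dG_def\<close>)
  qed
  have acu: "ac_on \<alpha> \<beta> u"
    by (rule ac_on_cong[OF ac_on_indefinite_integral[OF h'(1), of "u \<alpha>"]]) (simp add: u_int[symmetric])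
  have "ac_on \<alpha> \<beta> (\<lambda>t. \<Sum>i\<in>Basis. \<Sum>j\<in>Basis. ((u t \<bullet> i) *\<^sub>R (u t \<bullet> j)) *\<^sub>R G t i j)"
    by (intro ac_on_sum ac_on_scaleR ac_on_inner acu acG)
  then have ac: "ac_on \<alpha> \<beta> (\<lambda>t. G t (u t) (u t))"
    by (rule ac_on_cong) (simp add: bilinear_basis_expansion[OF bil(1), of _ "u _"])
  have der: "((\<lambda>t. G t (u t) (u t)) has_vector_derivative 2 * G t (a t) (u t)) (at t within ?I)" if t: "t \<in> ?I - N" for t
  proof -
    have tI: "t \<in> ?I" using t by blast
    have "((\<lambda>t. G t (u t) (u t)) has_derivative
       (\<lambda>r. r *\<^sub>R dG t (u t) (u t) (u t) + G t (r *\<^sub>R h t) (u t) + G t (u t) (r *\<^sub>R h t))) (at t within ?I)"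
    proof (rule has_derivative_bilinear_field[OF tI bil(1), where M' = "\<lambda>r e e'. r *\<^sub>R dG t (u t) e e'"])
      show "((\<lambda>s. G s e e') has_derivative (\<lambda>r. r *\<^sub>R dG t (u t) e e')) (at t within ?I)" for e e'
        using Gd[OF tI] unfolding has_vector_derivative_def .
      show "bilinear (\<lambda>e e'. r *\<^sub>R dG t (u t) e e')" for r
        using bil(3)[OF tI, of "u t"] linear_compose_scale_right unfolding bilinear_def by blast
      show "(u has_derivative (\<lambda>r. r *\<^sub>R h t)) (at t within ?I)"
        using ud[OF t] unfolding has_vector_derivative_def .
      then show "(u has_derivative (\<lambda>r. r *\<^sub>R h t)) (at t within ?I)" .
    qed
    moreover have "r *\<^sub>R dG t (u t) (u t) (u t) + G t (r *\<^sub>R h t) (u t) + G t (u t) (r *\<^sub>R h t)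
        = r *\<^sub>R (2 * G t (a t) (u t))" for r
    proof -
      have sym: "G t e e' = G t e' e" for e e'
        unfolding G_def by (rule metric_in_chart_sym[OF c yY(2)[OF tI]])
      have "dG t (u t) (u t) (u t) = G t (\<Gamma> t (u t) (u t)) (u t) + G t (u t) (\<Gamma> t (u t) (u t))"
        unfolding dG_def G_def \<Gamma>_def by (rule christoffel_compat[OF c yY(2)[OF tI]])
      then show ?thesis
        using sym[of "u t"] bil(1)[OF tI]
        by (simp add: a_def bilinear_ladd bilinear_lmul bilinear_rmul algebra_simps)
    qed
    ultimately show ?thesis unfolding has_vector_derivative_def by simp
  qed
  have "((\<lambda>t. 2 * G t (a t) (u t)) has_integral (G \<beta> (u \<beta>) (u \<beta>) - G \<alpha> (u \<alpha>) (u \<alpha>))) ?I"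
    by (rule ac_on_FTC[OF _ ac N der]) (use ab in auto)
  then have "((\<lambda>t. 2 * g (q t) (acc t) (vel t)) has_integral (G \<beta> (u \<beta>) (u \<beta>) - G \<alpha> (u \<alpha>) (u \<alpha>))) ?I"
    by (rule has_integral_spike[OF N, rotated]) (use gau in auto)
  then show "((\<lambda>t. 2 * g (q t) (acc t) (vel t)) has_integral
      (g (q \<beta>) (vel \<beta>) (vel \<beta>) - g (q \<alpha>) (vel \<alpha>) (vel \<alpha>))) ?I"
    using guu ab by simp
qed

text \<open>Both statements are additive over adjacent intervals and hold on short ones, which lie in a chart.\<close>

lemma energy:
  assumes st: "0 \<le> s" "s \<le> t" "t \<le> T"
  shows "(\<lambda>t. g (q t) (acc t) (acc t)) integrable_on {s..t}"
    and "((\<lambda>t. 2 * g (q t) (acc t) (vel t)) has_integral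
      (g (q t) (vel t) (vel t) - g (q s) (vel s) (vel s))) {s..t}"
proof -
  define P where "P \<alpha> \<beta> \<longleftrightarrow> (0 \<le> \<alpha> \<longrightarrow> \<alpha> \<le> \<beta> \<longrightarrow> \<beta> \<le> T \<longrightarrow>
    (\<lambda>t. g (q t) (acc t) (acc t)) integrable_on {\<alpha>..\<beta>} \<and>
    ((\<lambda>t. 2 * g (q t) (acc t) (vel t)) has_integral
      (g (q \<beta>) (vel \<beta>) (vel \<beta>) - g (q \<alpha>) (vel \<alpha>) (vel \<alpha>))) {\<alpha>..\<beta>})" for \<alpha> \<beta>
  have "P s t" using st(2)
  proof (induction rule: Bolzano)
    case (trans a b c)
    show ?case unfolding P_def
    proof (intro impI conjI)
      assume "0 \<le> a" "a \<le> c" "c \<le> T"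
      then have ab: "(\<lambda>t. g (q t) (acc t) (acc t)) integrable_on {a..b}"
          "((\<lambda>t. 2 * g (q t) (acc t) (vel t)) has_integral
            (g (q b) (vel b) (vel b) - g (q a) (vel a) (vel a))) {a..b}"
        and bc: "(\<lambda>t. g (q t) (acc t) (acc t)) integrable_on {b..c}"
          "((\<lambda>t. 2 * g (q t) (acc t) (vel t)) has_integral
            (g (q c) (vel c) (vel c) - g (q b) (vel b) (vel b))) {b..c}"
        using trans unfolding P_def by auto
      show "(\<lambda>t. g (q t) (acc t) (acc t)) integrable_on {a..c}"
        by (rule Henstock_Kurzweil_Integration.integrable_combine[OF trans(3,4) ab(1) bc(1)])
      show "((\<lambda>t. 2 * g (q t) (acc t) (vel t)) has_integral
            (g (q c) (vel c) (vel c) - g (q a) (vel a) (vel a))) {a..c}"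
        using has_integral_combine[OF trans(3,4) ab(2) bc(2)] by simp
    qed
  next
    case (local x)
    have x: "x \<in> {0..T}" using local st by auto
    obtain c where c: "c \<in> A" "q x \<in> chart_dom c" using ex_chart by blast
    have "continuous_on {0..T} q" using H2 unfolding H2_curve_def by blast
    then obtain \<delta> where \<delta>: "\<delta> > 0" "\<And>s. s \<in> {0..T} \<Longrightarrow> \<bar>s - x\<bar> < \<delta> \<Longrightarrow> q s \<in> chart_dom c"
      using stays_in_open[of "{0..T}" q x "chart_dom c"] x open_chart_dom[OF c(1)] c(2) by blast
    have "P a b" if "a \<le> x" "x \<le> b" "b - a < \<delta>" for a b
      unfolding P_def
    proof (intro impI)
      assume ab: "0 \<le> a" "a \<le> b" "b \<le> T"
      show "(\<lambda>t. g (q t) (acc t) (acc t)) integrable_on {a..b} \<and>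
        ((\<lambda>t. 2 * g (q t) (acc t) (vel t)) has_integral
          (g (q b) (vel b) (vel b) - g (q a) (vel a) (vel a))) {a..b}"
      proof (cases "a = b")
        case True
        then show ?thesis using has_integral_refl(2) by (auto simp: integrable_on_def)
      next
        case False
        have "q ` {a..b} \<subseteq> chart_dom c" using \<delta>(2) that ab by auto
        then show ?thesis using energy_in_chart[OF c(1) ab(1) _ ab(3)] False ab by auto
      qed
    qed
    then show ?case using \<delta>(1) by blast
  qed
  then show "(\<lambda>t. g (q t) (acc t) (acc t)) integrable_on {s..t}"
    and "((\<lambda>t. 2 * g (q t) (acc t) (vel t)) has_integral
      (g (q t) (vel t) (vel t) - g (q s) (vel s) (vel s))) {s..t}"
    using st unfolding P_def by auto
qed

text \<open>Let \<open>M\<close> be the maximal speed, attained at \<open>m\<close>. Integrating \<open>d/dt \<parallel>q'\<parallel>\<^sup>2 = 2 g(q'', q') \<le> 2 \<parallel>q''\<parallel> M\<close>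
up to \<open>m\<close> gives \<open>M\<^sup>2 \<le> \<parallel>q'(0)\<parallel>\<^sup>2 + 2 M sqrt (C T)\<close>, and solving this quadratic inequality gives the
bound. The Cauchy-Schwarz inequality for the integral is replaced by Young's inequality with a parameter
\<open>l\<close> that is optimised afterwards.\<close>

lemma speed_bound:
  assumes C: "integral {0..T} (\<lambda>t. g (q t) (acc t) (acc t)) \<le> C" and t: "t \<in> {0..T}"
  shows "tangent_norm g (q t) (vel t) \<le> sqrt (C * T) + sqrt (C * T + (tangent_norm g (q 0) (vel 0))\<^sup>2)"
proof -
  define f where "f t = g (q t) (vel t) (vel t)" for t
  let ?N2 = "\<lambda>t. g (q t) (acc t) (acc t)"
  have f0: "f t \<ge> 0" if "t \<in> {0..T}" for t
    unfolding f_def using g_nonneg vel_tangent that by blast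
  have N0: "?N2 t \<ge> 0" if "t \<in> {0..T}" for t
    using g_nonneg acc_tangent that by blast
  have "0 \<le> integral {0..T} ?N2" using energy(1)[of 0 T] T N0 by (intro integral_nonneg) auto
  then have C0: "C \<ge> 0" using C by linarith
  have "continuous_on {0..T} f"
  proof -
    let ?h = "\<lambda>t. 2 * g (q t) (acc t) (vel t)"
    have "?h integrable_on {0..T}" using energy(2)[of 0 T] T by (auto simp: integrable_on_def)
    then have "continuous_on {0..T} (\<lambda>t. f 0 + integral {0..t} ?h)"
      by (intro continuous_intros indefinite_integral_continuous_1)
    moreover have "f 0 + integral {0..t} ?h = f t" if "t \<in> {0..T}" for t
      using integral_unique[OF energy(2)[of 0 t]] that by (simp add: f_def)
    ultimately show ?thesis by (metis (no_types, lifting) continuous_on_cong)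
  qed
  moreover have "compact {0..T}" "{0..T} \<noteq> {}" using T by auto
  ultimately obtain m where m: "m \<in> {0..T}" "\<And>t. t \<in> {0..T} \<Longrightarrow> f t \<le> f m"
    by (meson continuous_attains_sup)
  define M where "M = sqrt (f m)"
  have M0: "M \<ge> 0" and M2: "M\<^sup>2 = f m" using f0[OF m(1)] by (simp_all add: M_def)
  have speed: "tangent_norm g (q t) (vel t) \<le> M" if "t \<in> {0..T}" for t
    using m(2)[OF that] by (simp add: M_def f_def tangent_norm_def)
  have young: "M\<^sup>2 \<le> f 0 + (l * C + M\<^sup>2 * T / l)" if "l > 0" for l
  proof -
    have i: "?N2 integrable_on {0..m}" using energy(1)[of 0 m] m by auto
    have le: "2 * g (q t) (acc t) (vel t) \<le> l * ?N2 t + M\<^sup>2 / l" if t: "t \<in> {0..m}" for t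
    proof -
      have t': "t \<in> {0..T}" using t m by auto
      let ?n = "tangent_norm g (q t) (acc t)"
      have n: "?n \<ge> 0" "?n\<^sup>2 = ?N2 t"
        using tangent_norm_nonneg tangent_norm_sq acc_tangent[OF t'] by blast+
      have "g (q t) (acc t) (vel t) \<le> ?n * tangent_norm g (q t) (vel t)"
        using g_Cauchy_Schwarz[OF acc_tangent[OF t'] vel_tangent[OF t']] by linarith
      also have "\<dots> \<le> ?n * M" using speed[OF t'] n by (intro mult_left_mono) auto
      finally have 1: "2 * g (q t) (acc t) (vel t) \<le> 2 * (?n * M)" by simp
      have "0 \<le> (l * ?n - M)\<^sup>2 / l" using \<open>l > 0\<close> by simp
      also have "\<dots> = l * ?n\<^sup>2 + M\<^sup>2 / l - 2 * (?n * M)"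
        using \<open>l > 0\<close> by (simp add: power2_eq_square field_simps)
      finally have "0 \<le> l * ?N2 t + M\<^sup>2 / l - 2 * (?n * M)" by (simp only: n(2))
      then show ?thesis using 1 by argo
    qed
    have "f m - f 0 \<le> integral {0..m} (\<lambda>t. l * ?N2 t + M\<^sup>2 / l)"
    proof (rule has_integral_le)
      show "((\<lambda>t. 2 * g (q t) (acc t) (vel t)) has_integral f m - f 0) {0..m}"
        using energy(2)[of 0 m] m by (simp add: f_def)
      show "((\<lambda>t. l * ?N2 t + M\<^sup>2 / l) has_integral integral {0..m} (\<lambda>t. l * ?N2 t + M\<^sup>2 / l)) {0..m}"
        by (intro integrable_integral integrable_add integrable_on_mult_right i) auto
    qed (use le in auto)
    also have "\<dots> = l * integral {0..m} ?N2 + M\<^sup>2 / l * m"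
      using m i by (subst integral_add) (auto intro: integrable_on_mult_right)
    also have "\<dots> \<le> l * C + M\<^sup>2 / l * T"
    proof (intro add_mono mult_left_mono)
      have "integral {0..m} ?N2 \<le> integral {0..T} ?N2"
        by (rule integral_subset_le) (use m i N0 energy(1)[of 0 T] T in auto)
      then show "integral {0..m} ?N2 \<le> C" using C by linarith
    qed (use m \<open>l > 0\<close> in auto)
    finally show ?thesis using M2 by simp
  qed
  have quad: "M\<^sup>2 \<le> f 0 + 2 * M * sqrt (C * T)"
  proof (cases "M = 0")
    case True
    then show ?thesis using f0[of 0] T by simp
  next
    case False
    then have "M > 0" using M0 by simp
    show ?thesis
    proof (cases "C = 0")
      case True
      \<comment> \<open>No optimal parameter exists here: it has to tend to infinity.\<close>
      have "M\<^sup>2 \<le> f 0 + e" if "e > 0" for e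
        using young[of "M\<^sup>2 * T / e"] that \<open>M > 0\<close> T True by (simp add: field_simps)
      then have "M\<^sup>2 \<le> f 0" by (rule field_le_epsilon)
      then show ?thesis using True by simp
    next
      case False
      then have "C > 0" using C0 by simp
      define r where "r = sqrt (C * T)"
      have r: "r > 0" "r * r = C * T" using \<open>C > 0\<close> T by (simp_all add: r_def)
      \<comment> \<open>The value of the parameter for which the two terms on the right are equal.\<close>
      have "M\<^sup>2 \<le> f 0 + (M * T / r * C + M\<^sup>2 * T / (M * T / r))"
        by (rule young) (use \<open>M > 0\<close> r T in simp)
      also have "M * T / r * C = M * r" using r \<open>M > 0\<close> by (simp add: field_simps)
      also have "M\<^sup>2 * T / (M * T / r) = M * r" using r \<open>M > 0\<close> T by (simp add: field_simps power2_eq_square)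
      finally show ?thesis by (simp add: r_def)
    qed
  qed
  define r where "r = sqrt (C * T)"
  have r2: "r\<^sup>2 = C * T" "r \<ge> 0" using C0 T by (simp_all add: r_def)
  have "(M - r)\<^sup>2 \<le> C * T + f 0" using quad r2(1) by (simp add: r_def[symmetric] power2_diff)
  then have "M - r \<le> sqrt (C * T + f 0)" by (rule real_le_rsqrt)
  moreover have "f 0 = (tangent_norm g (q 0) (vel 0))\<^sup>2"
    using tangent_norm_sq[OF vel_tangent[of 0]] T by (simp add: f_def)
  ultimately show ?thesis using speed[OF t] by (simp add: r_def)
qed

end

end

section \<open>Riemannian distance along a curve\<close>

lemma set_lebesgue_integral_le_const:
  fixes f :: "real \<Rightarrow> real"
  assumes "a \<le> b" "0 \<le> B" "\<And>t. t \<in> {a..b} \<Longrightarrow> f t \<le> B"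
  shows "(LINT t:{a..b}|lebesgue. f t) \<le> B * (b - a)"
proof (cases "set_integrable lebesgue {a..b} f")
  case True
  then have "f integrable_on {a..b}" "(LINT t:{a..b}|lebesgue. f t) = integral {a..b} f"
    using set_lebesgue_integral_eq_integral by blast+
  moreover have "integral {a..b} f \<le> integral {a..b} (\<lambda>_. B)"
    by (rule integral_le) (use \<open>f integrable_on {a..b}\<close> assms in auto)
  ultimately show ?thesis using assms by (simp add: mult.commute)
next
  case False
  then have "(LINT t:{a..b}|lebesgue. f t) = 0"
    by (simp add: set_lebesgue_integral_def set_integrable_def not_integrable_integral_eq)
  then show ?thesis using assms by simp
qed

lemma C1_curve_continuous: "C1_curve A a b \<gamma> \<Longrightarrow> continuous_on {a..b} \<gamma>"
  unfolding C1_curve_def by (rule conjunct1)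

lemma C1_curve_in_chart:
  assumes "C1_curve A a b \<gamma>" "c \<in> A" "a \<le> s" "s < u" "u \<le> b" "\<gamma> ` {s..u} \<subseteq> chart_dom c"
  shows "\<exists>D. continuous_on {s..u} D \<and>
     (\<forall>t\<in>{s..u}. ((\<lambda>t. chart_map c (\<gamma> t)) has_vector_derivative D t) (at t within {s..u}))"
  by (rule assms(1)[unfolded C1_curve_def, THEN conjunct2, rule_format]) (use assms in auto)

lemma C1_curve_cong:
  assumes "C1_curve A s u \<gamma>" "\<And>t. t \<in> {s..u} \<Longrightarrow> \<gamma> t = \<gamma>' t"
  shows "C1_curve A s u \<gamma>'"
  unfolding C1_curve_def
proof (intro conjI ballI allI impI)
  have "continuous_on {s..u} \<gamma>" by (rule C1_curve_continuous[OF assms(1)])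
  then show "continuous_on {s..u} \<gamma>'" by (rule continuous_on_eq) (rule assms(2))
  fix c s' u' assume c: "c \<in> A" and su: "s \<le> s' \<and> s' < u' \<and> u' \<le> u \<and> \<gamma>' ` {s'..u'} \<subseteq> chart_dom c"
  have eq: "\<gamma> t = \<gamma>' t" if "t \<in> {s'..u'}" for t using assms(2) su that by auto
  have "\<gamma> ` {s'..u'} = \<gamma>' ` {s'..u'}" by (rule image_cong[OF refl eq])
  then have "\<gamma> ` {s'..u'} \<subseteq> chart_dom c" using su by simp
  then obtain D where D: "continuous_on {s'..u'} D"
    "\<And>t. t \<in> {s'..u'} \<Longrightarrow> ((\<lambda>t. chart_map c (\<gamma> t)) has_vector_derivative D t) (at t within {s'..u'})"
    using C1_curve_in_chart[OF assms(1) c, of s' u'] su by blast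
  have "((\<lambda>t. chart_map c (\<gamma>' t)) has_vector_derivative D t) (at t within {s'..u'})" if "t \<in> {s'..u'}" for t
    by (rule has_vector_derivative_transform[OF that _ D(2)[OF that]]) (simp add: eq)
  then show "\<exists>D. continuous_on {s'..u'} D \<and>
     (\<forall>t\<in>{s'..u'}. ((\<lambda>t. chart_map c (\<gamma>' t)) has_vector_derivative D t) (at t within {s'..u'}))"
    using D(1) by blast
qed

lemma C1_curve_subinterval:
  assumes "C1_curve A a b \<gamma>" "a \<le> s" "u \<le> b"
  shows "C1_curve A s u \<gamma>"
  unfolding C1_curve_def
proof (intro conjI ballI allI impI)
  have "continuous_on {a..b} \<gamma>" by (rule C1_curve_continuous[OF assms(1)])
  then show "continuous_on {s..u} \<gamma>" by (rule continuous_on_subset) (use assms in auto)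
  fix c s' u' assume c: "c \<in> A" and su: "s \<le> s' \<and> s' < u' \<and> u' \<le> u \<and> \<gamma> ` {s'..u'} \<subseteq> chart_dom c"
  then show "\<exists>D. continuous_on {s'..u'} D \<and>
     (\<forall>t\<in>{s'..u'}. ((\<lambda>t. chart_map c (\<gamma> t)) has_vector_derivative D t) (at t within {s'..u'}))"
    using C1_curve_in_chart[OF assms(1) c, of s' u'] assms(2,3) by auto
qed

lemma velocity_cong_interior:
  fixes A :: "('q, 'e::euclidean_space) chart set"
  assumes "open U" "t \<in> U" "U \<subseteq> I" "U \<subseteq> I'" "\<And>s. s \<in> U \<Longrightarrow> \<gamma> s = \<gamma>' s"
  shows "velocity A I \<gamma> t = velocity A I' \<gamma>' t"
proof
  fix c :: "('q, 'e) chart"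
  have w: "at t within I = at t" "at t within I' = at t"
    using assms(1-4) by (meson at_within_interior interiorI)+
  have "((\<lambda>s. chart_map c (\<gamma> s)) has_vector_derivative d) (at t) \<longleftrightarrow>
        ((\<lambda>s. chart_map c (\<gamma>' s)) has_vector_derivative d) (at t)" for d
    using has_vector_derivative_transform_within_open[OF _ assms(1,2)] assms(5) by (metis (no_types, lifting))
  then show "velocity A I \<gamma> t c = velocity A I' \<gamma>' t c"
    using assms(2,5) by (simp add: velocity_def vector_derivative_def w)
qed

context riemannian
begin

text \<open>At the breakpoints the velocity of a piecewise smooth curve is arbitrary, and the metric of a family of
components that is not a tangent vector has no sign; so lengths are nonnegative only because such times
are finite in number.\<close>

lemma piecewise_C1_velocity_tangent:
  assumes "piecewise_C1_curve A a b \<gamma>"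
  obtains K where "finite K" "\<And>t. t \<in> {a..b} - K \<Longrightarrow> velocity A {a..b} \<gamma> t \<in> tangent_space A (\<gamma> t)"
proof -
  obtain K where K: "finite K"
    "\<And>s u. a \<le> s \<Longrightarrow> s < u \<Longrightarrow> u \<le> b \<Longrightarrow> K \<inter> {s<..<u} = {} \<Longrightarrow> C1_curve A s u \<gamma>"
    and cont: "continuous_on {a..b} \<gamma>"
    using assms unfolding piecewise_C1_curve_def by blast
  show thesis
  proof
    show "finite (K \<union> {a, b})" using K(1) by simp
    fix t assume t: "t \<in> {a..b} - (K \<union> {a, b})"
    obtain c where c: "c \<in> A" "\<gamma> t \<in> chart_dom c" using ex_chart by blast
    obtain \<delta> where \<delta>: "\<delta> > 0" "\<And>s. s \<in> {a..b} \<Longrightarrow> \<bar>s - t\<bar> < \<delta> \<Longrightarrow> \<gamma> s \<in> chart_dom c"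
      using stays_in_open[OF cont, of t "chart_dom c"] open_chart_dom[OF c(1)] c(2) t by blast
    have "open ({a<..<b} - K)" using K(1) by (intro open_Diff finite_imp_closed) auto
    moreover have "t \<in> {a<..<b} - K" using t by auto
    ultimately obtain e where e: "e > 0" "ball t e \<subseteq> {a<..<b} - K" using open_contains_ball by blast
    define r where "r = min e \<delta> / 2"
    have r: "r > 0" "r < e" "r < \<delta>" using e \<delta> by (auto simp: r_def)
    have sub: "{t-r..t+r} \<subseteq> {a<..<b} - K"
      using e(2) r by (auto simp: subset_iff dist_real_def)
    moreover have "t - r \<in> {t-r..t+r}" "t + r \<in> {t-r..t+r}" using r by auto
    ultimately have tr: "t - r \<in> {a<..<b}" "t + r \<in> {a<..<b}" by blast+
    have "\<gamma> ` {t-r..t+r} \<subseteq> chart_dom c"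
    proof
      fix x assume "x \<in> \<gamma> ` {t-r..t+r}"
      then obtain s where s: "s \<in> {t-r..t+r}" "x = \<gamma> s" by blast
      have "s \<in> {a..b}" "\<bar>s - t\<bar> < \<delta>" using s(1) sub r by auto
      then show "x \<in> chart_dom c" using \<delta>(2) s(2) by blast
    qed
    moreover have "{t-r<..<t+r} \<subseteq> {t-r..t+r}" by auto
    then have "K \<inter> {t-r<..<t+r} = {}" using sub by blast
    then have "C1_curve A (t-r) (t+r) \<gamma>" using K(2)[of "t-r" "t+r"] tr r by auto
    ultimately obtain D where "((\<lambda>t. chart_map c (\<gamma> t)) has_vector_derivative D t) (at t within {t-r..t+r})"
      using C1_curve_in_chart[OF _ c(1), of "t-r" "t+r" \<gamma> "t-r" "t+r"] r by fastforce
    moreover have "at t within {t-r..t+r} = at t within {a..b}"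
      using r t by (simp add: at_within_Icc_at)
    ultimately have "((\<lambda>t. chart_map c (\<gamma> t)) has_vector_derivative D t) (at t within {a..b})" by simp
    moreover have "a < b" "t \<in> {a..b}" using t by auto
    ultimately show "velocity A {a..b} \<gamma> t \<in> tangent_space A (\<gamma> t)"
      using velocity_tangent c cont by blast
  qed
qed

lemma curve_length_nonneg:
  assumes "piecewise_C1_curve A a b \<gamma>"
  shows "curve_length A g a b \<gamma> \<ge> 0"
proof -
  obtain K where K: "finite K" "\<And>t. t \<in> {a..b} - K \<Longrightarrow> velocity A {a..b} \<gamma> t \<in> tangent_space A (\<gamma> t)"
    by (rule piecewise_C1_velocity_tangent[OF assms]) blast
  have "K \<in> null_sets lebesgue" using K(1) negligible_finite negligible_iff_null_sets by blast
  then have "AE t in lebesgue. t \<notin> K" by (rule AE_not_in)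
  then have "AE t in lebesgue. 0 \<le> indicator {a..b} t *\<^sub>R tangent_norm g (\<gamma> t) (velocity A {a..b} \<gamma> t)"
    by eventually_elim (use K(2) tangent_norm_nonneg in \<open>auto simp: indicator_def\<close>)
  then show ?thesis
    unfolding curve_length_def set_lebesgue_integral_def by (rule integral_nonneg_AE)
qed

lemma concat_piecewise_C1:
  assumes "a < b" "b < d" "piecewise_C1_curve A a b \<gamma>1" "C1_curve A b d \<gamma>2" "\<gamma>1 b = \<gamma>2 b"
  shows "piecewise_C1_curve A a d (\<lambda>t. if t \<le> b then \<gamma>1 t else \<gamma>2 t)" (is "piecewise_C1_curve A a d ?\<gamma>")
proof -
  obtain K where K: "finite K"
    "\<And>s u. a \<le> s \<Longrightarrow> s < u \<Longrightarrow> u \<le> b \<Longrightarrow> K \<inter> {s<..<u} = {} \<Longrightarrow> C1_curve A s u \<gamma>1"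
    and c1: "continuous_on {a..b} \<gamma>1"
    using assms(3) unfolding piecewise_C1_curve_def by blast
  have c2: "continuous_on {b..d} \<gamma>2" by (rule C1_curve_continuous[OF assms(4)])
  have eq2: "?\<gamma> t = \<gamma>2 t" if "t \<ge> b" for t using assms(5) that by auto
  have "continuous_on ({a..b} \<union> {b..d}) ?\<gamma>"
  proof (rule continuous_on_closed_Un)
    show "continuous_on {a..b} ?\<gamma>" by (rule continuous_on_eq[OF c1]) auto
    show "continuous_on {b..d} ?\<gamma>" by (rule continuous_on_eq[OF c2]) (use assms(5) in auto)
  qed auto
  moreover have "{a..b} \<union> {b..d} = {a..d}" using assms by auto
  ultimately have "continuous_on {a..d} ?\<gamma>" by simp
  moreover have "C1_curve A s u ?\<gamma>" if su: "a \<le> s" "s < u" "u \<le> d" "insert b K \<inter> {s<..<u} = {}" for s u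
  proof (cases "u \<le> b")
    case True
    have "C1_curve A s u \<gamma>1" using K(2)[of s u] su True by auto
    then show ?thesis by (rule C1_curve_cong) (use True in auto)
  next
    case False
    then have "b \<le> s" using su by auto
    have "C1_curve A s u \<gamma>2" by (rule C1_curve_subinterval[OF assms(4) \<open>b \<le> s\<close> su(3)])
    then show ?thesis
    proof (rule C1_curve_cong)
      fix t assume "t \<in> {s..u}"
      then show "\<gamma>2 t = ?\<gamma> t" using eq2[of t] \<open>b \<le> s\<close> by simp
    qed
  qed
  then have "\<exists>K. finite K \<and> (\<forall>s u. a \<le> s \<and> s < u \<and> u \<le> d \<and> K \<inter> {s<..<u} = {} \<longrightarrow> C1_curve A s u ?\<gamma>)"
    using K(1) by (intro exI[of _ "insert b K"]) auto
  ultimately show ?thesis unfolding piecewise_C1_curve_def by blast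
qed

lemma C1_imp_piecewise_C1: "C1_curve A a b \<gamma> \<Longrightarrow> piecewise_C1_curve A a b \<gamma>"
  unfolding piecewise_C1_curve_def
  using C1_curve_continuous C1_curve_subinterval by (metis finite.emptyI)

text \<open>An inequality suffices for the triangle inequality. It covers curves whose speed is not integrable: then
the concatenation has the default length \<open>0\<close>.\<close>

lemma curve_length_concat_le:
  assumes "a < b" "b < d" "piecewise_C1_curve A a b \<gamma>1" "C1_curve A b d \<gamma>2"
  shows "curve_length A g a d (\<lambda>t. if t \<le> b then \<gamma>1 t else \<gamma>2 t)
    \<le> curve_length A g a b \<gamma>1 + curve_length A g b d \<gamma>2"
proof -
  let ?\<gamma> = "\<lambda>t. if t \<le> b then \<gamma>1 t else \<gamma>2 t"
  define F where "F t = tangent_norm g (?\<gamma> t) (velocity A {a..d} ?\<gamma> t)" for t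
  define F1 where "F1 t = tangent_norm g (\<gamma>1 t) (velocity A {a..b} \<gamma>1 t)" for t
  define F2 where "F2 t = tangent_norm g (\<gamma>2 t) (velocity A {b..d} \<gamma>2 t)" for t
  have L: "curve_length A g a d ?\<gamma> = (LINT t:{a..d}|lebesgue. F t)"
    "curve_length A g a b \<gamma>1 = (LINT t:{a..b}|lebesgue. F1 t)"
    "curve_length A g b d \<gamma>2 = (LINT t:{b..d}|lebesgue. F2 t)"
    by (simp_all add: curve_length_def F_def F1_def F2_def)
  have nonneg: "0 \<le> curve_length A g a b \<gamma>1" "0 \<le> curve_length A g b d \<gamma>2"
    using curve_length_nonneg C1_imp_piecewise_C1 assms(3,4) by blast+
  show ?thesis
  proof (cases "F absolutely_integrable_on {a..d}")
    case False
    then have "(LINT t:{a..d}|lebesgue. F t) = 0"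
      by (simp add: set_lebesgue_integral_def set_integrable_def not_integrable_integral_eq)
    then show ?thesis using nonneg L by simp
  next
    case True
    have F1: "F t = F1 t" if "t \<in> {a..b} - {a, b}" for t
    proof -
      have "velocity A {a..d} ?\<gamma> t = velocity A {a..b} \<gamma>1 t"
        by (rule velocity_cong_interior[of "{a<..<b}"]) (use that assms in auto)
      then show ?thesis using that by (simp add: F_def F1_def)
    qed
    have F2: "F t = F2 t" if "t \<in> {b..d} - {b, d}" for t
    proof -
      have "velocity A {a..d} ?\<gamma> t = velocity A {b..d} \<gamma>2 t"
        by (rule velocity_cong_interior[of "{b<..<d}"]) (use that assms in auto)
      then show ?thesis using that by (simp add: F_def F2_def)
    qed
    have i: "F absolutely_integrable_on {a..b}" "F absolutely_integrable_on {b..d}"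
      using absolutely_integrable_on_subinterval[OF True] assms by auto
    have n: "negligible {a, b}" "negligible {b, d}" by (auto intro: negligible_finite)
    have "F1 absolutely_integrable_on {a..b}"
      by (rule absolutely_integrable_spike[OF i(1) n(1)]) (use F1 in auto)
    then have 1: "(LINT t:{a..b}|lebesgue. F1 t) = integral {a..b} F1" by (rule set_lebesgue_integral_eq_integral)
    have "F2 absolutely_integrable_on {b..d}"
      by (rule absolutely_integrable_spike[OF i(2) n(2)]) (use F2 in auto)
    then have 2: "(LINT t:{b..d}|lebesgue. F2 t) = integral {b..d} F2" by (rule set_lebesgue_integral_eq_integral)
    have "(LINT t:{a..d}|lebesgue. F t) = integral {a..d} F"
      using True by (rule set_lebesgue_integral_eq_integral)
    also have "\<dots> = integral {a..b} F + integral {b..d} F"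
      using assms(1,2) set_lebesgue_integral_eq_integral(1)[OF True]
      by (intro Henstock_Kurzweil_Integration.integral_combine[symmetric]) auto
    also have "integral {a..b} F = integral {a..b} F1"
      by (rule integral_spike[OF n(1)]) (use F1 in auto)
    also have "integral {b..d} F = integral {b..d} F2"
      by (rule integral_spike[OF n(2)]) (use F2 in auto)
    finally show ?thesis using L 1 2 by simp
  qed
qed

definition lengths :: "'q \<Rightarrow> 'q \<Rightarrow> real set" where
  "lengths x y = {curve_length A g a b \<gamma> | a b \<gamma>. a < b \<and> piecewise_C1_curve A a b \<gamma> \<and> \<gamma> a = x \<and> \<gamma> b = y}"

lemma riem_dist_lengths: "riem_dist A g x y = Inf (lengths x y)"
  unfolding riem_dist_def lengths_def ..

text \<open>The part of an \<open>H\<^sup>2\<close> curve between the times \<open>s\<close> and \<open>t\<close>, in either order, run from \<open>q s\<close> to \<open>q t\<close>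
and shifted to start at an arbitrary time \<open>b\<close>, so that it can be appended to a given curve.\<close>

lemma reparametrized_piece:
  fixes b :: real
  assumes H2: "H2_curve A T q" and T: "T > 0"
    and st: "s \<in> {0..T}" "t \<in> {0..T}" "s \<noteq> t"
    and v: "\<And>r. r \<in> {0..T} \<Longrightarrow> tangent_norm g (q r) (velocity A {0..T} q r) \<le> v"
  defines "\<gamma> \<equiv> \<lambda>r. q (s + sgn (t - s) * (r - b))"
  shows "C1_curve A b (b + \<bar>t - s\<bar>) \<gamma>" and "curve_length A g b (b + \<bar>t - s\<bar>) \<gamma> \<le> v * \<bar>t - s\<bar>"
proof -
  define \<sigma> where "\<sigma> = sgn (t - s)"
  define \<phi> where "\<phi> r = s + \<sigma> * (r - b)" for r
  define d where "d = b + \<bar>t - s\<bar>"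
  let ?X = "velocity A {0..T} q"
  have \<gamma>: "\<gamma> r = q (\<phi> r)" for r by (simp add: \<gamma>_def \<phi>_def \<sigma>_def)
  have \<sigma>: "\<sigma> = 1 \<or> \<sigma> = -1" "\<sigma>\<^sup>2 = 1" using st(3) by (auto simp: \<sigma>_def sgn_if)
  have bd: "b < d" using st(3) by (simp add: d_def)
  have \<phi>T: "\<phi> r \<in> {0..T}" if "r \<in> {b..d}" for r
    using that st by (auto simp: \<phi>_def \<sigma>_def d_def sgn_if split: if_splits)
  have \<phi>c: "continuous_on S \<phi>" for S unfolding \<phi>_def by (intro continuous_intros)
  have qc: "continuous_on {0..T} q" using H2 unfolding H2_curve_def by blast
  have reg: "regular_curve 0 T q" by (rule H2_regular[OF H2 T])
  have der: "((\<lambda>r. chart_map c (\<gamma> r)) has_vector_derivative \<sigma> *\<^sub>R ?X (\<phi> r) c) (at r within {s'..u'})"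
    if "c \<in> A" "\<gamma> r \<in> chart_dom c" "r \<in> {s'..u'}" "{s'..u'} \<subseteq> {b..d}" for c r s' u'
  proof -
    have "(\<phi> has_vector_derivative \<sigma>) (at r within {s'..u'})"
      unfolding \<phi>_def by (auto intro!: derivative_eq_intros simp: has_vector_derivative_def)
    moreover have "((\<lambda>\<tau>. chart_map c (q \<tau>)) has_vector_derivative ?X (\<phi> r) c) (at (\<phi> r) within \<phi> ` {s'..u'})"
      by (rule has_vector_derivative_within_subset[OF regular_curve_velocity(2)[OF reg]])
        (use that \<phi>T \<gamma> in auto)
    ultimately show ?thesis
      using vector_diff_chain_within by (fastforce simp: o_def \<gamma>)
  qed
  have "C1_curve A b d \<gamma>"
    unfolding C1_curve_def
  proof (intro conjI ballI allI impI)
    show "continuous_on {b..d} \<gamma>"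
      unfolding \<gamma> by (rule continuous_on_compose2[OF qc \<phi>c]) (use \<phi>T in auto)
    fix c s' u' assume c: "c \<in> A" and su: "b \<le> s' \<and> s' < u' \<and> u' \<le> d \<and> \<gamma> ` {s'..u'} \<subseteq> chart_dom c"
    define \<alpha> \<beta> where "\<alpha> = min (\<phi> s') (\<phi> u')" and "\<beta> = max (\<phi> s') (\<phi> u')"
    have ab: "0 \<le> \<alpha>" "\<alpha> < \<beta>" "\<beta> \<le> T"
      using \<phi>T[of s'] \<phi>T[of u'] su \<sigma> by (auto simp: \<alpha>_def \<beta>_def \<phi>_def min_def max_def)
    have "q ` {\<alpha>..\<beta>} \<subseteq> chart_dom c"
    proof
      fix x assume "x \<in> q ` {\<alpha>..\<beta>}"
      then obtain \<tau> where \<tau>: "\<tau> \<in> {\<alpha>..\<beta>}" "x = q \<tau>" by blast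
      define r where "r = b + \<sigma> * (\<tau> - s)"
      have "\<phi> r = \<tau>" "r \<in> {s'..u'}"
        using \<sigma> \<tau>(1) su by (auto simp: r_def \<phi>_def \<alpha>_def \<beta>_def min_def max_def split: if_splits)
      then have "x \<in> \<gamma> ` {s'..u'}" using \<gamma>[of r] \<tau>(2) by (metis imageI)
      then show "x \<in> chart_dom c" using su by blast
    qed
    then have "continuous_on {\<alpha>..\<beta>} (\<lambda>t. ?X t c)"
      by (rule vel_continuous_in_chart[OF H2 T c ab])
    moreover have "\<phi> ` {s'..u'} \<subseteq> {\<alpha>..\<beta>}"
      using \<sigma>(1) by (auto simp: \<alpha>_def \<beta>_def \<phi>_def)
    ultimately have "continuous_on {s'..u'} (\<lambda>r. \<sigma> *\<^sub>R ?X (\<phi> r) c)"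
      by (intro continuous_intros continuous_on_compose2[OF _ \<phi>c])
    moreover have "((\<lambda>r. chart_map c (\<gamma> r)) has_vector_derivative \<sigma> *\<^sub>R ?X (\<phi> r) c) (at r within {s'..u'})"
      if "r \<in> {s'..u'}" for r
      by (rule der[OF c]) (use that su in auto)
    ultimately show "\<exists>D. continuous_on {s'..u'} D \<and>
       (\<forall>t\<in>{s'..u'}. ((\<lambda>t. chart_map c (\<gamma> t)) has_vector_derivative D t) (at t within {s'..u'}))"
      by blast
  qed
  then show "C1_curve A b (b + \<bar>t - s\<bar>) \<gamma>" unfolding d_def .
  have vel: "velocity A {b..d} \<gamma> r = (\<lambda>c. \<sigma> *\<^sub>R ?X (\<phi> r) c)" if r: "r \<in> {b..d}" for r
  proof
    fix c
    show "velocity A {b..d} \<gamma> r c = \<sigma> *\<^sub>R ?X (\<phi> r) c"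
    proof (cases "c \<in> A \<and> \<gamma> r \<in> chart_dom c")
      case True
      then show ?thesis using velocity_component[OF bd r _ _ der] r by blast
    next
      case False
      then show ?thesis by (auto simp: velocity_def \<gamma>)
    qed
  qed
  have "tangent_norm g (\<gamma> r) (velocity A {b..d} \<gamma> r) \<le> v" if r: "r \<in> {b..d}" for r
  proof -
    have "tangent_norm g (\<gamma> r) (velocity A {b..d} \<gamma> r) = tangent_norm g (q (\<phi> r)) (?X (\<phi> r))"
      unfolding vel[OF r] tangent_norm_def \<gamma>
      using g_scale[OF vel_tangent[OF H2 T \<phi>T[OF r]], of \<sigma>] \<sigma>(2) by simp
    then show ?thesis using v[OF \<phi>T[OF r]] by simp
  qed
  moreover have "0 \<le> v"
    using v[of 0] tangent_norm_nonneg[OF vel_tangent[OF H2 T, of 0]] T by simp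
  ultimately have "curve_length A g b d \<gamma> \<le> v * (d - b)"
    unfolding curve_length_def using bd by (intro set_lebesgue_integral_le_const) auto
  then show "curve_length A g b (b + \<bar>t - s\<bar>) \<gamma> \<le> v * \<bar>t - s\<bar>" by (simp add: d_def)
qed

text \<open>Extend the curves from \<open>p\<close> to \<open>q s\<close> by the piece from \<open>q s\<close> to \<open>q t\<close>. As the piece can also be run
backwards, there is a curve from \<open>p\<close> to \<open>q s\<close> if and only if there is one to \<open>q t\<close>; if there is none,
the two distances are the same infimum of the empty set.\<close>

lemma riem_dist_speed_bound:
  assumes H2: "H2_curve A T q" and T: "T > 0"
    and v: "\<And>r. r \<in> {0..T} \<Longrightarrow> tangent_norm g (q r) (velocity A {0..T} q r) \<le> v"
    and st: "s \<in> {0..T}" "t \<in> {0..T}"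
  shows "riem_dist A g p (q t) \<le> riem_dist A g p (q s) + v * \<bar>t - s\<bar>"
proof (cases "s = t")
  case False
  have extend: "\<exists>l'\<in>lengths p (q t). l' \<le> l + v * \<bar>t - s\<bar>"
    if l: "l \<in> lengths p (q s)" and st: "s \<in> {0..T}" "t \<in> {0..T}" "s \<noteq> t" for l s t
  proof -
    obtain a b \<gamma>1 where \<gamma>1: "l = curve_length A g a b \<gamma>1" "a < b" "piecewise_C1_curve A a b \<gamma>1" "\<gamma>1 a = p" "\<gamma>1 b = q s"
      using l unfolding lengths_def by blast
    define d where "d = b + \<bar>t - s\<bar>"
    define \<gamma>2 where "\<gamma>2 = (\<lambda>r. q (s + sgn (t - s) * (r - b)))"
    have \<gamma>2: "C1_curve A b d \<gamma>2" "curve_length A g b d \<gamma>2 \<le> v * \<bar>t - s\<bar>"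
      unfolding d_def \<gamma>2_def by (rule reparametrized_piece[OF H2 T st v]; assumption)+
    have bd: "b < d" using st(3) by (simp add: d_def)
    let ?\<gamma> = "\<lambda>t. if t \<le> b then \<gamma>1 t else \<gamma>2 t"
    have "\<gamma>1 b = \<gamma>2 b" "\<gamma>2 d = q t"
      using \<gamma>1(5) by (auto simp: \<gamma>2_def d_def sgn_if)
    then have "piecewise_C1_curve A a d ?\<gamma>" "?\<gamma> a = p" "?\<gamma> d = q t"
      using concat_piecewise_C1[OF \<gamma>1(2) bd \<gamma>1(3) \<gamma>2(1)] \<gamma>1 bd by auto
    then have "curve_length A g a d ?\<gamma> \<in> lengths p (q t)"
      unfolding lengths_def using \<gamma>1(2) bd by (intro CollectI exI[of _ a] exI[of _ d] exI[of _ ?\<gamma>]) auto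
    moreover have "curve_length A g a d ?\<gamma> \<le> l + v * \<bar>t - s\<bar>"
      using curve_length_concat_le[OF \<gamma>1(2) bd \<gamma>1(3) \<gamma>2(1)] \<gamma>2(2) \<gamma>1(1) by linarith
    ultimately show ?thesis by blast
  qed
  have v0: "0 \<le> v"
    using v[of 0] tangent_norm_nonneg[OF vel_tangent[OF H2 T, of 0]] T by simp
  show ?thesis
  proof (cases "lengths p (q s) = {}")
    case True
    then have "lengths p (q t) = {}" using extend[of _ t s] st False by blast
    then show ?thesis using True v0 by (simp add: riem_dist_lengths)
  next
    case nonempty: False
    have bdd: "bdd_below (lengths p (q t))"
      by (rule bdd_belowI[of _ 0]) (auto simp: lengths_def intro: curve_length_nonneg)
    have "Inf (lengths p (q t)) - v * \<bar>t - s\<bar> \<le> Inf (lengths p (q s))"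
    proof (rule cInf_greatest[OF nonempty])
      fix l assume "l \<in> lengths p (q s)"
      then obtain l' where l': "l' \<in> lengths p (q t)" "l' \<le> l + v * \<bar>t - s\<bar>"
        using extend st False by blast
      then show "Inf (lengths p (q t)) - v * \<bar>t - s\<bar> \<le> l"
        using cInf_lower[OF l'(1) bdd] by linarith
    qed
    then show ?thesis by (simp add: riem_dist_lengths)
  qed
qed simp

lemma smooth_function_continuous:
  assumes "smooth_function A V"
  shows "continuous_on UNIV V"
proof (rule continuous_at_imp_continuous_on, intro ballI)
  fix x
  obtain c where c: "c \<in> A" "x \<in> chart_dom c" using ex_chart by blast
  have "Ck_on 0 (chart_map c ` chart_dom c) (V \<circ> chart_inv c)"
    using assms c(1) unfolding smooth_function_def smooth_on_def by blast
  then have "continuous_on (chart_map c ` chart_dom c) (V \<circ> chart_inv c)" by simp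
  then have "continuous_on (chart_dom c) (\<lambda>x. (V \<circ> chart_inv c) (chart_map c x))"
    by (rule continuous_on_compose2[OF _ chart_map_continuous[OF c(1)]]) auto
  then have "continuous_on (chart_dom c) V"
    by (rule continuous_on_eq) (simp add: chart_inv_map[OF c(1)])
  then show "isCont V x" using continuous_on_eq_continuous_at[OF open_chart_dom[OF c(1)]] c(2) by blast
qed

lemma cost_J_split:
  assumes H2: "H2_curve A T q" and T: "T > 0" and V: "smooth_function A V" "\<And>x. V x \<ge> 0"
  shows "cost_J A g T V q = 1 / 2 * (integral {0..T} (\<lambda>t. g (q t) (acceleration A g {0..T} q t) (acceleration A g {0..T} q t))
     + integral {0..T} (\<lambda>t. V (q t)))"
    and "(\<lambda>t. V (q t)) integrable_on {0..T}"
proof -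
  let ?N2 = "\<lambda>t. g (q t) (acceleration A g {0..T} q t) (acceleration A g {0..T} q t)"
  let ?F = "\<lambda>t. (tangent_norm g (q t) (acceleration A g {0..T} q t))\<^sup>2 + V (q t)"
  have qc: "continuous_on {0..T} q" using H2 unfolding H2_curve_def by blast
  show Vi: "(\<lambda>t. V (q t)) integrable_on {0..T}"
    by (intro integrable_continuous_real continuous_on_compose2[OF smooth_function_continuous[OF V(1)] qc]) auto
  have Ni: "?N2 integrable_on {0..T}" using energy(1)[OF H2 T, of 0 T] T by auto
  have F: "?F t = ?N2 t + V (q t)" if "t \<in> {0..T}" for t
    using tangent_norm_sq[OF acc_tangent[OF H2 T that]] by simp
  have "?F integrable_on {0..T}"
    using integrable_add[OF Ni Vi] F by (metis (no_types, lifting) integrable_eq)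
  then have "?F absolutely_integrable_on {0..T}"
    using V(2) by (intro nonnegative_absolutely_integrable_1) auto
  then have "(LINT t:{0..T}|lebesgue. ?F t) = integral {0..T} ?F"
    by (rule set_lebesgue_integral_eq_integral)
  also have "\<dots> = integral {0..T} (\<lambda>t. ?N2 t + V (q t))"
    by (rule integral_cong) (rule F)
  also have "\<dots> = integral {0..T} ?N2 + integral {0..T} (\<lambda>t. V (q t))"
    by (rule integral_add[OF Ni Vi])
  finally show "cost_J A g T V q = 1 / 2 * (integral {0..T} ?N2 + integral {0..T} (\<lambda>t. V (q t)))"
    by (simp add: cost_J_def)
qed

end

section \<open>The obstacle avoidance theorem\<close>

theorem proposition2:
  fixes A :: "('q::{t2_space,second_countable_topology}, 'e::euclidean_space) chart set"
    and g :: "('q, 'e) metric"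
    and T r rstar R Vminus Vstar a c v :: real
    and q0 qT p :: 'q and v0 vT :: "('q, 'e) tangent"
    and V :: "'q \<Rightarrow> real" and \<Omega> :: "(real \<Rightarrow> 'q) set"
    and q qstar :: "real \<Rightarrow> 'q"
  assumes "complete_connected_riemannian_manifold A g"
    and "T > 0"
    and "(q0, v0) \<in> tangent_bundle A" and "(qT, vT) \<in> tangent_bundle A"
    and "0 < r" and "r < rstar" and "rstar < R"
    and "0 \<le> Vminus" and "Vminus \<le> Vstar"
    and "smooth_function A V" and "\<And>x. V x \<ge> 0"
    and "\<And>x. x \<in> riem_ball A g p rstar \<Longrightarrow> V x \<ge> Vstar"
    and "\<And>x. x \<notin> closure (riem_ball A g p R) \<Longrightarrow> V x \<le> Vminus"
    and "\<Omega> = admissible A T (q0, v0) (qT, vT)"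
    and "avoidance_feasible A g T p R \<Omega>"
    and "q \<in> \<Omega>" and "\<And>t. t \<in> {0..T} \<Longrightarrow> q t \<notin> closure (riem_ball A g p R)"
    and "bdd_above ((\<lambda>t. tangent_norm g (q t) (acceleration A g {0..T} q t)) ` {0..T})"
    and "a = (SUP t\<in>{0..T}. tangent_norm g (q t) (acceleration A g {0..T} q t))"
    and "c = (a\<^sup>2 + Vminus) * T"
    and "v = sqrt (c * T) + sqrt (c * T + (tangent_norm g q0 v0)\<^sup>2)"
    and "Vstar > c * v / (2 * (rstar - r))"
    and "is_minimizer (cost_J A g T V) \<Omega> qstar"
  shows "avoids A g T p r qstar"
proof -
  interpret riemannian A g
    using assms(1) unfolding complete_connected_riemannian_manifold_def by unfold_locales auto
  note T = \<open>T > 0\<close> and V = \<open>smooth_function A V\<close> \<open>\<And>x. V x \<ge> 0\<close>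
  have q: "H2_curve A T q" "q 0 = q0" "q T = qT"
    using assms(14,16) by (auto simp: admissible_def)
  have opt: "qstar \<in> \<Omega>" "cost_J A g T V qstar \<le> cost_J A g T V q"
    using assms(16,23) by (auto simp: is_minimizer_def)
  have qs: "H2_curve A T qstar" "qstar 0 = q0" "qstar T = qT" "velocity A {0..T} qstar 0 = v0"
    using opt(1) assms(14) by (auto simp: admissible_def)
  let ?N2 = "\<lambda>q t. g (q t) (acceleration A g {0..T} q t) (acceleration A g {0..T} q t)"
  have N2_nonneg: "0 \<le> ?N2 q t" if "H2_curve A T q" "t \<in> {0..T}" for q t
    using g_nonneg[OF acc_tangent[OF that(1) T that(2)]] .

  have "integral {0..T} (?N2 q) + integral {0..T} (\<lambda>t. V (q t)) \<le> c"
  proof -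
    have i: "?N2 q integrable_on {0..T}" "(\<lambda>t. V (q t)) integrable_on {0..T}"
      using energy(1)[OF q(1) T, of 0 T] cost_J_split(2)[OF q(1) T V] T by auto
    have "?N2 q t \<le> a\<^sup>2" if t: "t \<in> {0..T}" for t
    proof -
      let ?n = "tangent_norm g (q t) (acceleration A g {0..T} q t)"
      have "?n \<le> a" unfolding assms(19) using assms(18) t by (rule cSUP_upper[rotated])
      moreover have "0 \<le> ?n" by (rule tangent_norm_nonneg[OF acc_tangent[OF q(1) T t]])
      ultimately have "?n\<^sup>2 \<le> a\<^sup>2" by (rule power_mono)
      then show ?thesis using tangent_norm_sq[OF acc_tangent[OF q(1) T t]] by simp
    qed
    then have "integral {0..T} (?N2 q) \<le> integral {0..T} (\<lambda>_. a\<^sup>2)"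
      using i by (intro integral_le) auto
    moreover have "integral {0..T} (\<lambda>t. V (q t)) \<le> integral {0..T} (\<lambda>_. Vminus)"
      using i assms(13,17) by (intro integral_le) auto
    ultimately show ?thesis using T assms(20) by (simp add: algebra_simps)
  qed
  moreover have "integral {0..T} (?N2 qstar) + integral {0..T} (\<lambda>t. V (qstar t))
      \<le> integral {0..T} (?N2 q) + integral {0..T} (\<lambda>t. V (q t))"
    using opt(2) unfolding cost_J_split(1)[OF q(1) T V] cost_J_split(1)[OF qs(1) T V] by simp
  ultimately have star: "integral {0..T} (?N2 qstar) + integral {0..T} (\<lambda>t. V (qstar t)) \<le> c"
    by (rule order_trans[rotated])
  have Vi: "(\<lambda>t. V (qstar t)) integrable_on {0..T}" by (rule cost_J_split(2)[OF qs(1) T V])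
  have "0 \<le> integral {0..T} (?N2 qstar)"
    using energy(1)[OF qs(1) T, of 0 T] T N2_nonneg[OF qs(1)] by (intro integral_nonneg) auto
  then have V_le: "integral {0..T} (\<lambda>t. V (qstar t)) \<le> c" using star by linarith
  have "0 \<le> integral {0..T} (\<lambda>t. V (qstar t))" using Vi V(2) by (intro integral_nonneg) auto
  then have N_le: "integral {0..T} (?N2 qstar) \<le> c" using star by linarith
  have speed: "tangent_norm g (qstar t) (velocity A {0..T} qstar t) \<le> v" if "t \<in> {0..T}" for t
    using speed_bound[OF qs(1) T N_le that] qs assms(21) by simp
  have dist: "riem_dist A g p (qstar t) \<le> riem_dist A g p (qstar s) + v * \<bar>t - s\<bar>"
    if "s \<in> {0..T}" "t \<in> {0..T}" for s t
    by (rule riem_dist_speed_bound[OF qs(1) T speed that])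

  show ?thesis unfolding avoids_def
  proof (intro ballI notI)
    fix s assume s: "s \<in> {0..T}" and "qstar s \<in> riem_ball A g p r"
    then have close: "riem_dist A g p (qstar s) < r" by (simp add: riem_ball_def)
    \<comment> \<open>The end points of the minimizer are those of the reference curve, which lie outside the large ball.\<close>
    have far: "rstar < riem_dist A g p (qstar t)" if "t = 0 \<or> t = T" for t
    proof -
      have "qstar t = q t" "t \<in> {0..T}" using that q qs T by auto
      then have "qstar t \<notin> riem_ball A g p R" using assms(17) closure_subset by (metis subsetD)
      then show ?thesis using assms(7) by (simp add: riem_ball_def)
    qed
    have e0: "rstar - r < v * s" using far[of 0] dist[OF s, of 0] close s T by auto
    have eT: "rstar - r < v * (T - s)" using far[of T] dist[OF s, of T] close s T by auto
    have "0 < v * s" using e0 assms(6) by linarith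
    then have "v > 0" using s by (simp add: zero_less_mult_iff)
    \<comment> \<open>At speed at most \<open>v\<close>, leaving the ball of radius \<open>rstar\<close> from inside the small ball takes at least this time.\<close>
    define \<eta> where "\<eta> = (rstar - r) / v"
    have \<eta>: "\<eta> > 0" "v * \<eta> = rstar - r" using \<open>v > 0\<close> assms(6) by (simp_all add: \<eta>_def)
    have "\<eta> < s" "\<eta> < T - s" using e0 eT \<eta>(2) \<open>v > 0\<close> by (metis mult_less_cancel_left_pos)+
    then have sub: "{s-\<eta>..s+\<eta>} \<subseteq> {0..T}" by auto
    have "Vstar \<le> V (qstar t)" if t: "t \<in> {s-\<eta>..s+\<eta>}" for t
    proof (rule assms(12))
      have "v * \<bar>t - s\<bar> \<le> v * \<eta>" using t \<open>v > 0\<close> by (intro mult_left_mono) auto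
      then have "riem_dist A g p (qstar t) < rstar"
        using dist[OF s, of t] t sub close \<eta>(2) by auto
      then show "qstar t \<in> riem_ball A g p rstar" by (simp add: riem_ball_def)
    qed
    moreover have Vi': "(\<lambda>t. V (qstar t)) integrable_on {s-\<eta>..s+\<eta>}"
      using integrable_on_subinterval[OF Vi sub] .
    ultimately have "integral {s-\<eta>..s+\<eta>} (\<lambda>_. Vstar) \<le> integral {s-\<eta>..s+\<eta>} (\<lambda>t. V (qstar t))"
      by (intro integral_le) auto
    also have "\<dots> \<le> integral {0..T} (\<lambda>t. V (qstar t))"
      using Vi Vi' sub V(2) by (intro integral_subset_le) auto
    finally have "2 * \<eta> * Vstar \<le> c" using V_le \<eta>(1) by simp
    then have "2 * (rstar - r) * Vstar \<le> c * v"
      using \<open>v > 0\<close> by (simp add: \<eta>_def field_simps)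
    then show False using assms(22) assms(6) by (simp add: field_simps)
  qed
qed

end
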